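(* Assume that the coordinates $(x_1,x_2)$ are linearly adapted to $\phi$, where $\phi$ is smooth and of finite type and satisfies $\phi(0,0)=0$, $\nabla\phi(0,0)=0$. (a) If the coordinates $(x_1,x_2)$ are not adapted to $\phi$, then for every non-flat fractionally smooth, real function $f(x_1)$ and the corresponding fractional shear in $H^+$ respectively $H^-$, we have $h^f(\phi)\le h^r(\phi)$. Consequently, $h^r(\phi)=\tilde h^r(\phi)$. (b) If the coordinates $(x_1,x_2)$ are adapted to $\phi$, then $\tilde h^r(\phi)=d(\phi)=h(\phi)$. In particular, the critical exponent $p_c'$ (defined by $p_c':=2h(\phi)+2$ if the coordinates are adapted, and by $p_c':=2h^r(\phi)+2$ if they are not) is in all cases given by $p_c'=2\tilde h^r(\phi)+2$.
   Context: Newton notions. With Taylor series $\phi\sim\sum c_{\alpha_1,\alpha_2}x_1^{\alpha_1}x_2^{\alpha_2}$ at $0$ (finite type: not identically zero), the Taylor support is $\{\alpha\in\mathbb N^2:c_\alpha\ne0\}$ and the Newton polyhedron $\mathcal N(\phi)$ is the convex hull of the union of all quadrants $\alpha+\mathbb R_+^2$ with $\alpha$ in the Taylor support. The Newton distance $d=d(\phi)$: $(d,d)$ is the point where the bisectrix $t_1=t_2$ meets the boundary of $\mathcal N(\phi)$; the principal face $\pi(\phi)$ is the face (edge or vertex) of minimal dimension containing $(d,d)$; $\phi_{\rm pr}=\sum_{\alpha\in\pi(\phi)}c_\alpha x^\alpha$. A local coordinate system at the origin is a smooth coordinate system near $0$ preserving $0$; $d_y$ is the Newton distance of $\phi$ expressed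 in the coordinates $y$; the height is $h(\phi)=\sup_yd_y$; coordinates $x$ are adapted if $d_x=h(\phi)$. $h_{\rm lin}(\phi)=\sup\{d(\phi\circ T):T\in GL(2,\mathbb R)\}$, and a linear coordinate system $y$ is linearly adapted if $d_y=h_{\rm lin}(\phi)$. If $\pi(\phi)$ is a compact edge, lying on the line $L=\{\kappa_1t_1+\kappa_2t_2=1\}$, the coordinates are always permuted so that $0<\kappa_1\le\kappa_2$. If the coordinates are linearly adapted but not adapted, $\pi(\phi)$ is a compact edge, $m:=\kappa_2/\kappa_1$ is an integer $\ge2$, and $d=1/(\kappa_1+\kappa_2)$. Principal root jet (non-adapted case). $\psi$ is the smooth function near $0$ given by Varchenko's algorithm: when the coordinates are not adapted, $\phi_{\rm pr}$ has a unique real root $x_2=b_1x_1^{m_1}$ ($m_1=m$, $b_1\ne0$) of multiplicity $>d(\phi)$; pass to the coordinates $(x_1,x_2-b_1x_1^{m_1})$, and repeat as long as the new coordinates are not adapted, obtaining integers $m_1<m_2<\cdots$ and $b_k\ne0$. If one reaches adapted coordinates after $K$ steps, $\psi(x_1)=\sum_{k\le K}b_kx_1^{m_k}$; otherwise $\psi$ is a smooth function with Taylor series $\sum_kb_kx_1^{m_k}$. Put $\phi^a(y):=\phi(y_1,y_2+\psi(y_1))$. $r$-height (non-adapted case). Let $(A_l,B_l)$, $l=0,\dots,n$, be the vertices of $\mathcal N(\phi^a)$, $A_{l-1}<A_l$, with compact edges $\gamma_l=[(A_{l-1},B_{l-1}),(A_l,B_l)]$ contained in lines $\{\kappa_1^lt_1+\kappa_2^lt_2=1\}$,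 $a_l:=\kappa_2^l/\kappa_1^l$. For the unbounded horizontal edge put $\kappa^{n+1}=(0,1/B_n)$, $a_{n+1}=\infty$. Set $h_l=\frac{1+m\kappa_1^l-\kappa_2^l}{\kappa_1^l+\kappa_2^l}$ (so $h_{n+1}=B_n-1$) and $h^r(\phi):=\max\big(d,\max_{\{1\le l\le n+1:\,a_l>m\}}h_l\big)$. Fractional shears. $\mathbb R_\pm=\{x_1:\pm x_1>0\}$, $H^\pm=\mathbb R_\pm\times\mathbb R$. A function $f$ on $U\cap\mathbb R_\pm$ ($U$ a neighborhood of $0$) is fractionally smooth if $f(x_1)=g(|x_1|^{1/q})$ with $g$ smooth and an integer $q\ge1$; it is flat if $f(x_1)=O(|x_1|^N)$ for all $N$. A fractional shear in $H^\pm$ is a change of coordinates $y_1=x_1$, $y_2=x_2-f(x_1)$ with $f$ real-valued, fractionally smooth and not flat (preserving the origin, so $f(x_1)\to0$ as $x_1\to0$). Put $\phi^f(y):=\phi(y_1,y_2+f(y_1))$; it is a smooth function of $(|y_1|^{1/q},y_2)$ near the origin. If $\sum c_{\alpha_1,\alpha_2}|y_1|^{\alpha_1/q}y_2^{\alpha_2}$ is its formal Puiseux series, its Newton polyhedron $\mathcal N(\phi^f)$ is the convex hull of the union of all quadrants $(\alpha_1/q,\alpha_2)+\mathbb R_+^2$ with $c_{\alpha_1,\alpha_2}\ne0$. Let $m_0>0$ be the leading exponent of the formal Puiseux series of $f$. Let $\kappa^f$ be the weight with $\kappa^f_2/\kappa^f_1=m_0$ such that $L^f=\{\kappa_1^ft_1+\kappa_2^ft_2=1\}$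 is a supporting line to $\mathcal N(\phi^f)$, and let $(d^f,d^f)$ be the intersection of $L^f$ with the bisectrix. Let $(A^f_l,B^f_l)$, $l=0,\dots,n_f$, be the vertices of $\mathcal N(\phi^f)$, ordered so that $A^f_{l-1}<A^f_l$. For $l=1,\dots,n_f$ denote now by $\gamma_l=[(A^f_{l-1},B^f_{l-1}),(A^f_l,B^f_l)]$ the compact edges of $\mathcal N(\phi^f)$, by $\kappa^l$ the weight such that $\gamma_l$ is contained in the line $\{\kappa_1^lt_1+\kappa_2^lt_2=1\}$, and put $a_l=\kappa_2^l/\kappa_1^l$; for the unbounded horizontal edge $\gamma_{n_f+1}$ with left endpoint $(A^f_{n_f},B^f_{n_f})$ put $\kappa^{n_f+1}=(0,1/B^f_{n_f})$ and $a_{n_f+1}=\infty$. For $1\le l\le n_f+1$ put $h_l^f=\frac{1+m_0\kappa_1^l-\kappa_2^l}{\kappa_1^l+\kappa_2^l}$ (so $h^f_{n_f+1}=B^f_{n_f}-1$) and $$h^f(\phi)=\max\big(d^f,\max_{\{l:\,a_l>m_0\}}h^f_l\big).$$ Finally $\tilde h^r(\phi):=\sup_fh^f(\phi)$, the supremum being over all non-flat fractionally smooth real functions $f(x_1)$ of $x_1>0$ (fractional shears in $H^+$) or of $x_1<0$ (fractional shears in $H^-$). *)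

theory Defs
  imports
    "HOL-Analysis.Analysis"
    "HOL-Library.Landau_Symbols"
    "HOL-Computational_Algebra.Polynomial"
begin

section \<open>Smooth germs at the origin and their Taylor coefficients\<close>

primrec Ck_on :: "nat \<Rightarrow> 'a::real_normed_vector set \<Rightarrow> ('a \<Rightarrow> 'b::real_normed_vector) \<Rightarrow> bool" where
  "Ck_on 0 U f \<longleftrightarrow> continuous_on U f"
| "Ck_on (Suc n) U f \<longleftrightarrow>
     (\<forall>x\<in>U. f differentiable (at x)) \<and> (\<forall>v. Ck_on n U (\<lambda>x. frechet_derivative f (at x) v))"

definition smooth_on :: "'a::real_normed_vector set \<Rightarrow> ('a \<Rightarrow> 'b::real_normed_vector) \<Rightarrow> bool" where
  "smooth_on U f \<longleftrightarrow> (\<forall>n. Ck_on n U f)"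

definition smooth_near_0 :: "('a::real_normed_vector \<Rightarrow> 'b::real_normed_vector) \<Rightarrow> bool" where
  "smooth_near_0 f \<longleftrightarrow> (\<exists>U. open U \<and> 0 \<in> U \<and> smooth_on U f)"

definition dir_deriv :: "real \<times> real \<Rightarrow> (real \<times> real \<Rightarrow> real) \<Rightarrow> real \<times> real \<Rightarrow> real" where
  "dir_deriv v f = (\<lambda>x. frechet_derivative f (at x) v)"

definition taylor_coeff :: "(real \<times> real \<Rightarrow> real) \<Rightarrow> nat \<Rightarrow> nat \<Rightarrow> real" where
  "taylor_coeff f a b =
     ((dir_deriv (1, 0) ^^ a) ((dir_deriv (0, 1) ^^ b) f)) (0, 0) / (fact a * fact b)"

definition taylor_coeff1 :: "(real \<Rightarrow> real) \<Rightarrow> nat \<Rightarrow> real" where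
  "taylor_coeff1 g a = (deriv ^^ a) g 0 / fact a"

definition finite_type :: "(real \<times> real \<Rightarrow> real) \<Rightarrow> bool" where
  "finite_type \<phi> \<longleftrightarrow> (\<exists>a b. taylor_coeff \<phi> a b \<noteq> 0)"


section \<open>Newton polyhedra\<close>

definition taylor_support :: "(real \<times> real \<Rightarrow> real) \<Rightarrow> (real \<times> real) set" where
  "taylor_support \<phi> = {(real a, real b) | a b. taylor_coeff \<phi> a b \<noteq> 0}"

text \<open>Supports are subsets of the real plane because those of Puiseux series have
  fractional first components.\<close>

definition newton_hull :: "(real \<times> real) set \<Rightarrow> (real \<times> real) set" where
  "newton_hull S = convex hull (\<Union>\<alpha>\<in>S. {t. fst \<alpha> \<le> fst t \<and> snd \<alpha> \<le> snd t})"

definition newton_polyhedron :: "(real \<times> real \<Rightarrow> real) \<Rightarrow> (real \<times> real) set" where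
  "newton_polyhedron \<phi> = newton_hull (taylor_support \<phi>)"

definition newton_distance :: "(real \<times> real \<Rightarrow> real) \<Rightarrow> real" where
  "newton_distance \<phi> = (THE d. (d, d) \<in> frontier (newton_polyhedron \<phi>))"

definition principal_face :: "(real \<times> real \<Rightarrow> real) \<Rightarrow> (real \<times> real) set" where
  "principal_face \<phi> =
     (let N = newton_polyhedron \<phi>; d = newton_distance \<phi> in
      THE F. F face_of N \<and> (d, d) \<in> F \<and>
             (\<forall>G. G face_of N \<and> (d, d) \<in> G \<longrightarrow> aff_dim F \<le> aff_dim G))"

definition compact_edges :: "(real \<times> real) set \<Rightarrow> (real \<times> real) set set" where
  "compact_edges N = {e. e edge_of N \<and> compact e}"

definition edge_weight :: "(real \<times> real) set \<Rightarrow> real \<times> real" where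
  "edge_weight e = (THE \<kappa>. e \<subseteq> {t. \<kappa> \<bullet> t = 1})"

definition last_vertex :: "(real \<times> real) set \<Rightarrow> real \<times> real" where
  "last_vertex N = (THE v. v extreme_point_of N \<and> (\<forall>w. w extreme_point_of N \<longrightarrow> fst w \<le> fst v))"

text \<open>The principal part as a polynomial in \<open>x\<^sub>2\<close> with coefficients in \<open>\<real>[x\<^sub>1]\<close>.
  It is meaningful only if the principal face is compact, since otherwise the sum may
  range over an infinite set.\<close>

definition principal_part :: "(real \<times> real \<Rightarrow> real) \<Rightarrow> real poly poly" where
  "principal_part \<phi> =
     (\<Sum>(a, b) \<in> {(a, b). taylor_coeff \<phi> a b \<noteq> 0 \<and> (real a, real b) \<in> principal_face \<phi>}.
        monom (monom (taylor_coeff \<phi> a b) a) b)"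

text \<open>The convention on the order of the coordinates when the principal face is a
  compact edge.\<close>

definition normalized_order :: "(real \<times> real \<Rightarrow> real) \<Rightarrow> bool" where
  "normalized_order \<phi> \<longleftrightarrow>
     (principal_face \<phi> \<in> compact_edges (newton_polyhedron \<phi>) \<longrightarrow>
        (let \<kappa> = edge_weight (principal_face \<phi>) in 0 < fst \<kappa> \<and> fst \<kappa> \<le> snd \<kappa>))"

definition principal_slope :: "(real \<times> real \<Rightarrow> real) \<Rightarrow> real" where
  "principal_slope \<phi> = (let \<kappa> = edge_weight (principal_face \<phi>) in snd \<kappa> / fst \<kappa>)"


section \<open>Heights and adapted coordinates\<close>

text \<open>\<open>local_coordinates \<Phi>\<close>: \<open>\<Phi>\<close> is the map \<open>x = \<Phi> y\<close> from the new to the old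
  coordinates, so that \<open>\<phi>\<close> is expressed by \<open>\<phi> \<circ> \<Phi>\<close> in the coordinates \<open>y\<close>.\<close>

definition local_coordinates :: "(real \<times> real \<Rightarrow> real \<times> real) \<Rightarrow> bool" where
  "local_coordinates \<Phi> \<longleftrightarrow> \<Phi> 0 = 0 \<and>
     (\<exists>U V \<Psi>. open U \<and> 0 \<in> U \<and> open V \<and> homeomorphism U V \<Phi> \<Psi> \<and>
        smooth_on U \<Phi> \<and> smooth_on V \<Psi>)"

definition height :: "(real \<times> real \<Rightarrow> real) \<Rightarrow> ereal" where
  "height \<phi> = (SUP \<Phi> \<in> {\<Phi>. local_coordinates \<Phi>}. ereal (newton_distance (\<phi> \<circ> \<Phi>)))"

definition adapted :: "(real \<times> real \<Rightarrow> real) \<Rightarrow> bool" where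
  "adapted \<phi> \<longleftrightarrow> ereal (newton_distance \<phi>) = height \<phi>"

definition linear_height :: "(real \<times> real \<Rightarrow> real) \<Rightarrow> ereal" where
  "linear_height \<phi> = (SUP T \<in> {T. linear T \<and> bij T}. ereal (newton_distance (\<phi> \<circ> T)))"

definition linearly_adapted :: "(real \<times> real \<Rightarrow> real) \<Rightarrow> bool" where
  "linearly_adapted \<phi> \<longleftrightarrow> ereal (newton_distance \<phi>) = linear_height \<phi>"


section \<open>Shears and the principal root jet\<close>

definition shear :: "(real \<times> real \<Rightarrow> real) \<Rightarrow> (real \<Rightarrow> real) \<Rightarrow> real \<times> real \<Rightarrow> real" where
  "shear \<phi> f = (\<lambda>y. \<phi> (fst y, snd y + f (fst y)))"

text \<open>\<open>x\<^sub>2 = b x\<^sub>1^m\<close> is a root of the principal part of multiplicity greater than the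
  Newton distance, the principal face being a compact edge of weight ratio \<open>m\<close>.\<close>

definition varchenko_root :: "(real \<times> real \<Rightarrow> real) \<Rightarrow> nat \<Rightarrow> real \<Rightarrow> bool" where
  "varchenko_root \<phi> m b \<longleftrightarrow>
     principal_face \<phi> \<in> compact_edges (newton_polyhedron \<phi>) \<and>
     real m = principal_slope \<phi> \<and> b \<noteq> 0 \<and>
     real (order (monom b m) (principal_part \<phi>)) > newton_distance \<phi>"

definition jet_sum :: "(nat \<Rightarrow> nat) \<Rightarrow> (nat \<Rightarrow> real) \<Rightarrow> nat \<Rightarrow> real \<Rightarrow> real" where
  "jet_sum m b k = (\<lambda>x. \<Sum>j<k. b j * x ^ m j)"

definition varchenko_steps ::
  "(real \<times> real \<Rightarrow> real) \<Rightarrow> (nat \<Rightarrow> nat) \<Rightarrow> (nat \<Rightarrow> real) \<Rightarrow> nat set \<Rightarrow> bool" where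
  "varchenko_steps \<phi> m b I \<longleftrightarrow> strict_mono_on I m \<and>
     (\<forall>k\<in>I. \<not> adapted (shear \<phi> (jet_sum m b k)) \<and>
             varchenko_root (shear \<phi> (jet_sum m b k)) (m k) (b k))"

text \<open>The first disjunct is the case that Varchenko's algorithm stops after \<open>K\<close> steps, the
  second one the case that it does not stop; in the latter, \<open>\<psi>\<close> is determined only up
  to a flat function. Steps are counted from 0.\<close>

definition principal_root_jet :: "(real \<times> real \<Rightarrow> real) \<Rightarrow> (real \<Rightarrow> real) \<Rightarrow> bool" where
  "principal_root_jet \<phi> \<psi> \<longleftrightarrow>
     (\<exists>m b. (\<exists>K. varchenko_steps \<phi> m b {..<K} \<and> adapted (shear \<phi> (jet_sum m b K)) \<and>
                 \<psi> = jet_sum m b K) \<or>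
            (varchenko_steps \<phi> m b UNIV \<and> smooth_near_0 \<psi> \<and>
             (\<forall>k. taylor_coeff1 \<psi> (m k) = b k) \<and>
             (\<forall>j. j \<notin> range m \<longrightarrow> taylor_coeff1 \<psi> j = 0)))"


section \<open>The r-height\<close>

text \<open>The numbers \<open>h\<^sub>l\<close> over the edges with \<open>a\<^sub>l > \<mu>\<close>. The unbounded horizontal edge,
  for which \<open>a\<^sub>l = \<infinity>\<close>, contributes \<open>B - 1\<close>; the general expression cannot be used
  there, as its weight \<open>(0, 1/B)\<close> is undefined for \<open>B = 0\<close>.\<close>

definition edge_heights :: "real \<Rightarrow> (real \<times> real) set \<Rightarrow> real set" where
  "edge_heights \<mu> N =
     insert (snd (last_vertex N) - 1)
       {(1 + \<mu> * \<kappa>1 - \<kappa>2) / (\<kappa>1 + \<kappa>2) | \<kappa>1 \<kappa>2.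
          (\<exists>e\<in>compact_edges N. (\<kappa>1, \<kappa>2) = edge_weight e) \<and> \<kappa>2 / \<kappa>1 > \<mu>}"

definition r_height :: "(real \<times> real \<Rightarrow> real) \<Rightarrow> (real \<Rightarrow> real) \<Rightarrow> real" where
  "r_height \<phi> \<psi> =
     max (newton_distance \<phi>)
         (Max (edge_heights (principal_slope \<phi>) (newton_polyhedron (shear \<phi> \<psi>))))"

definition critical_exponent :: "(real \<times> real \<Rightarrow> real) \<Rightarrow> (real \<Rightarrow> real) \<Rightarrow> ereal" where
  "critical_exponent \<phi> \<psi> =
     (if adapted \<phi> then 2 * height \<phi> + 2 else ereal (2 * r_height \<phi> \<psi> + 2))"


section \<open>Fractional shears\<close>

text \<open>\<open>H\<close> is one of the half-lines \<open>{0<..}\<close>, \<open>{..<0}\<close>; functions on \<open>H\<close> matter only as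
  germs at 0.\<close>

definition fractional_rep :: "real set \<Rightarrow> (real \<Rightarrow> real) \<Rightarrow> nat \<Rightarrow> (real \<Rightarrow> real) \<Rightarrow> bool" where
  "fractional_rep H f q g \<longleftrightarrow> q \<ge> 1 \<and> smooth_near_0 g \<and>
     (\<forall>\<^sub>F x in at 0 within H. f x = g (root q \<bar>x\<bar>))"

definition flat :: "real set \<Rightarrow> (real \<Rightarrow> real) \<Rightarrow> bool" where
  "flat H f \<longleftrightarrow> (\<forall>N::nat. f \<in> O[at 0 within H](\<lambda>x. \<bar>x\<bar> ^ N))"

definition fractional_shear :: "real set \<Rightarrow> (real \<Rightarrow> real) \<Rightarrow> bool" where
  "fractional_shear H f \<longleftrightarrow> H \<in> {{0<..}, {..<0}} \<and> (\<exists>q g. fractional_rep H f q g) \<and>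
     \<not> flat H f \<and> (f \<longlongrightarrow> 0) (at 0 within H)"

text \<open>In the next two definitions the exponents do not depend on the representation by
  \<open>q\<close> and a smooth function: the values on \<open>H\<close> determine the Taylor series of the
  latter for a given \<open>q\<close>, and two representations can be compared at the product of
  their denominators. Hence the union over all representations is the set of exponents
  of any single one.\<close>

definition leading_exponent :: "real set \<Rightarrow> (real \<Rightarrow> real) \<Rightarrow> real" where
  "leading_exponent H f =
     Inf {real a / real q | a q. \<exists>g. fractional_rep H f q g \<and> taylor_coeff1 g a \<noteq> 0}"

definition puiseux_support :: "real set \<Rightarrow> (real \<times> real \<Rightarrow> real) \<Rightarrow> (real \<times> real) set" where
  "puiseux_support H F =
     {(real a / real q, real b) | a b q. q \<ge> 1 \<and>
        (\<exists>G. smooth_near_0 G \<and>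
             (\<forall>\<^sub>F y in at 0 within H \<times> UNIV. F y = G (root q \<bar>fst y\<bar>, snd y)) \<and>
             taylor_coeff G a b \<noteq> 0)}"

definition supporting_weight :: "real \<Rightarrow> (real \<times> real) set \<Rightarrow> real \<times> real" where
  "supporting_weight \<mu> N =
     (THE \<kappa>. 0 < fst \<kappa> \<and> snd \<kappa> / fst \<kappa> = \<mu> \<and>
             N \<subseteq> {t. \<kappa> \<bullet> t \<ge> 1} \<and> N \<inter> {t. \<kappa> \<bullet> t = 1} \<noteq> {})"

definition fractional_height ::
  "real set \<Rightarrow> (real \<times> real \<Rightarrow> real) \<Rightarrow> (real \<Rightarrow> real) \<Rightarrow> real" where
  "fractional_height H \<phi> f =
     (let N = newton_hull (puiseux_support H (shear \<phi> f));
          m0 = leading_exponent H f;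
          \<kappa> = supporting_weight m0 N;
          d = (THE d. \<kappa> \<bullet> (d, d) = 1)
      in max d (Max (edge_heights m0 N)))"

definition r_height_tilde :: "(real \<times> real \<Rightarrow> real) \<Rightarrow> ereal" where
  "r_height_tilde \<phi> =
     (SUP (H, f) \<in> {(H, f). fractional_shear H f}. ereal (fractional_height H \<phi> f))"

end

theory Submission
  imports Defs
begin

text \<open>
  For a curve \<open>x\<^sub>2 = f(x\<^sub>1)\<close> and \<open>a > 0\<close> let \<open>\<nu>\<^sub>f(a)\<close> be the order of vanishing in \<open>x\<^sub>1\<close> of
  \<open>\<phi>(x\<^sub>1, f(x\<^sub>1) + c x\<^sub>1\<^sup>a)\<close> for generic \<open>c\<close>, that is, the minimum of \<open>\<alpha>\<^sub>1 + a \<alpha>\<^sub>2\<close> over the support of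
  \<open>\<phi>\<^sup>f\<close>. If \<open>f - g = \<gamma> x\<^sub>1\<^sup>a + o(x\<^sub>1\<^sup>a)\<close>, then \<open>\<nu>\<^sub>f(a) = \<nu>\<^sub>g(a)\<close>, and the \<open>a\<close>-homogeneous initial
  polynomials, dehomogenized at \<open>x\<^sub>1 = 1\<close>, differ by the translation by \<open>\<gamma>\<close>. Moreover
  \<open>h\<^sup>f = sup\<^bsub>a \<ge> m\<^sub>0\<^esub> (\<nu>\<^sub>f(a) + m\<^sub>0 - a) / (1 + a)\<close>, where \<open>a = m\<^sub>0\<close> yields \<open>d\<^sup>f\<close> and \<open>a = \<infinity>\<close> the
  horizontal edge.

  Let \<open>f\<close> branch off from the principal root jet \<open>\<psi>\<close> with \<open>f - \<psi> \<sim> \<gamma> x\<^sub>1\<^sup>a\<close>, \<open>\<gamma> \<noteq> 0\<close>. Then \<open>\<gamma>\<close> is a root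
  of the initial polynomial of \<open>\<phi>\<^sup>\<psi>\<close> of multiplicity at most \<open>D = \<nu>\<^sub>\<psi>(a) / (1 + a)\<close>: a nonzero
  root has multiplicity less than the number of monomials, which settles the faces on one side of the
  bisectrix and those of nonintegral slope; for an integral slope a root of larger multiplicity would
  contradict either adaptedness or the multiplicity of the root chosen in Varchenko's algorithm.
  Hence \<open>\<nu>\<^sub>f(a') \<le> (1 + a') D\<close> for \<open>a' \<ge> a\<close>, so that the heights over slopes \<open>a' \<ge> a\<close> do not exceed the
  one at \<open>a\<close>, where \<open>f\<close> and \<open>\<psi>\<close> still agree.
\<close>

section \<open>Calculus of smooth functions\<close>

text \<open>The germs are merely smooth, so series are never substituted into each other. Orders and
  initial polynomials are read off from limits of \<open>F x (x^a t) / x^\<nu>\<close> as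
  \<open>x\<close> decreases to 0; in such a limit a shear by \<open>\<gamma> x^a + o(x^a)\<close>
  becomes the replacement of \<open>t\<close> by \<open>t + \<gamma>\<close>, and flat errors
  disappear. The half-plane \<open>x1 < 0\<close> is pulled back to \<open>x > 0\<close> by a sign
  \<open>\<sigma>\<close>. Multiplicities enter because the translation by \<open>\<gamma>\<close>
  turns the multiplicity of \<open>\<gamma>\<close> into the least exponent of \<open>x2\<close> on
  the face. The edges of the polyhedra of two curves need not match, so heights are not compared
  edge by edge: every bound is stated for the order at all slopes \<open>a \<ge> m0\<close>. A curve
  leaving \<open>\<psi>\<close> at or before its first exponent \<open>m\<close> may have
  \<open>m0\<close> different from \<open>m\<close>; the target is then the distance
  \<open>d\<close>, which bounds \<open>D\<close> because \<open>\<psi>\<close> does not change the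
  order at such a slope. In the adapted case the supremum need not be attained: for
  \<open>x2^2\<close> the distance is 2 and every height is smaller. It is approached through curves
  with rational exponents.\<close>

lemma Ck_on_cong:
  assumes "open U" "\<And>x. x \<in> U \<Longrightarrow> f x = g x"
  shows "Ck_on n U f \<longleftrightarrow> Ck_on n U g"
  using assms(2)
proof (induction n arbitrary: f g)
  case 0
  then show ?case by (simp cong: continuous_on_cong)
next
  case (Suc n)
  have has: "(f has_derivative D) (at x) \<longleftrightarrow> (g has_derivative D) (at x)" if "x \<in> U" for x D
    using has_derivative_transform_within_open[OF _ assms(1) that, of f D UNIV g]
      has_derivative_transform_within_open[OF _ assms(1) that, of g D UNIV f] Suc.prems by auto
  then have "f differentiable (at x) \<longleftrightarrow> g differentiable (at x)" if "x \<in> U" for x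
    using that unfolding differentiable_def by blast
  moreover have "frechet_derivative f (at x) = frechet_derivative g (at x)" if "x \<in> U" for x
    using has[OF that] unfolding frechet_derivative_def by simp
  ultimately show ?case
    using Suc.IH[of "\<lambda>x. frechet_derivative f (at x) v" "\<lambda>x. frechet_derivative g (at x) v" for v]
    by simp
qed

lemma Ck_on_has_derivative:
  assumes "Ck_on (Suc n) U f" "x \<in> U"
  shows "(f has_derivative frechet_derivative f (at x)) (at x)"
proof -
  have "f differentiable (at x)"
    using assms by simp
  then show ?thesis
    by (rule iffD1[OF frechet_derivative_works])
qed

lemma Ck_on_Suc_imp: "Ck_on (Suc n) U f \<Longrightarrow> Ck_on n U f"
proof (induction n arbitrary: f)
  case 0
  then show ?case
    by (auto intro!: continuous_at_imp_continuous_on differentiable_imp_continuous_within)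
next
  case (Suc n)
  then show ?case by (metis Ck_on.simps(2))
qed

lemma Ck_on_subset: "Ck_on n U f \<Longrightarrow> U' \<subseteq> U \<Longrightarrow> Ck_on n U' f"
  by (induction n arbitrary: f) (auto intro: continuous_on_subset)

lemma Ck_on_const: "Ck_on n U (\<lambda>_. c)"
  by (induction n arbitrary: c) auto

lemma Ck_on_add:
  assumes "open U" "Ck_on n U f" "Ck_on n U g"
  shows "Ck_on n U (\<lambda>x. f x + g x)"
  using assms(2,3)
proof (induction n arbitrary: f g)
  case 0
  then show ?case by (simp add: continuous_on_add)
next
  case (Suc n)
  have "Ck_on n U (\<lambda>x. frechet_derivative (\<lambda>x. f x + g x) (at x) v)" for v
  proof -
    have "Ck_on n U (\<lambda>x. frechet_derivative f (at x) v + frechet_derivative g (at x) v)"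
      using Suc by simp
    moreover have "frechet_derivative f (at x) v + frechet_derivative g (at x) v
        = frechet_derivative (\<lambda>x. f x + g x) (at x) v" if "x \<in> U" for x
    proof -
      have "(f has_derivative frechet_derivative f (at x)) (at x)"
        "(g has_derivative frechet_derivative g (at x)) (at x)"
        using Suc.prems that Ck_on_has_derivative by blast+
      from has_derivative_add[OF this] show ?thesis
        using fun_cong[OF frechet_derivative_at] by blast
    qed
    ultimately show ?thesis by (rule iffD1[OF Ck_on_cong[OF assms(1)], rotated])
  qed
  then show ?case using Suc.prems by (auto intro: differentiable_add)
qed

lemma Ck_on_bounded_linear:
  assumes "open U" "bounded_linear L" "Ck_on n U f"
  shows "Ck_on n U (\<lambda>x. L (f x))"
  using assms(3)
proof (induction n arbitrary: f)
  case 0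
  then show ?case
    by (simp add: bounded_linear.continuous_on[OF assms(2)])
next
  case (Suc n)
  have D: "((\<lambda>x. L (f x)) has_derivative (\<lambda>v. L (frechet_derivative f (at x) v))) (at x)"
    if "x \<in> U" for x
    using bounded_linear.has_derivative[OF assms(2) Ck_on_has_derivative[OF Suc.prems that]] .
  have "Ck_on n U (\<lambda>x. frechet_derivative (\<lambda>x. L (f x)) (at x) v)" for v
  proof -
    have "Ck_on n U (\<lambda>x. L (frechet_derivative f (at x) v))"
      using Suc by simp
    moreover have "L (frechet_derivative f (at x) v)
        = frechet_derivative (\<lambda>x. L (f x)) (at x) v" if "x \<in> U" for x
      using fun_cong[OF frechet_derivative_at[OF D[OF that]]] .
    ultimately show ?thesis by (rule iffD1[OF Ck_on_cong[OF assms(1)], rotated])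
  qed
  then show ?case using D by (auto simp: differentiable_def)
qed

lemma Ck_on_linear:
  assumes "bounded_linear L"
  shows "Ck_on n U L"
proof (cases n)
  case (Suc k)
  have "(L has_derivative L) (at x)" for x
    using assms bounded_linear_imp_has_derivative by blast
  then have "frechet_derivative L (at x) = L" "L differentiable (at x)" for x
    using frechet_derivative_at[of L L] differentiableI[of L L] by auto
  then show ?thesis by (simp add: Suc Ck_on_const)
qed (simp add: assms linear_continuous_on)

lemma Ck_on_mult:
  fixes f g :: "'a::real_normed_vector \<Rightarrow> real"
  assumes "open U" "Ck_on n U f" "Ck_on n U g"
  shows "Ck_on n U (\<lambda>x. f x * g x)"
  using assms(2,3)
proof (induction n arbitrary: f g)
  case 0
  then show ?case by (simp add: continuous_on_mult)
next
  case (Suc n)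
  have D: "((\<lambda>x. f x * g x) has_derivative
      (\<lambda>v. f x * frechet_derivative g (at x) v + frechet_derivative f (at x) v * g x)) (at x)"
    if "x \<in> U" for x
    using has_derivative_mult[OF Ck_on_has_derivative[OF Suc.prems(1) that]
        Ck_on_has_derivative[OF Suc.prems(2) that]] .
  have "Ck_on n U (\<lambda>x. frechet_derivative (\<lambda>x. f x * g x) (at x) v)" for v
  proof -
    have "Ck_on n U (\<lambda>x. f x * frechet_derivative g (at x) v + frechet_derivative f (at x) v * g x)"
      using Suc.prems Suc.prems[THEN Ck_on_Suc_imp]
      by (intro Ck_on_add[OF assms(1)] Suc.IH) auto
    moreover have "f x * frechet_derivative g (at x) v + frechet_derivative f (at x) v * g x
        = frechet_derivative (\<lambda>x. f x * g x) (at x) v" if "x \<in> U" for x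
      using fun_cong[OF frechet_derivative_at[OF D[OF that]]] .
    ultimately show ?thesis by (rule iffD1[OF Ck_on_cong[OF assms(1)], rotated])
  qed
  then show ?case using D by (auto simp: differentiable_def)
qed

lemma Ck_on_sum:
  fixes f :: "'i \<Rightarrow> 'a::real_normed_vector \<Rightarrow> 'b::real_normed_vector"
  assumes "open U" "\<And>i. i \<in> I \<Longrightarrow> Ck_on n U (f i)"
  shows "Ck_on n U (\<lambda>x. \<Sum>i\<in>I. f i x)"
proof (cases "finite I")
  case True
  then show ?thesis using assms(2)
    by (induction I) (auto simp: Ck_on_const intro!: Ck_on_add[OF assms(1)])
qed (simp add: Ck_on_const)

text \<open>The chain rule differentiates \<open>f\<close> in a direction that varies with
  \<open>x\<close>, while \<open>Ck_on\<close> controls fixed directions only. Expanding the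
  direction in the basis gives a finite sum of products, to which the closure lemmas and the
  induction hypothesis apply.\<close>

lemma Ck_on_compose:
  fixes f :: "'b::euclidean_space \<Rightarrow> real" and g :: "'a::real_normed_vector \<Rightarrow> 'b"
  assumes "open U" "Ck_on n V f" "Ck_on n U g" "g ` U \<subseteq> V"
  shows "Ck_on n U (\<lambda>x. f (g x))"
  using assms(2,3)
proof (induction n arbitrary: f)
  case 0
  then show ?case using assms(4)
    by (simp add: continuous_on_compose2[of V f U g])
next
  case (Suc n)
  have D: "((\<lambda>x. f (g x)) has_derivative
      (\<lambda>v. frechet_derivative f (at (g x)) (frechet_derivative g (at x) v))) (at x)"
    if "x \<in> U" for x
  proof -
    have "(f has_derivative frechet_derivative f (at (g x))) (at (g x))"
      "(g has_derivative frechet_derivative g (at x)) (at x)"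
      using Suc.prems that assms(4) Ck_on_has_derivative by blast+
    then show ?thesis using has_derivative_compose by blast
  qed
  have "Ck_on n U (\<lambda>x. frechet_derivative (\<lambda>x. f (g x)) (at x) v)" for v
  proof -
    have "Ck_on n U (\<lambda>x. \<Sum>i\<in>Basis. (frechet_derivative g (at x) v \<bullet> i) *
        frechet_derivative f (at (g x)) i)"
    proof (intro Ck_on_sum Ck_on_mult assms(1))
      fix i :: 'b
      show "Ck_on n U (\<lambda>x. frechet_derivative g (at x) v \<bullet> i)"
        using Suc.prems by (intro Ck_on_bounded_linear[OF assms(1) bounded_linear_inner_left]) auto
      show "Ck_on n U (\<lambda>x. frechet_derivative f (at (g x)) i)"
        using Suc.IH[of "\<lambda>z. frechet_derivative f (at z) i"] Suc.prems Ck_on_Suc_imp by auto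
    qed
    moreover have "(\<Sum>i\<in>Basis. (frechet_derivative g (at x) v \<bullet> i) *
        frechet_derivative f (at (g x)) i)
        = frechet_derivative (\<lambda>x. f (g x)) (at x) v" if "x \<in> U" for x
    proof -
      have "f differentiable (at (g x))"
        using Suc.prems that assms(4) by auto
      then have L: "linear (frechet_derivative f (at (g x)))"
        by (rule linear_frechet_derivative)
      have "frechet_derivative (\<lambda>x. f (g x)) (at x) v
          = frechet_derivative f (at (g x)) (frechet_derivative g (at x) v)"
        using fun_cong[OF frechet_derivative_at[OF D[OF that]], symmetric] .
      also have "\<dots> = frechet_derivative f (at (g x))
          (\<Sum>i\<in>Basis. (frechet_derivative g (at x) v \<bullet> i) *\<^sub>R i)"
        by (simp add: euclidean_representation)
      finally show ?thesis
        by (simp add: linear_sum[OF L] linear_cmul[OF L])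
    qed
    ultimately show ?thesis by (rule iffD1[OF Ck_on_cong[OF assms(1)], rotated])
  qed
  then show ?case using D by (auto simp: differentiable_def)
qed

lemma Ck_on_power:
  fixes f :: "'a::real_normed_vector \<Rightarrow> real"
  assumes "open U" "Ck_on n U f"
  shows "Ck_on n U (\<lambda>x. f x ^ k)"
proof (induction k)
  case (Suc k)
  then show ?case using Ck_on_mult[OF assms] by simp
qed (simp add: Ck_on_const)

lemma Ck_on_Pair:
  assumes "open U" "Ck_on n U f" "Ck_on n U g"
  shows "Ck_on n U (\<lambda>x. (f x, g x))"
proof -
  have "Ck_on n U (\<lambda>x. (f x, 0) + (0, g x))"
    using assms
    by (intro Ck_on_add Ck_on_bounded_linear[where L = "\<lambda>u. (u, 0)"]
        Ck_on_bounded_linear[where L = "\<lambda>u. (0, u)"] bounded_linear_intros)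
      (auto simp: bounded_linear_Pair bounded_linear_zero bounded_linear_ident)
  then show ?thesis by simp
qed

lemma smooth_near_0I: "open U \<Longrightarrow> 0 \<in> U \<Longrightarrow> (\<And>n. Ck_on n U f) \<Longrightarrow> smooth_near_0 f"
  unfolding smooth_near_0_def smooth_on_def by blast

lemma smooth_near_0E:
  assumes "smooth_near_0 f"
  obtains U where "open U" "0 \<in> U" "\<forall>n. Ck_on n U f"
proof -
  obtain U where "open U \<and> 0 \<in> U \<and> smooth_on U f"
    using assms unfolding smooth_near_0_def ..
  then show ?thesis
    using that[of U] unfolding smooth_on_def by blast
qed

lemma smooth_near_0_linear: "bounded_linear L \<Longrightarrow> smooth_near_0 L"
  unfolding smooth_near_0_def smooth_on_def using Ck_on_linear open_UNIV by blast

lemma smooth_near_0_const: "smooth_near_0 (\<lambda>_. c)"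
  unfolding smooth_near_0_def smooth_on_def using Ck_on_const open_UNIV by blast

lemma smooth_near_0_common:
  assumes "smooth_near_0 f" "smooth_near_0 g"
  obtains U where "open U" "0 \<in> U" "\<forall>n. Ck_on n U f" "\<forall>n. Ck_on n U g"
proof -
  obtain U where U: "open U" "0 \<in> U" "\<forall>n. Ck_on n U f"
    by (rule smooth_near_0E[OF assms(1)])
  obtain V where V: "open V" "0 \<in> V" "\<forall>n. Ck_on n V g"
    by (rule smooth_near_0E[OF assms(2)])
  show ?thesis
    by (rule that[of "U \<inter> V"]) (auto simp: U(1,2) V(1,2) open_Int
        intro: Ck_on_subset[OF spec[OF U(3)]] Ck_on_subset[OF spec[OF V(3)]])
qed

lemma smooth_near_0_add:
  assumes "smooth_near_0 f" "smooth_near_0 g"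
  shows "smooth_near_0 (\<lambda>x. f x + g x)"
proof -
  obtain U where U: "open U" "0 \<in> U" "\<forall>n. Ck_on n U f" "\<forall>n. Ck_on n U g"
    by (rule smooth_near_0_common[OF assms])
  show ?thesis
    by (rule smooth_near_0I[OF U(1,2)]) (rule Ck_on_add[OF U(1) spec[OF U(3)] spec[OF U(4)]])
qed

lemma smooth_near_0_mult:
  fixes f g :: "'a::real_normed_vector \<Rightarrow> real"
  assumes "smooth_near_0 f" "smooth_near_0 g"
  shows "smooth_near_0 (\<lambda>x. f x * g x)"
proof -
  obtain U where U: "open U" "0 \<in> U" "\<forall>n. Ck_on n U f" "\<forall>n. Ck_on n U g"
    by (rule smooth_near_0_common[OF assms])
  show ?thesis
    by (rule smooth_near_0I[OF U(1,2)]) (rule Ck_on_mult[OF U(1) spec[OF U(3)] spec[OF U(4)]])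
qed

lemma smooth_near_0_power:
  fixes f :: "'a::real_normed_vector \<Rightarrow> real"
  assumes "smooth_near_0 f"
  shows "smooth_near_0 (\<lambda>x. f x ^ k)"
proof (induction k)
  case (Suc k)
  then show ?case using smooth_near_0_mult[OF assms] by simp
qed (simp add: smooth_near_0_const)

lemma smooth_near_0_sum:
  fixes f :: "'i \<Rightarrow> 'a::real_normed_vector \<Rightarrow> real"
  assumes "\<And>i. i \<in> I \<Longrightarrow> smooth_near_0 (f i)"
  shows "smooth_near_0 (\<lambda>x. \<Sum>i\<in>I. f i x)"
proof (cases "finite I")
  case True
  then show ?thesis using assms
    by (induction I) (simp_all add: smooth_near_0_const smooth_near_0_add)
qed (simp add: smooth_near_0_const)

lemma smooth_near_0_Pair:
  assumes "smooth_near_0 f" "smooth_near_0 g"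
  shows "smooth_near_0 (\<lambda>x. (f x, g x))"
proof -
  obtain U where U: "open U" "0 \<in> U" "\<forall>n. Ck_on n U f" "\<forall>n. Ck_on n U g"
    by (rule smooth_near_0_common[OF assms])
  show ?thesis
    by (rule smooth_near_0I[OF U(1,2)]) (rule Ck_on_Pair[OF U(1) spec[OF U(3)] spec[OF U(4)]])
qed

lemma smooth_near_0_compose:
  fixes f :: "'b::euclidean_space \<Rightarrow> real" and g :: "'a::real_normed_vector \<Rightarrow> 'b"
  assumes "smooth_near_0 f" "smooth_near_0 g" "g 0 = 0"
  shows "smooth_near_0 (\<lambda>x. f (g x))"
proof -
  obtain V where V: "open V" "0 \<in> V" "\<forall>n. Ck_on n V f"
    by (rule smooth_near_0E[OF assms(1)])
  obtain U where U: "open U" "0 \<in> U" "\<forall>n. Ck_on n U g"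
    by (rule smooth_near_0E[OF assms(2)])
  \<comment> \<open>The composition is controlled only where \<open>g\<close> lands in the
    neighbourhood belonging to \<open>f\<close>; \<open>g 0 = 0\<close> keeps the origin
    inside.\<close>
  define W where "W = U \<inter> g -` V"
  have "continuous_on U g"
    using spec[OF U(3), of 0] by simp
  then have W: "open W"
    using continuous_open_preimage[of U g V] U(1) V(1) by (simp add: W_def)
  have "Ck_on n W (\<lambda>x. f (g x))" for n
    by (rule Ck_on_compose[OF W spec[OF V(3)] Ck_on_subset[OF spec[OF U(3)]]]) (auto simp: W_def)
  moreover have "0 \<in> W"
    using U(2) V(2) assms(3) by (simp add: W_def)
  ultimately show ?thesis
    by (intro smooth_near_0I[OF W])
qed

section \<open>Taylor estimates\<close>

text \<open>Extends \<open>dir_deriv\<close> to arbitrary normed spaces, so that germs in one and in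
  two variables share one Taylor formula.\<close>

definition dirder :: "'a::real_normed_vector \<Rightarrow> ('a \<Rightarrow> real) \<Rightarrow> 'a \<Rightarrow> real" where
  "dirder v f = (\<lambda>x. frechet_derivative f (at x) v)"

lemma dir_deriv_eq_dirder: "dir_deriv = dirder"
  by (intro ext) (simp add: dir_deriv_def dirder_def)

lemma Ck_on_dirder: "Ck_on (Suc n) U f \<Longrightarrow> Ck_on n U (dirder v f)"
  by (simp add: dirder_def)

lemma Ck_on_funpow_dirder: "(\<forall>n. Ck_on n U f) \<Longrightarrow> Ck_on n U ((dirder v ^^ k) f)"
proof (induction k arbitrary: n)
  case (Suc k)
  then have "Ck_on (Suc n) U ((dirder v ^^ k) f)"
    by blast
  then show ?case
    using Ck_on_dirder[of n U "(dirder v ^^ k) f" v] by simp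
qed simp

text \<open>Along the line the iterated directional derivatives are ordinary derivatives of a
  function of one variable, so Maclaurin's formula with Lagrange remainder applies. It is used in
  its two-sided form, hence the condition on both sides of \<open>p\<close>.\<close>

lemma Taylor_along_line:
  fixes f :: "'a::real_normed_vector \<Rightarrow> real"
  assumes f: "\<forall>n. Ck_on n U f" and U: "\<And>t. \<bar>t\<bar> \<le> \<bar>\<tau>\<bar> \<Longrightarrow> p + t *\<^sub>R v \<in> U"
  shows "\<exists>t. \<bar>t\<bar> \<le> \<bar>\<tau>\<bar> \<and>
    f (p + \<tau> *\<^sub>R v) = (\<Sum>m<N. (dirder v ^^ m) f p / fact m * \<tau> ^ m)
      + (dirder v ^^ N) f (p + t *\<^sub>R v) / fact N * \<tau> ^ N"
proof -
  define diff where "diff m t = (dirder v ^^ m) f (p + t *\<^sub>R v)" for m t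
  have "(diff m has_real_derivative diff (Suc m) t) (at t)" if "\<bar>t\<bar> \<le> \<bar>\<tau>\<bar>" for m t
  proof -
    let ?h = "(dirder v ^^ m) f"
    have "Ck_on (Suc 0) U ?h"
      by (rule Ck_on_funpow_dirder[OF f])
    from Ck_on_has_derivative[OF this U[OF that]]
    have D: "(?h has_derivative frechet_derivative ?h (at (p + t *\<^sub>R v))) (at (p + t *\<^sub>R v))" .
    have "((\<lambda>t. p + t *\<^sub>R v) has_derivative (\<lambda>h. h *\<^sub>R v)) (at t)"
      by (auto intro!: derivative_eq_intros)
    from has_derivative_compose[OF this D]
    have "((\<lambda>t. ?h (p + t *\<^sub>R v)) has_derivative
        (\<lambda>h. frechet_derivative ?h (at (p + t *\<^sub>R v)) (h *\<^sub>R v))) (at t)" .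
    moreover
    have "frechet_derivative ?h (at (p + t *\<^sub>R v)) (h *\<^sub>R v)
        = h * frechet_derivative ?h (at (p + t *\<^sub>R v)) v" for h
      using has_derivative_linear[OF D] by (simp add: linear_cmul)
    then have "(\<lambda>h. frechet_derivative ?h (at (p + t *\<^sub>R v)) (h *\<^sub>R v)) = (*) (dirder v ?h (p + t *\<^sub>R v))"
      by (auto simp: dirder_def)
    ultimately show ?thesis
      unfolding diff_def has_field_derivative_def by simp
  qed
  then have "\<forall>m t. m < N \<and> \<bar>t\<bar> \<le> \<bar>\<tau>\<bar> \<longrightarrow> DERIV (diff m) t :> diff (Suc m) t"
    by blast
  from Maclaurin_bi_le[of diff, OF refl this] show ?thesis
    by (simp add: diff_def)
qed

lemma open_contains_box:
  fixes U :: "(real \<times> real) set"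
  assumes "open U" "0 \<in> U"
  shows "\<exists>r>0. r \<le> 1 \<and> (\<forall>s y. \<bar>s\<bar> \<le> r \<longrightarrow> \<bar>y\<bar> \<le> r \<longrightarrow> (s, y) \<in> U)"
proof -
  obtain e where e: "e > 0" "cball 0 e \<subseteq> U"
    using assms open_contains_cball by blast
  have "(s, y) \<in> U" if "\<bar>s\<bar> \<le> min 1 (e / 2)" "\<bar>y\<bar> \<le> min 1 (e / 2)" for s y
  proof -
    have "norm (s, y) \<le> \<bar>s\<bar> + \<bar>y\<bar>"
      using norm_Pair_le[of s y] by simp
    then have "norm (s, y) \<le> e"
      using that by simp
    then show ?thesis using e(2) by auto
  qed
  then show ?thesis
    using e(1) by (intro exI[of _ "min 1 (e / 2)"]) simp
qed

lemma Ck_on_bounded_on_compact: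
  fixes f :: "'a::real_normed_vector \<Rightarrow> real"
  assumes "Ck_on n U f" "compact K" "K \<subseteq> U"
  shows "\<exists>M. \<forall>x\<in>K. \<bar>f x\<bar> \<le> M"
proof -
  have "Ck_on 0 U f"
    using assms(1) by (induction n) (use Ck_on_Suc_imp in blast)+
  then have "continuous_on K f"
    using assms(3) continuous_on_subset by auto
  then have "bounded (f ` K)"
    using assms(2) compact_continuous_image compact_imp_bounded by blast
  then show ?thesis
    unfolding bounded_iff by auto
qed

text \<open>Expanding in \<open>x\<^sub>2\<close> first and then expanding the coefficients in \<open>x\<^sub>1\<close> produces the coefficients in
  the order of differentiation of \<open>taylor_coeff\<close>, so that the symmetry of mixed derivatives is not needed.\<close>

lemma taylor_estimate:
  fixes G :: "real \<times> real \<Rightarrow> real"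
  assumes "smooth_near_0 G"
  shows "\<exists>C r. 0 < r \<and> r \<le> 1 \<and> 0 \<le> C \<and> (\<forall>s y. \<bar>s\<bar> \<le> r \<longrightarrow> \<bar>y\<bar> \<le> r \<longrightarrow>
      \<bar>G (s, y) - (\<Sum>a<N. \<Sum>b<N. taylor_coeff G a b * s ^ a * y ^ b)\<bar> \<le> C * (\<bar>s\<bar> ^ N + \<bar>y\<bar> ^ N))"
proof -
  obtain U where U: "open U" "0 \<in> U" "\<forall>n. Ck_on n U G"
    by (rule smooth_near_0E[OF assms])
  obtain r where r: "0 < r" "r \<le> 1" "\<And>s y. \<bar>s\<bar> \<le> r \<Longrightarrow> \<bar>y\<bar> \<le> r \<Longrightarrow> (s, y) \<in> U"
    using open_contains_box[OF U(1,2)] by blast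
  define K where "K = {-r..r} \<times> {-r..r}"
  have K: "compact K" "K \<subseteq> U" "\<And>s y. \<bar>s\<bar> \<le> r \<Longrightarrow> \<bar>y\<bar> \<le> r \<Longrightarrow> (s, y) \<in> K"
    using r(3) by (auto simp: K_def compact_Times abs_le_iff)
  define D where "D b = (dirder (0, 1) ^^ b) G" for b
  have D: "\<forall>n. Ck_on n U (D b)" for b
    unfolding D_def using Ck_on_funpow_dirder[OF U(3)] by blast
  obtain M where M: "\<And>x. x \<in> K \<Longrightarrow> \<bar>D N x\<bar> \<le> M"
    using Ck_on_bounded_on_compact[OF spec[OF D] K(1,2)] by blast
  have "\<exists>L. \<forall>b. \<forall>x\<in>K. \<bar>(dirder (1, 0) ^^ N) (D b) x\<bar> \<le> L b"
  proof -
    have "\<exists>M. \<forall>x\<in>K. \<bar>(dirder (1, 0) ^^ N) (D b) x\<bar> \<le> M" for b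
      by (rule Ck_on_bounded_on_compact[OF Ck_on_funpow_dirder[OF D] K(1,2)])
    then show ?thesis by metis
  qed
  then obtain L where L: "\<And>b x. x \<in> K \<Longrightarrow> \<bar>(dirder (1, 0) ^^ N) (D b) x\<bar> \<le> L b"
    by blast
  have K0: "(0, 0) \<in> K"
    using r(1) K(3) by simp
  have M0: "0 \<le> M" and L0: "0 \<le> L b" for b
    using order_trans[OF abs_ge_zero M[OF K0]] order_trans[OF abs_ge_zero L[OF K0]] by auto
  \<comment> \<open>\<open>M\<close> bounds the remainder in \<open>x2\<close> and
    \<open>L b\<close> the remainder in \<open>x1\<close> of the coefficient of
    \<open>y ^ b\<close>; the factorials and the powers of \<open>y\<close> only help, as
    \<open>\<bar>y\<bar> \<le> 1\<close>.\<close>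
  define C where "C = M + (\<Sum>b<N. L b)"
  have "\<bar>G (s, y) - (\<Sum>a<N. \<Sum>b<N. taylor_coeff G a b * s ^ a * y ^ b)\<bar> \<le> C * (\<bar>s\<bar> ^ N + \<bar>y\<bar> ^ N)"
    if s: "\<bar>s\<bar> \<le> r" and y: "\<bar>y\<bar> \<le> r" for s y
  proof -
    have "(s, 0) + t *\<^sub>R (0, 1) \<in> U" if "\<bar>t\<bar> \<le> \<bar>y\<bar>" for t
      using r(3)[of s t] s y that by simp
    from Taylor_along_line[OF U(3) this, where N = N]
    obtain t where t: "\<bar>t\<bar> \<le> \<bar>y\<bar>"
      "G (s, y) = (\<Sum>b<N. D b (s, 0) / fact b * y ^ b) + D N (s, t) / fact N * y ^ N"
      by (auto simp: D_def)
    have "\<exists>u. \<bar>u\<bar> \<le> \<bar>s\<bar> \<and> D b (s, 0) = (\<Sum>a<N. taylor_coeff G a b * fact b * s ^ a)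
        + (dirder (1, 0) ^^ N) (D b) (u, 0) / fact N * s ^ N" for b
    proof -
      have "(0, 0) + t *\<^sub>R (1, 0) \<in> U" if "\<bar>t\<bar> \<le> \<bar>s\<bar>" for t
        using r(1) r(3)[of t 0] s that by simp
      from Taylor_along_line[OF D[of b] this, where N = N]
      have "\<exists>u. \<bar>u\<bar> \<le> \<bar>s\<bar> \<and> D b (s, 0) = (\<Sum>m<N. (dirder (1, 0) ^^ m) (D b) (0, 0) / fact m * s ^ m)
        + (dirder (1, 0) ^^ N) (D b) (u, 0) / fact N * s ^ N"
        by simp
      moreover have "(dirder (1, 0) ^^ m) (D b) (0, 0) / fact m = taylor_coeff G m b * fact b" for m
        by (simp add: taylor_coeff_def D_def dir_deriv_eq_dirder)
      ultimately show ?thesis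
        by simp
    qed
    then have "\<forall>b. \<exists>u. \<bar>u\<bar> \<le> \<bar>s\<bar> \<and> D b (s, 0) = (\<Sum>a<N. taylor_coeff G a b * fact b * s ^ a)
        + (dirder (1, 0) ^^ N) (D b) (u, 0) / fact N * s ^ N"
      by blast
    from choice[OF this] obtain u where u: "\<And>b. \<bar>u b\<bar> \<le> \<bar>s\<bar>"
      "\<And>b. D b (s, 0) = (\<Sum>a<N. taylor_coeff G a b * fact b * s ^ a)
        + (dirder (1, 0) ^^ N) (D b) (u b, 0) / fact N * s ^ N"
      by blast
    define R where "R b = (dirder (1, 0) ^^ N) (D b) (u b, 0)" for b
    have "(\<Sum>b<N. D b (s, 0) / fact b * y ^ b)
        = (\<Sum>b<N. (\<Sum>a<N. taylor_coeff G a b * s ^ a * y ^ b) + R b / fact N / fact b * s ^ N * y ^ b)"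
      by (rule sum.cong[OF refl])
        (simp add: u(2) R_def[symmetric] field_simps sum_distrib_left sum_divide_distrib)
    also have "\<dots> = (\<Sum>a<N. \<Sum>b<N. taylor_coeff G a b * s ^ a * y ^ b)
        + (\<Sum>b<N. R b / fact N / fact b * s ^ N * y ^ b)"
      unfolding sum.distrib by (rule arg_cong2[OF sum.swap refl])
    finally have "G (s, y) - (\<Sum>a<N. \<Sum>b<N. taylor_coeff G a b * s ^ a * y ^ b)
        = (\<Sum>b<N. R b / fact N / fact b * s ^ N * y ^ b) + D N (s, t) / fact N * y ^ N"
      using t(2) by simp
    moreover have "\<bar>D N (s, t) / fact N * y ^ N\<bar> \<le> M * \<bar>y\<bar> ^ N"
    proof -
      have "\<bar>D N (s, t)\<bar> / fact N \<le> M / 1"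
        using M[OF K(3)[of s t]] s y t(1) M0 by (intro frac_le) auto
      then have "\<bar>D N (s, t)\<bar> / fact N * \<bar>y\<bar> ^ N \<le> M * \<bar>y\<bar> ^ N"
        by (intro mult_right_mono) auto
      then show ?thesis
        by (simp add: abs_mult power_abs)
    qed
    moreover have "\<bar>\<Sum>b<N. R b / fact N / fact b * s ^ N * y ^ b\<bar> \<le> (\<Sum>b<N. L b) * \<bar>s\<bar> ^ N"
    proof -
      have "\<bar>R b / fact N / fact b * s ^ N * y ^ b\<bar> \<le> L b * \<bar>s\<bar> ^ N" for b
      proof -
        have "\<bar>R b\<bar> \<le> L b"
          unfolding R_def using L[OF K(3)[of "u b" 0]] u(1)[of b] s r(1) by simp
        moreover have "(1::real) \<le> fact N * fact b"
          by (metis fact_ge_1 mult_mono' mult_1 zero_le_one)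
        ultimately have "\<bar>R b\<bar> / (fact N * fact b) \<le> L b / 1"
          using L0 by (intro frac_le) auto
        moreover have "\<bar>y\<bar> ^ b \<le> 1"
          using y r(2) by (simp add: power_le_one)
        ultimately have "\<bar>R b\<bar> / (fact N * fact b) * (\<bar>s\<bar> ^ N * \<bar>y\<bar> ^ b) \<le> L b * (\<bar>s\<bar> ^ N * 1)"
          using L0 by (intro mult_mono) auto
        then show ?thesis
          by (simp add: abs_mult power_abs)
      qed
      then show ?thesis
        unfolding sum_distrib_right by (intro order_trans[OF sum_abs] sum_mono)
    qed
    moreover have "M * \<bar>y\<bar> ^ N \<le> C * \<bar>y\<bar> ^ N" "(\<Sum>b<N. L b) * \<bar>s\<bar> ^ N \<le> C * \<bar>s\<bar> ^ N"
      using M0 L0 by (auto simp: C_def sum_nonneg intro!: mult_right_mono)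
    ultimately show ?thesis
      unfolding distrib_left by linarith
  qed
  moreover have "0 \<le> C"
    using M0 L0 by (simp add: C_def sum_nonneg)
  ultimately show ?thesis
    using r(1,2) by blast
qed

text \<open>Links the iterated \<open>deriv\<close> of \<open>taylor_coeff1\<close> to
  \<open>dirder\<close>. The induction runs over all points of \<open>U\<close>, because each
  further derivative looks at a whole neighbourhood.\<close>

lemma funpow_deriv_eq_dirder:
  assumes "\<forall>n. Ck_on n U g" "open U" "x \<in> U"
  shows "(deriv ^^ k) g x = (dirder 1 ^^ k) g x"
  using assms(3)
proof (induction k arbitrary: x)
  case (Suc k)
  let ?h = "(dirder 1 ^^ k) g"
  have "Ck_on (Suc 0) U ?h"
    by (rule Ck_on_funpow_dirder[OF assms(1)])
  from Ck_on_has_derivative[OF this Suc.prems]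
  have D: "(?h has_derivative frechet_derivative ?h (at x)) (at x)" .
  have "frechet_derivative ?h (at x) = (\<lambda>h. frechet_derivative ?h (at x) 1 * h)"
  proof
    fix h :: real
    show "frechet_derivative ?h (at x) h = frechet_derivative ?h (at x) 1 * h"
      using linear_cmul[OF has_derivative_linear[OF D], of h 1] by simp
  qed
  then have "(?h has_real_derivative frechet_derivative ?h (at x) 1) (at x)"
    using D unfolding has_field_derivative_def by simp
  then have "deriv ?h x = dirder 1 ?h x"
    unfolding dirder_def by (rule DERIV_imp_deriv)
  moreover have "deriv ((deriv ^^ k) g) x = deriv ?h x"
    by (rule deriv_cong_ev[OF eventually_mono[OF eventually_nhds_in_open[OF assms(2) Suc.prems]] refl])
      (rule Suc.IH)
  ultimately show ?case by simp
qed simp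

lemma taylor_estimate1:
  fixes g :: "real \<Rightarrow> real"
  assumes "smooth_near_0 g"
  shows "\<exists>C r. 0 < r \<and> r \<le> 1 \<and> 0 \<le> C \<and>
    (\<forall>s. \<bar>s\<bar> \<le> r \<longrightarrow> \<bar>g s - (\<Sum>a<N. taylor_coeff1 g a * s ^ a)\<bar> \<le> C * \<bar>s\<bar> ^ N)"
proof -
  obtain U where U: "open U" "0 \<in> U" "\<forall>n. Ck_on n U g"
    by (rule smooth_near_0E[OF assms])
  obtain e where e: "e > 0" "cball 0 e \<subseteq> U"
    using U(1,2) open_contains_cball by blast
  define r where "r = min 1 e"
  have r: "0 < r" "r \<le> 1" "cball 0 r \<subseteq> U"
    using e by (auto simp: r_def)
  obtain M where M: "\<And>x. x \<in> cball 0 r \<Longrightarrow> \<bar>(dirder 1 ^^ N) g x\<bar> \<le> M"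
    using Ck_on_bounded_on_compact[OF Ck_on_funpow_dirder[OF U(3)] compact_cball r(3)] by blast
  have M0: "0 \<le> M"
    using order_trans[OF abs_ge_zero M[of 0]] r(1) by simp
  have "\<bar>g s - (\<Sum>a<N. taylor_coeff1 g a * s ^ a)\<bar> \<le> M * \<bar>s\<bar> ^ N" if s: "\<bar>s\<bar> \<le> r" for s
  proof -
    have "0 + t *\<^sub>R 1 \<in> U" if "\<bar>t\<bar> \<le> \<bar>s\<bar>" for t
      using r(3) s that by auto
    from Taylor_along_line[OF U(3) this, where N = N]
    obtain t where t: "\<bar>t\<bar> \<le> \<bar>s\<bar>"
      "g s = (\<Sum>a<N. taylor_coeff1 g a * s ^ a) + (dirder 1 ^^ N) g t / fact N * s ^ N"
      by (auto simp: taylor_coeff1_def funpow_deriv_eq_dirder[OF U(3,1,2)])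
    have "\<bar>(dirder 1 ^^ N) g t\<bar> / fact N \<le> M / 1"
      using M[of t] s t(1) M0 by (intro frac_le) auto
    then have "\<bar>(dirder 1 ^^ N) g t\<bar> / fact N * \<bar>s\<bar> ^ N \<le> M * \<bar>s\<bar> ^ N"
      by (intro mult_right_mono) auto
    then show ?thesis
      using t(2) by (simp add: abs_mult power_abs)
  qed
  then show ?thesis
    using r(1,2) M0 by blast
qed

section \<open>Supports and weighted orders\<close>

text \<open>Exponents of \<open>x1\<close> are multiples of \<open>1 / q\<close>, those of
  \<open>x2\<close> are integers. This discreteness makes minima of positive weights
  attained.\<close>

definition lattice_set :: "nat \<Rightarrow> (real \<times> real) set \<Rightarrow> bool" where
  "lattice_set q S \<longleftrightarrow> q > 0 \<and> (\<forall>p\<in>S. \<exists>k b. p = (real k / real q, real b))"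

text \<open>The number \<open>\<nu>(a)\<close> of the overview, that is, the support function of the
  Newton polyhedron in the direction \<open>(1, a)\<close>.\<close>

definition weighted_order :: "(real \<times> real) set \<Rightarrow> real \<Rightarrow> real" where
  "weighted_order S a = Inf ((\<lambda>p. fst p + a * snd p) ` S)"

lemma lattice_set_nonneg: "lattice_set q S \<Longrightarrow> p \<in> S \<Longrightarrow> 0 \<le> fst p \<and> 0 \<le> snd p"
  unfolding lattice_set_def by force

lemma finite_lattice_box:
  assumes "lattice_set q S"
  shows "finite {p \<in> S. fst p \<le> M \<and> snd p \<le> L}"
proof (rule finite_subset)
  have q: "q > 0" using assms by (simp add: lattice_set_def)
  show "{p \<in> S. fst p \<le> M \<and> snd p \<le> L}
      \<subseteq> (\<lambda>(k, b). (real k / real q, real b)) ` ({..nat \<lfloor>M * q\<rfloor>} \<times> {..nat \<lfloor>L\<rfloor>})"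
  proof
    fix p assume p: "p \<in> {p \<in> S. fst p \<le> M \<and> snd p \<le> L}"
    then obtain k b where kb: "p = (real k / real q, real b)"
      using assms unfolding lattice_set_def by blast
    then have "real k \<le> M * q" "real b \<le> L"
      using p q by (auto simp: field_simps)
    then have "k \<le> nat \<lfloor>M * q\<rfloor>" "b \<le> nat \<lfloor>L\<rfloor>"
      by (auto simp: le_nat_floor)
    then show "p \<in> (\<lambda>(k, b). (real k / real q, real b)) ` ({..nat \<lfloor>M * q\<rfloor>} \<times> {..nat \<lfloor>L\<rfloor>})"
      using kb by (intro image_eqI[of _ _ "(k, b)"]) auto
  qed
qed auto

lemma finite_lattice_le:
  assumes "lattice_set q S" "a > 0"
  shows "finite {p \<in> S. fst p + a * snd p \<le> L}"
proof (rule finite_subset[OF _ finite_lattice_box[OF assms(1), of L "L / a"]])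
  show "{p \<in> S. fst p + a * snd p \<le> L} \<subseteq> {p \<in> S. fst p \<le> L \<and> snd p \<le> L / a}"
  proof safe
    fix x y assume p: "(x, y) \<in> S" "fst (x, y) + a * snd (x, y) \<le> L"
    then have "0 \<le> x" "0 \<le> y"
      using lattice_set_nonneg[OF assms(1)] by auto
    moreover have "0 \<le> a * y"
      using \<open>0 \<le> y\<close> assms(2) by simp
    ultimately show "fst (x, y) \<le> L" "snd (x, y) \<le> L / a"
      using p(2) unfolding pos_le_divide_eq[OF assms(2)] fst_conv snd_conv mult.commute[of y]
      by linarith+
  qed
qed

text \<open>Only finitely many lattice points weigh at most as much as a given one, so the infimum
  is a minimum.\<close>

lemma weighted_order_attained:
  assumes "lattice_set q S" "S \<noteq> {}" "a > 0"
  shows "\<exists>p\<in>S. fst p + a * snd p = weighted_order S a"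
    and "p \<in> S \<Longrightarrow> weighted_order S a \<le> fst p + a * snd p"
proof -
  obtain p0 where p0: "p0 \<in> S" using assms(2) by blast
  let ?f = "\<lambda>p. fst p + a * snd p"
  let ?T = "{p \<in> S. ?f p \<le> ?f p0}"
  have fin: "finite ?T"
    by (rule finite_lattice_le[OF assms(1,3)])
  obtain m where m: "m \<in> ?T" "\<And>p. p \<in> ?T \<Longrightarrow> ?f m \<le> ?f p"
    using arg_min_if_finite[OF fin, of ?f] p0 by (metis (mono_tags, lifting) empty_Collect_eq
        linorder_not_le order_refl)
  have min: "?f m \<le> ?f p" if "p \<in> S" for p
  proof (cases "?f p \<le> ?f p0")
    case False
    then show ?thesis using m(1) by auto
  qed (use m(2) that in auto)
  have "weighted_order S a = ?f m"
    unfolding weighted_order_def using m(1) min by (intro cInf_eq_minimum) auto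
  then show "\<exists>p\<in>S. fst p + a * snd p = weighted_order S a"
    and "p \<in> S \<Longrightarrow> weighted_order S a \<le> fst p + a * snd p"
    using m(1) min by auto
qed

section \<open>Puiseux expansions\<close>

definition coeff_support :: "(real \<Rightarrow> nat \<Rightarrow> real) \<Rightarrow> (real \<times> real) set" where
  "coeff_support c = {(\<alpha>, real b) | \<alpha> b. c \<alpha> b \<noteq> 0}"

definition puiseux_trunc :: "(real \<Rightarrow> nat \<Rightarrow> real) \<Rightarrow> nat \<Rightarrow> (real \<times> nat) set" where
  "puiseux_trunc c N = {(\<alpha>, b). c \<alpha> b \<noteq> 0 \<and> \<alpha> < real N \<and> b < N}"

abbreviation puiseux_sum :: "(real \<Rightarrow> nat \<Rightarrow> real) \<Rightarrow> nat \<Rightarrow> real \<Rightarrow> real \<Rightarrow> real" where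
  "puiseux_sum c N x y \<equiv> \<Sum>(\<alpha>, b)\<in>puiseux_trunc c N. c \<alpha> b * x powr \<alpha> * y ^ b"

text \<open>Purely asymptotic and restricted to \<open>x > 0\<close>: no derivative of
  \<open>F\<close> is mentioned, so shears by fractionally smooth functions are covered. The error
  \<open>x ^ N + \<bar>y\<bar> ^ N\<close> is what remains when both exponents are cut off at
  \<open>N\<close>.\<close>

definition puiseux_expansion :: "(real \<Rightarrow> real \<Rightarrow> real) \<Rightarrow> (real \<Rightarrow> nat \<Rightarrow> real) \<Rightarrow> bool" where
  "puiseux_expansion F c \<longleftrightarrow> (\<exists>q. lattice_set q (coeff_support c)) \<and>
     (\<forall>N. \<exists>C r. 0 < r \<and> (\<forall>x y. 0 < x \<longrightarrow> x < r \<longrightarrow> \<bar>y\<bar> < r \<longrightarrow>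
        \<bar>F x y - puiseux_sum c N x y\<bar>
          \<le> C * (x ^ N + \<bar>y\<bar> ^ N)))"

text \<open>The \<open>a\<close>-homogeneous part of weight \<open>\<nu>\<close>, dehomogenized at \<open>x\<^sub>1 = 1\<close>.\<close>

definition weighted_part :: "(real \<Rightarrow> nat \<Rightarrow> real) \<Rightarrow> real \<Rightarrow> real \<Rightarrow> real poly" where
  "weighted_part c a \<nu> = (\<Sum>b\<le>nat \<lfloor>\<nu> / a\<rfloor>. monom (c (\<nu> - a * real b) b) b)"

lemma coeff_supportI: "c \<alpha> b \<noteq> 0 \<Longrightarrow> (\<alpha>, real b) \<in> coeff_support c"
  by (auto simp: coeff_support_def)

lemma lattice_coeff:
  assumes "lattice_set q (coeff_support c)" "c \<alpha> b \<noteq> 0"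
  shows "\<exists>k. \<alpha> = real k / real q"
proof -
  have "\<exists>k j. (\<alpha>, real b) = (real k / real q, real j)"
    using coeff_supportI[of c \<alpha> b] assms unfolding lattice_set_def by blast
  then show ?thesis by blast
qed

lemma lattice_coeff_support:
  assumes "q > 0" "\<And>\<alpha> b. c \<alpha> b \<noteq> 0 \<Longrightarrow> \<exists>k. \<alpha> = real k / real q"
  shows "lattice_set q (coeff_support c)"
  unfolding lattice_set_def
proof (intro conjI ballI)
  fix p assume "p \<in> coeff_support c"
  then obtain \<alpha> b where p: "p = (\<alpha>, real b)" "c \<alpha> b \<noteq> 0"
    unfolding coeff_support_def by blast
  from assms(2)[OF this(2)] obtain k where "\<alpha> = real k / real q" ..
  with p show "\<exists>k b. p = (real k / real q, real b)" by blast
qed (rule assms(1))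

lemma puiseux_expansion_estimate:
  assumes "puiseux_expansion F c"
  shows "\<exists>C r. 0 < r \<and> (\<forall>x y. 0 < x \<longrightarrow> x < r \<longrightarrow> \<bar>y\<bar> < r \<longrightarrow>
        \<bar>F x y - puiseux_sum c N x y\<bar>
          \<le> C * (x ^ N + \<bar>y\<bar> ^ N))"
  using assms unfolding puiseux_expansion_def by (rule conjunct2[THEN spec])

text \<open>The cut-off at \<open>\<nu> / a\<close> loses nothing, because the exponents of
  \<open>x1\<close> are nonnegative.\<close>

lemma coeff_weighted_part:
  assumes "lattice_set q (coeff_support c)" "a > 0"
  shows "coeff (weighted_part c a \<nu>) b = c (\<nu> - a * real b) b"
proof (cases "b \<le> nat \<lfloor>\<nu> / a\<rfloor>")
  case True
  have "coeff (weighted_part c a \<nu>) b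
      = (\<Sum>j\<le>nat \<lfloor>\<nu> / a\<rfloor>. if j = b then c (\<nu> - a * real j) j else 0)"
    unfolding weighted_part_def coeff_sum by (intro sum.cong) auto
  then show ?thesis using True by (simp add: sum.delta)
next
  case False
  have "c (\<nu> - a * real b) b = 0"
  proof (rule ccontr)
    assume "c (\<nu> - a * real b) b \<noteq> 0"
    then have "\<nu> - a * real b \<ge> 0"
      using lattice_set_nonneg[OF assms(1) coeff_supportI] by fastforce
    then have "real b \<le> \<nu> / a"
      using assms(2) by (simp add: field_simps)
    then show False using False by (simp add: le_nat_floor)
  qed
  moreover have "coeff (weighted_part c a \<nu>) b = 0"
    unfolding weighted_part_def coeff_sum using False by (intro sum.neutral) auto
  ultimately show ?thesis by simp
qed

lemma finite_puiseux_trunc: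
  assumes "lattice_set q (coeff_support c)"
  shows "finite (puiseux_trunc c N)"
proof -
  have "(\<lambda>(\<alpha>, b). (\<alpha>, real b)) ` puiseux_trunc c N \<subseteq> {p \<in> coeff_support c. fst p \<le> N \<and> snd p \<le> N}"
    by (auto simp: puiseux_trunc_def coeff_supportI)
  then have "finite ((\<lambda>(\<alpha>, b). (\<alpha>, real b)) ` puiseux_trunc c N)"
    using finite_lattice_box[OF assms] finite_subset by blast
  then show ?thesis
    by (rule finite_imageD) (auto simp: inj_on_def)
qed

text \<open>Prepares uniqueness. The denominators are merged into their product, and all truncations
  are extended by zero coefficients to one finite index set.\<close>

lemma puiseux_expansion_diff:
  assumes "puiseux_expansion F c" "puiseux_expansion G d"
  shows "puiseux_expansion (\<lambda>x y. F x y - G x y) (\<lambda>\<alpha> b. c \<alpha> b - d \<alpha> b)"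
  unfolding puiseux_expansion_def
proof (intro conjI allI)
  let ?e = "\<lambda>\<alpha> b. c \<alpha> b - d \<alpha> b"
  obtain p q where p: "lattice_set p (coeff_support c)" and q: "lattice_set q (coeff_support d)"
    using assms by (auto simp: puiseux_expansion_def)
  have pq: "p > 0" "q > 0" using p q by (auto simp: lattice_set_def)
  have "\<exists>k. \<alpha> = real k / real (p * q)" if "?e \<alpha> b \<noteq> 0" for \<alpha> b
  proof (cases "c \<alpha> b \<noteq> 0")
    case True
    then obtain k where "\<alpha> = real k / real p" using lattice_coeff[OF p] by blast
    then show ?thesis using pq by (intro exI[of _ "k * q"]) simp
  next
    case False
    then have "d \<alpha> b \<noteq> 0" using that by simp
    then obtain k where "\<alpha> = real k / real q" using lattice_coeff[OF q] by blast
    then show ?thesis using pq by (intro exI[of _ "k * p"]) simp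
  qed
  then have e: "lattice_set (p * q) (coeff_support ?e)"
    using pq by (intro lattice_coeff_support) auto
  then show "\<exists>q. lattice_set q (coeff_support ?e)" by blast
  fix N
  obtain C r where 1: "0 < r" "\<And>x y. 0 < x \<Longrightarrow> x < r \<Longrightarrow> \<bar>y\<bar> < r \<Longrightarrow>
        \<bar>F x y - puiseux_sum c N x y\<bar>
          \<le> C * (x ^ N + \<bar>y\<bar> ^ N)"
    using puiseux_expansion_estimate[OF assms(1), of N] by blast
  obtain C' r' where 2: "0 < r'" "\<And>x y. 0 < x \<Longrightarrow> x < r' \<Longrightarrow> \<bar>y\<bar> < r' \<Longrightarrow>
        \<bar>G x y - puiseux_sum d N x y\<bar>
          \<le> C' * (x ^ N + \<bar>y\<bar> ^ N)"
    using puiseux_expansion_estimate[OF assms(2), of N] by blast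
  define T where "T = puiseux_trunc c N \<union> puiseux_trunc d N"
  have T: "finite T"
    unfolding T_def using finite_puiseux_trunc p q by blast
  have S: "puiseux_sum f N x y = (\<Sum>(\<alpha>, b)\<in>T. f \<alpha> b * x powr \<alpha> * y ^ b)"
    if "f = c \<or> f = d \<or> f = ?e" for f x y
    by (rule sum.mono_neutral_left[OF T]) (use that in \<open>auto simp: T_def puiseux_trunc_def\<close>)
  have "\<bar>F x y - G x y - puiseux_sum ?e N x y\<bar>
          \<le> (C + C') * (x ^ N + \<bar>y\<bar> ^ N)" if "0 < x" "x < min r r'" "\<bar>y\<bar> < min r r'" for x y
  proof -
    have "puiseux_sum ?e N x y
        = puiseux_sum c N x y
        - puiseux_sum d N x y"
      using S[of ?e x y] S[of c x y] S[of d x y]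
      by (simp add: sum_subtractf[symmetric] case_prod_beta algebra_simps)
    then show ?thesis
      using 1(2)[of x y] 2(2)[of x y] that unfolding distrib_right by force
  qed
  then show "\<exists>C r. 0 < r \<and> (\<forall>x y. 0 < x \<longrightarrow> x < r \<longrightarrow> \<bar>y\<bar> < r \<longrightarrow>
        \<bar>F x y - G x y - puiseux_sum ?e N x y\<bar>
          \<le> C * (x ^ N + \<bar>y\<bar> ^ N))"
    using 1(1) 2(1) by (intro exI[of _ "C + C'"] exI[of _ "min r r'"]) auto
qed

text \<open>On the curve \<open>y = x^a t\<close> a monomial becomes
  \<open>x^(\<alpha> + a b) t^b\<close>; after division by \<open>x^\<nu>\<close> only the terms of
  weight exactly \<open>\<nu>\<close> survive. A convergent \<open>t\<close> instead of a constant
  one leaves room for shears.\<close>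

lemma puiseux_expansion_limit:
  assumes F: "puiseux_expansion F c" and a: "a > 0"
    and \<nu>: "\<And>\<alpha> b. c \<alpha> b \<noteq> 0 \<Longrightarrow> \<nu> \<le> \<alpha> + a * real b"
    and t: "(t \<longlongrightarrow> \<tau>) (at_right 0)"
  shows "((\<lambda>x. F x (x powr a * t x) / x powr \<nu>) \<longlongrightarrow> poly (weighted_part c a \<nu>) \<tau>) (at_right 0)"
proof -
  obtain q where q: "lattice_set q (coeff_support c)"
    using F by (auto simp: puiseux_expansion_def)
  \<comment> \<open>With this \<open>N\<close> both parts \<open>x^N\<close> and
    \<open>x^(a N)\<close> of the truncation error are \<open>o(x^\<nu>)\<close>.\<close>
  obtain N where "max \<nu> (\<nu> / a) < real N"
    using reals_Archimedean2 by blast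
  then have N: "\<nu> < real N" "\<nu> < a * real N"
    using a by (auto simp: field_simps)
  let ?T = "puiseux_trunc c N"
  have T: "finite ?T" by (rule finite_puiseux_trunc[OF q])
  obtain C r where Cr: "0 < r" "\<And>x y. 0 < x \<Longrightarrow> x < r \<Longrightarrow> \<bar>y\<bar> < r \<Longrightarrow>
        \<bar>F x y - (\<Sum>(\<alpha>, b)\<in>?T. c \<alpha> b * x powr \<alpha> * y ^ b)\<bar> \<le> C * (x ^ N + \<bar>y\<bar> ^ N)"
    using puiseux_expansion_estimate[OF F, of N] by blast
  have pos: "\<forall>\<^sub>F x::real in at_right 0. 0 < x"
    by (simp add: eventually_at_filter)
  have pw: "((\<lambda>x::real. x powr e) \<longlongrightarrow> (if e = 0 then 1 else 0)) (at_right 0)" if "e \<ge> 0" for e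
  proof (cases "e = 0")
    case True
    have "((\<lambda>x::real. x powr 0) \<longlongrightarrow> 1) (at_right 0)"
      by (rule tendsto_eventually) (use pos in eventually_elim, simp)
    then show ?thesis using True by simp
  next
    case False
    have "((\<lambda>x::real. x powr e) \<longlongrightarrow> 0 powr e) (at_right 0)"
      using that False
      by (intro tendsto_powr' tendsto_intros) (auto simp: eventually_at_filter)
    then show ?thesis using False by simp
  qed
  define P where "P x = (\<Sum>(\<alpha>, b)\<in>?T. c \<alpha> b * x powr \<alpha> * (x powr a * t x) ^ b)" for x
  have "((\<lambda>x. \<Sum>(\<alpha>, b)\<in>?T. c \<alpha> b * x powr (\<alpha> + a * real b - \<nu>) * t x ^ b)
      \<longlongrightarrow> (\<Sum>(\<alpha>, b)\<in>?T. c \<alpha> b * (if \<alpha> + a * real b - \<nu> = 0 then 1 else 0) * \<tau> ^ b)) (at_right 0)"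
    by (intro tendsto_sum, unfold case_prod_beta, intro tendsto_mult tendsto_const pw tendsto_power t)
      (use \<nu> in \<open>force simp: puiseux_trunc_def\<close>)
  moreover have "\<forall>\<^sub>F x in at_right 0. (\<Sum>(\<alpha>, b)\<in>?T. c \<alpha> b * x powr (\<alpha> + a * real b - \<nu>) * t x ^ b)
      = P x / x powr \<nu>"
    using pos
  proof eventually_elim
    case (elim x)
    have "c \<alpha> b * x powr (\<alpha> + a * real b - \<nu>) * t x ^ b
        = c \<alpha> b * x powr \<alpha> * (x powr a * t x) ^ b / x powr \<nu>" for \<alpha> b
    proof -
      have "(x powr a) ^ b = x powr (a * real b)"
        using elim by (simp add: powr_powr[symmetric] powr_realpow)
      then show ?thesis
        using elim by (simp add: powr_add powr_diff power_mult_distrib)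
    qed
    then show ?case
      by (simp add: P_def sum_divide_distrib case_prod_beta)
  qed
  moreover have "(\<Sum>(\<alpha>, b)\<in>?T. c \<alpha> b * (if \<alpha> + a * real b - \<nu> = 0 then 1 else 0) * \<tau> ^ b)
      = poly (weighted_part c a \<nu>) \<tau>"
  proof -
    have "poly (weighted_part c a \<nu>) \<tau> = (\<Sum>b\<le>nat \<lfloor>\<nu> / a\<rfloor>. c (\<nu> - a * real b) b * \<tau> ^ b)"
      by (simp add: weighted_part_def poly_sum poly_monom)
    also have "\<dots> = (\<Sum>(\<alpha>, b)\<in>?T. c \<alpha> b * (if \<alpha> + a * real b - \<nu> = 0 then 1 else 0) * \<tau> ^ b)"
    \<comment> \<open>The terms of weight \<open>\<nu>\<close> correspond to the exponents
      \<open>b\<close> of the polynomial via \<open>\<alpha> = \<nu> - a b\<close>, and the choice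
      of \<open>N\<close> ensures that none of them is cut off.\<close>
    proof (rule sum.reindex_bij_witness_not_neutral[where S' = "{b \<in> {..nat \<lfloor>\<nu> / a\<rfloor>}. c (\<nu> - a * real b) b = 0}"
          and T' = "{(\<alpha>, b) \<in> ?T. \<alpha> + a * real b - \<nu> \<noteq> 0}" and i = snd and j = "\<lambda>b. (\<nu> - a * real b, b)"])
      fix b assume b: "b \<in> {..nat \<lfloor>\<nu> / a\<rfloor>} - {b \<in> {..nat \<lfloor>\<nu> / a\<rfloor>}. c (\<nu> - a * real b) b = 0}"
      then have c: "c (\<nu> - a * real b) b \<noteq> 0" by simp
      then have "0 \<le> \<nu> - a * real b"
        using lattice_set_nonneg[OF q coeff_supportI] by fastforce
      then have "a * real b < a * real N"
        using N by simp
      moreover have "\<nu> - a * real b < N"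
        using N a mult_nonneg_nonneg[of a "real b"] by linarith
      ultimately have "b < N" "\<nu> - a * real b < N"
        using a by auto
      then show "(\<nu> - a * real b, b) \<in> ?T - {(\<alpha>, b) \<in> ?T. \<alpha> + a * real b - \<nu> \<noteq> 0}"
        using c a by (auto simp: puiseux_trunc_def)
    next
      fix p assume p: "p \<in> ?T - {(\<alpha>, b) \<in> ?T. \<alpha> + a * real b - \<nu> \<noteq> 0}"
      then obtain \<alpha> b where ab: "p = (\<alpha>, b)" "c \<alpha> b \<noteq> 0" "\<alpha> = \<nu> - a * real b"
        by (auto simp: puiseux_trunc_def)
      then have "0 \<le> \<nu> - a * real b"
        using lattice_set_nonneg[OF q coeff_supportI] by fastforce
      then have "real b \<le> \<nu> / a"
        using a by (simp add: field_simps)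
      then show "snd p \<in> {..nat \<lfloor>\<nu> / a\<rfloor>} - {b \<in> {..nat \<lfloor>\<nu> / a\<rfloor>}. c (\<nu> - a * real b) b = 0}"
        using ab by (simp add: le_nat_floor)
    qed (use T in \<open>auto intro: finite_subset[OF _ T]\<close>)
    finally show ?thesis ..
  qed
  ultimately have lim: "((\<lambda>x. P x / x powr \<nu>) \<longlongrightarrow> poly (weighted_part c a \<nu>) \<tau>) (at_right 0)"
    by (simp add: tendsto_cong)
  have y0: "((\<lambda>x. x powr a * t x) \<longlongrightarrow> 0) (at_right 0)"
    using tendsto_mult[OF pw[of a] t] a by simp
  have "((\<lambda>x. C * (x powr (real N - \<nu>) + x powr (a * real N - \<nu>) * \<bar>t x\<bar> ^ N)) \<longlongrightarrow> C * (0 + 0 * \<bar>\<tau>\<bar> ^ N)) (at_right 0)"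
    using pw[of "real N - \<nu>"] pw[of "a * real N - \<nu>"] N
    by (intro tendsto_intros t) auto
  then have "((\<lambda>x. C * (x powr (real N - \<nu>) + x powr (a * real N - \<nu>) * \<bar>t x\<bar> ^ N)) \<longlongrightarrow> 0) (at_right 0)"
    by simp
  moreover have "\<forall>\<^sub>F x in at_right 0. norm (F x (x powr a * t x) / x powr \<nu> - P x / x powr \<nu>)
      \<le> C * (x powr (real N - \<nu>) + x powr (a * real N - \<nu>) * \<bar>t x\<bar> ^ N)"
  proof -
    have "\<forall>\<^sub>F x in at_right 0. \<bar>x powr a * t x\<bar> < r"
      using y0 Cr(1) by (auto simp: tendsto_iff)
    moreover have "\<forall>\<^sub>F x in at_right 0. x < r"
      using Cr(1) eventually_at_right by blast
    ultimately show ?thesis using pos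
    proof eventually_elim
      case (elim x)
      have "\<bar>F x (x powr a * t x) - P x\<bar> \<le> C * (x ^ N + \<bar>x powr a * t x\<bar> ^ N)"
        unfolding P_def by (rule Cr(2)) (use elim in auto)
      then have "\<bar>F x (x powr a * t x) - P x\<bar> / x powr \<nu> \<le> C * (x ^ N + \<bar>x powr a * t x\<bar> ^ N) / x powr \<nu>"
        using elim by (intro divide_right_mono) auto
      moreover have "x ^ N = x powr real N" "\<bar>x powr a * t x\<bar> ^ N = x powr (a * real N) * \<bar>t x\<bar> ^ N"
        using elim by (simp_all add: powr_realpow abs_mult power_mult_distrib powr_powr[symmetric])
      ultimately show ?case
        using elim by (simp add: diff_divide_distrib[symmetric] powr_diff distrib_left add_divide_distrib abs_mult)
    qed
  qed
  ultimately have "((\<lambda>x. F x (x powr a * t x) / x powr \<nu> - P x / x powr \<nu>) \<longlongrightarrow> 0) (at_right 0)"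
    by (rule Lim_null_comparison[rotated])
  from tendsto_add[OF this lim] show ?thesis by simp
qed

lemma weighted_part_eq_0_iff:
  assumes "lattice_set q (coeff_support c)" "a > 0"
  shows "weighted_part c a \<nu> = 0 \<longleftrightarrow> (\<forall>p\<in>coeff_support c. fst p + a * snd p \<noteq> \<nu>)"
proof
  assume 0: "weighted_part c a \<nu> = 0"
  show "\<forall>p\<in>coeff_support c. fst p + a * snd p \<noteq> \<nu>"
  proof (intro ballI notI)
    fix p assume "p \<in> coeff_support c" and \<nu>: "fst p + a * snd p = \<nu>"
    then obtain \<alpha> b where p: "p = (\<alpha>, real b)" "c \<alpha> b \<noteq> 0" by (auto simp: coeff_support_def)
    then have "\<alpha> = \<nu> - a * real b" using \<nu> by auto
    then show False
      using coeff_weighted_part[OF assms, of \<nu> b] p(2) 0 by simp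
  qed
next
  assume *: "\<forall>p\<in>coeff_support c. fst p + a * snd p \<noteq> \<nu>"
  show "weighted_part c a \<nu> = 0"
  proof (rule poly_eqI)
    fix b
    have "c (\<nu> - a * real b) b = 0"
      using bspec[OF * coeff_supportI, of "\<nu> - a * real b" b] by auto
    then show "coeff (weighted_part c a \<nu>) b = coeff 0 b"
      using coeff_weighted_part[OF assms] by simp
  qed
qed

lemma weighted_part_order_nonzero:
  assumes "lattice_set q (coeff_support c)" "coeff_support c \<noteq> {}" "a > 0"
  shows "weighted_part c a (weighted_order (coeff_support c) a) \<noteq> 0"
proof -
  obtain p where "p \<in> coeff_support c" "fst p + a * snd p = weighted_order (coeff_support c) a"
    using weighted_order_attained(1)[OF assms] ..
  then show ?thesis
    unfolding weighted_part_eq_0_iff[OF assms(1,3)] by blast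
qed

text \<open>Otherwise the part of least weight for \<open>a = 1\<close> would be a nonzero
  polynomial, yet as a limit of zeros it vanishes at every \<open>\<tau>\<close>.\<close>

lemma puiseux_expansion_zero:
  assumes "puiseux_expansion (\<lambda>_ _. 0) c"
  shows "c \<alpha> b = 0"
proof (rule ccontr)
  assume "c \<alpha> b \<noteq> 0"
  then have ne: "coeff_support c \<noteq> {}"
    using coeff_supportI by force
  obtain q where q: "lattice_set q (coeff_support c)"
    using assms by (auto simp: puiseux_expansion_def)
  define \<nu> where "\<nu> = weighted_order (coeff_support c) 1"
  have \<nu>: "\<nu> \<le> \<alpha> + 1 * real b" if "c \<alpha> b \<noteq> 0" for \<alpha> b
    using weighted_order_attained(2)[OF q ne, of 1 "(\<alpha>, real b)"] that coeff_supportI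
    by (simp add: \<nu>_def)
  have "poly (weighted_part c 1 \<nu>) \<tau> = 0" for \<tau>
  proof -
    have "((\<lambda>x. 0 / x powr \<nu>) \<longlongrightarrow> poly (weighted_part c 1 \<nu>) \<tau>) (at_right (0::real))"
      by (rule puiseux_expansion_limit[OF assms _ \<nu>, where t = "\<lambda>_. \<tau>"]) auto
    then show ?thesis
      by (simp add: tendsto_const_iff)
  qed
  then have "weighted_part c 1 \<nu> = 0"
    using poly_all_0_iff_0 by blast
  then show False
    using weighted_part_order_nonzero[OF q ne] \<nu>_def by simp
qed

lemma puiseux_expansion_unique:
  assumes "puiseux_expansion F c" "puiseux_expansion F d"
  shows "c = d"
proof (intro ext)
  fix \<alpha> b
  have "puiseux_expansion (\<lambda>_ _. 0) (\<lambda>\<alpha> b. c \<alpha> b - d \<alpha> b)"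
    using puiseux_expansion_diff[OF assms] by simp
  from puiseux_expansion_zero[OF this, of \<alpha> b] show "c \<alpha> b = d \<alpha> b" by simp
qed

text \<open>On \<open>y = x^a \<tau>\<close> the shear replaces \<open>\<tau>\<close> by
  \<open>\<tau> + \<delta> x / x^a\<close>, which tends to \<open>\<tau> + \<gamma>\<close>.
  Comparing the limits for all \<open>\<tau>\<close> gives the translation; since it maps nonzero
  polynomials to nonzero ones, the orders agree too.\<close>

lemma puiseux_expansion_shear:
  assumes F: "puiseux_expansion F c" and F': "puiseux_expansion F' c'"
    and ne: "coeff_support c \<noteq> {}" and a: "a > 0" and r: "0 < r"
    and eq: "\<And>x y. 0 < x \<Longrightarrow> x < r \<Longrightarrow> \<bar>y\<bar> < r \<Longrightarrow> F' x y = F x (y + \<delta> x)"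
    and \<delta>: "((\<lambda>x. \<delta> x / x powr a) \<longlongrightarrow> \<gamma>) (at_right 0)"
  shows "coeff_support c' \<noteq> {}"
    and "weighted_order (coeff_support c') a = weighted_order (coeff_support c) a"
    and "weighted_part c' a (weighted_order (coeff_support c) a)
      = pcompose (weighted_part c a (weighted_order (coeff_support c) a)) [:\<gamma>, 1:]"
proof -
  obtain q where q: "lattice_set q (coeff_support c)"
    using F by (auto simp: puiseux_expansion_def)
  obtain q' where q': "lattice_set q' (coeff_support c')"
    using F' by (auto simp: puiseux_expansion_def)
  have pos: "\<forall>\<^sub>F x::real in at_right 0. 0 < x \<and> x < r"
    using r eventually_at_right[of 0 r] by (auto simp: eventually_at_right)
  \<comment> \<open>Here \<open>\<mu>\<close> is any common lower bound of the weights, possibly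
    with zero on both sides. This permits a comparison before the two orders are known to
    agree.\<close>
  have core: "weighted_part c' a \<mu> = pcompose (weighted_part c a \<mu>) [:\<gamma>, 1:]"
    if 1: "\<And>p. p \<in> coeff_support c \<Longrightarrow> \<mu> \<le> fst p + a * snd p"
      and 2: "\<And>p. p \<in> coeff_support c' \<Longrightarrow> \<mu> \<le> fst p + a * snd p" for \<mu>
  proof (rule iffD1[OF poly_eq_poly_eq_iff], rule ext)
    fix \<tau>
    have "((\<lambda>x. F x (x powr a * (\<tau> + \<delta> x / x powr a)) / x powr \<mu>)
        \<longlongrightarrow> poly (weighted_part c a \<mu>) (\<tau> + \<gamma>)) (at_right 0)"
      by (rule puiseux_expansion_limit[OF F a]) (use 1[OF coeff_supportI] \<delta> in \<open>auto intro!: tendsto_intros\<close>)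
    moreover have "((\<lambda>x. F' x (x powr a * \<tau>) / x powr \<mu>) \<longlongrightarrow> poly (weighted_part c' a \<mu>) \<tau>) (at_right 0)"
      by (rule puiseux_expansion_limit[OF F' a]) (use 2[OF coeff_supportI] in auto)
    moreover have "\<forall>\<^sub>F x in at_right 0. F' x (x powr a * \<tau>) / x powr \<mu>
        = F x (x powr a * (\<tau> + \<delta> x / x powr a)) / x powr \<mu>"
    proof -
      have "((\<lambda>x::real. x powr a * \<tau>) \<longlongrightarrow> 0 powr a * \<tau>) (at_right 0)"
        using a by (intro tendsto_intros tendsto_powr') (auto simp: eventually_at_filter)
      then have "((\<lambda>x::real. x powr a * \<tau>) \<longlongrightarrow> 0) (at_right 0)" by simp
      then have "\<forall>\<^sub>F x in at_right 0. \<bar>x powr a * \<tau>\<bar> < r"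
        using r by (auto simp: tendsto_iff)
      then show ?thesis using pos
      proof eventually_elim
        case (elim x)
        then show ?case using eq[of x "x powr a * \<tau>"] by (simp add: distrib_left)
      qed
    qed
    ultimately have "poly (weighted_part c' a \<mu>) \<tau> = poly (weighted_part c a \<mu>) (\<tau> + \<gamma>)"
      by (intro tendsto_unique[OF trivial_limit_at_right_real _ iffD2[OF tendsto_cong]])
    then show "poly (weighted_part c' a \<mu>) \<tau> = poly (pcompose (weighted_part c a \<mu>) [:\<gamma>, 1:]) \<tau>"
      by (simp add: poly_pcompose add.commute)
  qed
  have nz: "pcompose P [:\<gamma>, 1:] = 0 \<longleftrightarrow> P = 0" for P :: "real poly"
    by (simp add: pcompose_eq_0_iff)
  let ?\<nu> = "weighted_order (coeff_support c) a"
  let ?\<nu>' = "weighted_order (coeff_support c') a"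
  note \<nu> = weighted_order_attained(2)[OF q ne a]
  show ne': "coeff_support c' \<noteq> {}"
  proof
    assume "coeff_support c' = {}"
    then have "weighted_part c' a ?\<nu> = pcompose (weighted_part c a ?\<nu>) [:\<gamma>, 1:]" "weighted_part c' a ?\<nu> = 0"
      using core[OF \<nu>] weighted_part_eq_0_iff[OF q' a] by auto
    then show False
      using weighted_part_order_nonzero[OF q ne a] nz by simp
  qed
  note \<nu>' = weighted_order_attained(2)[OF q' ne' a]
  \<comment> \<open>At the smaller of the two orders one of the parts is nonzero, hence so is the
    other; were the orders different, the part of the expansion of larger order would vanish
    there.\<close>
  have "weighted_part c' a (min ?\<nu> ?\<nu>') = pcompose (weighted_part c a (min ?\<nu> ?\<nu>')) [:\<gamma>, 1:]"
    using \<nu> \<nu>' by (intro core) (auto simp: min_le_iff_disj)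
  then have "weighted_part c' a (min ?\<nu> ?\<nu>') = 0 \<longleftrightarrow> weighted_part c a (min ?\<nu> ?\<nu>') = 0"
    using nz by simp
  moreover have "weighted_part c' a (min ?\<nu> ?\<nu>') = 0" if "?\<nu> < ?\<nu>'"
    using weighted_part_eq_0_iff[OF q' a] \<nu>' that by fastforce
  moreover have "weighted_part c a (min ?\<nu> ?\<nu>') = 0" if "?\<nu>' < ?\<nu>"
    using weighted_part_eq_0_iff[OF q a] \<nu> that by fastforce
  moreover have "weighted_part c a ?\<nu> \<noteq> 0" "weighted_part c' a ?\<nu>' \<noteq> 0"
    using weighted_part_order_nonzero[OF q ne a] weighted_part_order_nonzero[OF q' ne' a] by auto
  ultimately show "?\<nu>' = ?\<nu>"
    by (smt (verit, best) min_def)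
  then show "weighted_part c' a ?\<nu> = pcompose (weighted_part c a ?\<nu>) [:\<gamma>, 1:]"
    using core[OF \<nu>] \<nu>' by auto
qed

section \<open>Newton polyhedra of supports\<close>

lemma convex_weighted_halfplane:
  "convex {t::real \<times> real. m \<le> w1 * fst t + w2 * snd t}"
  "convex {t::real \<times> real. w1 * fst t + w2 * snd t = m}"
proof -
  have e: "(w1, w2) \<bullet> t = w1 * fst t + w2 * snd t" for t
    by (simp add: inner_prod_def)
  show "convex {t::real \<times> real. m \<le> w1 * fst t + w2 * snd t}"
    using convex_halfspace_ge[of m "(w1, w2)"] unfolding e .
  show "convex {t::real \<times> real. w1 * fst t + w2 * snd t = m}"
    using convex_hyperplane[of "(w1, w2)" m] unfolding e .
qed

text \<open>Excluding the origin reflects \<open>\<phi> (0, 0) = 0\<close>. It makes every order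
  positive, so that supporting lines can be normalized to
  \<open>\<kappa> \<bullet> t = 1\<close>.\<close>

locale newton_support =
  fixes q :: nat and S :: "(real \<times> real) set"
  assumes lattice: "lattice_set q S" and nonempty: "S \<noteq> {}" and origin: "(0, 0) \<notin> S"
begin

abbreviation "\<nu> \<equiv> weighted_order S"
abbreviation "N \<equiv> newton_hull S"

text \<open>Support points only; the geometric face is the convex hull of this set.\<close>

definition face :: "real \<Rightarrow> (real \<times> real) set" where
  "face a = {p \<in> S. fst p + a * snd p = \<nu> a}"

lemma nonneg: "p \<in> S \<Longrightarrow> 0 \<le> fst p" "p \<in> S \<Longrightarrow> 0 \<le> snd p"
  using lattice_set_nonneg[OF lattice] by blast+

lemma order_le: "p \<in> S \<Longrightarrow> a > 0 \<Longrightarrow> \<nu> a \<le> fst p + a * snd p"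
  using weighted_order_attained(2)[OF lattice nonempty] by blast

lemma face_nonempty: "a > 0 \<Longrightarrow> \<exists>p. p \<in> face a"
  using weighted_order_attained(1)[OF lattice nonempty, of a] unfolding face_def by blast

lemma faceD: "p \<in> face a \<Longrightarrow> p \<in> S" "p \<in> face a \<Longrightarrow> fst p + a * snd p = \<nu> a"
  by (auto simp: face_def)

lemma order_eqI:
  assumes "a > 0" "p \<in> S" "\<And>v. v \<in> S \<Longrightarrow> fst p + a * snd p \<le> fst v + a * snd v"
  shows "p \<in> face a"
proof -
  obtain v where "v \<in> face a" using face_nonempty[OF assms(1)] ..
  then have "fst p + a * snd p \<le> \<nu> a"
    using assms(3)[of v] faceD by simp
  then show ?thesis
    using order_le[OF assms(2,1)] assms(2) by (simp add: face_def)
qed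

lemma order_pos:
  assumes "a > 0"
  shows "\<nu> a > 0"
proof -
  obtain p where p: "p \<in> face a" using face_nonempty[OF assms] ..
  then have *: "0 \<le> fst p" "0 \<le> snd p" "p \<noteq> (0, 0)"
    using nonneg origin faceD by auto
  then have "0 < fst p \<or> 0 < snd p"
    by (metis order_le_less prod.collapse)
  then have "0 < fst p + a * snd p"
    using * assms by (auto intro: add_pos_nonneg add_nonneg_pos)
  then show ?thesis using faceD(2)[OF p] by simp
qed

lemma finite_face: "a > 0 \<Longrightarrow> finite (face a)"
  by (rule finite_subset[OF _ finite_lattice_le[OF lattice, of a "\<nu> a"]]) (auto simp: face_def)

lemma support_subset_hull: "S \<subseteq> N"
  unfolding newton_hull_def by (intro subset_trans[OF _ hull_subset]) auto

lemma convex_hull_N: "convex N"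
  unfolding newton_hull_def by simp

lemma hull_upward:
  assumes "t \<in> N" "0 \<le> fst u" "0 \<le> snd u"
  shows "u + t \<in> N"
proof -
  let ?U = "\<Union>\<alpha>\<in>S. {t. fst \<alpha> \<le> fst t \<and> snd \<alpha> \<le> snd t}"
  have "(\<lambda>x. u + x) ` ?U \<subseteq> ?U"
    using assms(2,3) by (fastforce intro: add_increasing)
  then have "convex hull ((\<lambda>x. u + x) ` ?U) \<subseteq> convex hull ?U"
    by (rule hull_mono)
  then show ?thesis
    using assms(1) unfolding newton_hull_def convex_hull_translation by blast
qed

lemma hull_upward': "t \<in> N \<Longrightarrow> fst t \<le> fst u \<Longrightarrow> snd t \<le> snd u \<Longrightarrow> u \<in> N"
  using hull_upward[of t "u - t"] by simp

lemma hull_subsetI: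
  assumes "convex C" "\<And>v t. v \<in> S \<Longrightarrow> fst v \<le> fst t \<Longrightarrow> snd v \<le> snd t \<Longrightarrow> t \<in> C"
  shows "N \<subseteq> C"
  unfolding newton_hull_def by (rule hull_minimal) (use assms(2) in blast, rule assms(1))

lemma hull_ge:
  assumes "0 \<le> w1" "0 \<le> w2" "\<And>p. p \<in> S \<Longrightarrow> m \<le> w1 * fst p + w2 * snd p" "t \<in> N"
  shows "m \<le> w1 * fst t + w2 * snd t"
proof -
  have "N \<subseteq> {t. m \<le> w1 * fst t + w2 * snd t}"
  proof (rule hull_subsetI[OF convex_weighted_halfplane(1)])
    fix v t assume "v \<in> S" "fst v \<le> fst t" "snd v \<le> snd t"
    then have "m \<le> w1 * fst v + w2 * snd v" "w1 * fst v \<le> w1 * fst t" "w2 * snd v \<le> w2 * snd t"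
      using assms(1-3) by (auto intro: mult_left_mono)
    then show "t \<in> {t. m \<le> w1 * fst t + w2 * snd t}"
      by simp
  qed
  then show ?thesis
    using assms(4) by auto
qed

lemma hull_order_le: "t \<in> N \<Longrightarrow> a > 0 \<Longrightarrow> \<nu> a \<le> fst t + a * snd t"
  using hull_ge[of 1 a "\<nu> a" t] order_le by simp

text \<open>Both weights being positive, a quadrant meets the supporting line at most in its corner,
  which is then a support point of the face.\<close>

lemma hull_face:
  assumes a: "a > 0"
  shows "N \<inter> {t. fst t + a * snd t = \<nu> a} = convex hull (face a)"
proof
  have "convex {t. fst t + a * snd t = \<nu> a}"
    using convex_weighted_halfplane(2)[of 1 a] by simp
  then show "convex hull (face a) \<subseteq> N \<inter> {t. fst t + a * snd t = \<nu> a}"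
    using support_subset_hull by (intro hull_minimal convex_Int convex_hull_N) (auto simp: face_def)
  \<comment> \<open>The open half-plane together with the face: convex although not closed, since a
    proper mixture with a point off the line stays off the line. It contains every quadrant, hence
    \<open>N\<close>.\<close>
  define C where "C = {t. \<nu> a < fst t + a * snd t} \<union> convex hull (face a)"
  have on: "fst t + a * snd t = \<nu> a" if "t \<in> convex hull (face a)" for t
    using that \<open>convex hull (face a) \<subseteq> N \<inter> {t. fst t + a * snd t = \<nu> a}\<close> by blast
  have "convex C"
  proof (rule convexI)
    fix x y and u v :: real
    assume xy: "x \<in> C" "y \<in> C" and uv: "0 \<le> u" "0 \<le> v" "u + v = 1"
    let ?g = "\<lambda>t::real\<times>real. fst t + a * snd t - \<nu> a"
    have g: "?g (u *\<^sub>R x + v *\<^sub>R y) = u * ?g x + v * ?g y"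
    proof -
      have "(u + v) * \<nu> a = \<nu> a"
        using uv(3) by simp
      then show ?thesis by (simp add: algebra_simps)
    qed
    have ge: "0 \<le> ?g x" "0 \<le> ?g y"
      using xy on by (auto simp: C_def)
    show "u *\<^sub>R x + v *\<^sub>R y \<in> C"
    proof (cases "u = 0 \<or> v = 0 \<or> x \<in> convex hull (face a) \<and> y \<in> convex hull (face a)")
      case True
      then show ?thesis
        using xy uv convexD[OF convex_convex_hull, of x "face a" y u v] by (auto simp: C_def)
    next
      case False
      then have "0 < u" "0 < v" "0 < ?g x \<or> 0 < ?g y"
        using xy uv by (auto simp: C_def)
      then have "0 < u * ?g x + v * ?g y"
        using ge by (auto intro: add_pos_nonneg add_nonneg_pos)
      then show ?thesis
        unfolding g[symmetric] by (simp add: C_def)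
    qed
  qed
  moreover have "t \<in> C" if v: "v \<in> S" "fst v \<le> fst t" "snd v \<le> snd t" for v t
  proof (cases "\<nu> a < fst t + a * snd t")
    case False
    have "a * snd v \<le> a * snd t" using v a by simp
    then have "fst v = fst t" "a * snd v = a * snd t" "fst v + a * snd v = \<nu> a"
      using order_le[OF v(1) a] False v(2) by linarith+
    then have "v = t" "v \<in> face a"
      using a v(1) by (auto simp: face_def prod_eq_iff)
    then show ?thesis by (simp add: C_def hull_inc)
  qed (simp add: C_def)
  ultimately have "N \<subseteq> C" by (rule hull_subsetI)
  then show "N \<inter> {t. fst t + a * snd t = \<nu> a} \<subseteq> convex hull (face a)"
    by (auto simp: C_def)
qed

section \<open>Minimal support points and closedness of the polyhedron\<close>

definition minimal_points :: "(real \<times> real) set" where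
  "minimal_points = {p \<in> S. \<forall>v\<in>S. fst v \<le> fst p \<longrightarrow> snd v \<le> snd p \<longrightarrow> v = p}"

lemma minimal_pointsD: "p \<in> minimal_points \<Longrightarrow> p \<in> S"
  by (simp add: minimal_points_def)

text \<open>Compared with a fixed support point \<open>p\<close>, a minimal point has at least one
  coordinate not exceeding that of \<open>p\<close>. On minimal points each coordinate is injective,
  and below a bound it takes only finitely many lattice values.\<close>

lemma finite_minimal_points: "finite minimal_points"
proof -
  obtain p where p: "p \<in> S" using nonempty by blast
  let ?A = "{v \<in> minimal_points. snd v \<le> snd p}" and ?B = "{v \<in> minimal_points. fst v \<le> fst p}"
  have 1: "minimal_points \<subseteq> ?A \<union> ?B"
  proof
    fix v assume v: "v \<in> minimal_points"
    then have "fst p \<le> fst v \<and> snd p \<le> snd v \<Longrightarrow> p = v"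
      using p by (simp add: minimal_points_def)
    then show "v \<in> ?A \<union> ?B"
      using v by (cases "fst p \<le> fst v"; cases "snd p \<le> snd v") auto
  qed
  have eqI: "u = v" if "u \<in> minimal_points" "v \<in> minimal_points" "fst u \<le> fst v" "snd u \<le> snd v" for u v
    using that unfolding minimal_points_def by blast
  have inj: "inj_on snd minimal_points"
  proof (rule inj_onI)
    fix u v assume "u \<in> minimal_points" "v \<in> minimal_points" "snd u = snd v"
    then show "u = v" using eqI[of u v] eqI[of v u] by (cases "fst u \<le> fst v") auto
  qed
  have inj': "inj_on fst minimal_points"
  proof (rule inj_onI)
    fix u v assume "u \<in> minimal_points" "v \<in> minimal_points" "fst u = fst v"
    then show "u = v" using eqI[of u v] eqI[of v u] by (cases "snd u \<le> snd v") auto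
  qed
  have "snd ` ?A \<subseteq> real ` {..nat \<lfloor>snd p\<rfloor>}"
  proof
    fix y assume "y \<in> snd ` ?A"
    then obtain v where v: "v \<in> S" "snd v \<le> snd p" "y = snd v"
      using minimal_pointsD by blast
    then obtain k b where "v = (real k / real q, real b)"
      using lattice unfolding lattice_set_def by blast
    then show "y \<in> real ` {..nat \<lfloor>snd p\<rfloor>}"
      using v by (auto simp: le_nat_floor)
  qed
  then have "finite (snd ` ?A)" by (rule finite_subset) simp
  then have A: "finite ?A"
    by (rule finite_imageD) (rule inj_on_subset[OF inj], blast)
  have "fst ` ?B \<subseteq> (\<lambda>k. real k / real q) ` {..nat \<lfloor>fst p * real q\<rfloor>}"
  proof
    fix y assume "y \<in> fst ` ?B"
    then obtain v where v: "v \<in> S" "fst v \<le> fst p" "y = fst v"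
      using minimal_pointsD by blast
    then obtain k b where kb: "v = (real k / real q, real b)"
      using lattice unfolding lattice_set_def by blast
    have "real k \<le> fst p * real q"
      using v(2) kb lattice by (simp add: lattice_set_def field_simps)
    then show "y \<in> (\<lambda>k. real k / real q) ` {..nat \<lfloor>fst p * real q\<rfloor>}"
      using v kb by (auto simp: le_nat_floor)
  qed
  then have "finite (fst ` ?B)" by (rule finite_subset) simp
  then have B: "finite ?B"
    by (rule finite_imageD) (rule inj_on_subset[OF inj'], blast)
  show ?thesis
    using finite_subset[OF 1] A B by blast
qed

lemma minimal_points_below:
  assumes "p \<in> S"
  shows "\<exists>v\<in>minimal_points. fst v \<le> fst p \<and> snd v \<le> snd p"
proof -
  let ?B = "{v \<in> S. fst v \<le> fst p \<and> snd v \<le> snd p}"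
  have "finite ?B" by (rule finite_lattice_box[OF lattice])
  moreover have "?B \<noteq> {}" using assms by blast
  ultimately obtain v where v: "v \<in> ?B" "\<And>u. u \<in> ?B \<Longrightarrow> fst v + snd v \<le> fst u + snd u"
    using arg_min_if_finite[of ?B "\<lambda>u. fst u + snd u"] by (metis (no_types, lifting) not_le)
  have "u = v" if "u \<in> S" "fst u \<le> fst v" "snd u \<le> snd v" for u
    using v(1) v(2)[of u] that by (simp add: prod_eq_iff)
  then have "v \<in> minimal_points"
    using v(1) by (simp add: minimal_points_def)
  then show ?thesis using v(1) by blast
qed

lemma face_subset_minimal: "a > 0 \<Longrightarrow> face a \<subseteq> minimal_points"
proof
  fix p assume a: "a > 0" and p: "p \<in> face a"
  have "v = p" if v: "v \<in> S" "fst v \<le> fst p" "snd v \<le> snd p" for v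
  proof -
    have "a * snd v \<le> a * snd p" using v(3) a by simp
    then have "fst v = fst p" "a * snd v = a * snd p"
      using order_le[OF v(1) a] faceD(2)[OF p] v(2) by linarith+
    then show ?thesis using a by (simp add: prod_eq_iff)
  qed
  then show "p \<in> minimal_points"
    using faceD(1)[OF p] by (simp add: minimal_points_def)
qed

text \<open>The polyhedron is the sum of the compact hull of finitely many minimal points and the
  closed quadrant, and a sum of a compact and a closed set is closed.\<close>

lemma closed_hull: "closed N"
proof -
  let ?Q = "{t::real\<times>real. 0 \<le> fst t \<and> 0 \<le> snd t}"
  let ?V = "convex hull minimal_points"
  have Q: "closed ?Q"
    by (intro closed_Collect_conj closed_Collect_le continuous_intros)
  have "convex ({t::real\<times>real. 0 \<le> fst t} \<inter> {t. 0 \<le> snd t})"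
    using convex_weighted_halfplane(1)[of 0 1 0] convex_weighted_halfplane(1)[of 0 0 1]
    by (intro convex_Int) simp_all
  then have cQ: "convex ?Q"
    by (simp add: Collect_conj_eq)
  have "N = (\<Union>x\<in>?V. \<Union>y\<in>?Q. {x + y})"
  proof
    show "N \<subseteq> (\<Union>x\<in>?V. \<Union>y\<in>?Q. {x + y})"
    proof (rule hull_subsetI)
      show "convex (\<Union>x\<in>?V. \<Union>y\<in>?Q. {x + y})"
        by (rule convex_sums[OF convex_convex_hull cQ])
      fix v t assume "v \<in> S" "fst v \<le> fst t" "snd v \<le> snd t"
      moreover obtain u where "u \<in> minimal_points" "fst u \<le> fst v" "snd u \<le> snd v"
        using minimal_points_below[OF \<open>v \<in> S\<close>] by blast
      ultimately have "u \<in> ?V" "t - u \<in> ?Q" "t = u + (t - u)"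
        by (auto simp: hull_inc)
      then show "t \<in> (\<Union>x\<in>?V. \<Union>y\<in>?Q. {x + y})" by blast
    qed
    have "?V \<subseteq> N"
      using support_subset_hull minimal_pointsD by (intro hull_minimal convex_hull_N) blast
    then show "(\<Union>x\<in>?V. \<Union>y\<in>?Q. {x + y}) \<subseteq> N"
      using hull_upward by (force simp: add.commute)
  qed
  then show ?thesis
    using compact_closed_sums[OF finite_imp_compact_convex_hull[OF finite_minimal_points] Q] by simp
qed

end

text \<open>The second point lies strictly between the first one and any point further along the
  ray, so a face containing both contains the whole ray and is unbounded.\<close>

lemma no_ray_in_compact_face:
  fixes K :: "'a::euclidean_space set"
  assumes e: "e face_of K" and "compact e" and p: "p \<in> e" "p' \<in> e" "p' = p + c *\<^sub>R d" "c > 0" "d \<noteq> 0"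
    and up: "\<And>s. s \<ge> 0 \<Longrightarrow> p' + s *\<^sub>R d \<in> K"
  shows False
proof -
  have in_e: "p' + s *\<^sub>R d \<in> e" if "s > 0" for s
  proof -
    have "p' \<in> open_segment p (p' + s *\<^sub>R d)"
    proof -
      define k where "k = c / (c + s)"
      have "k * (c + s) = c"
        using p(4) that by (simp add: k_def)
      moreover have "(1 - k) *\<^sub>R p + k *\<^sub>R (p' + s *\<^sub>R d) = p + (k * (c + s)) *\<^sub>R d"
        by (simp add: p(3) algebra_simps)
      ultimately have "p' = (1 - k) *\<^sub>R p + k *\<^sub>R (p' + s *\<^sub>R d)"
        by (simp add: p(3))
      moreover have "0 < k" "k < 1"
        using p(4) that by (auto simp: k_def)
      moreover have "p \<noteq> p' + s *\<^sub>R d"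
      proof -
        have "p' + s *\<^sub>R d = p + (c + s) *\<^sub>R d" by (simp add: p(3) algebra_simps)
        then show ?thesis using p(4,5) that by simp
      qed
      ultimately show ?thesis
        unfolding in_segment by blast
    qed
    from face_ofD[OF e this _ up p(2)] show ?thesis
      using p(1) face_of_imp_subset[OF e] that by auto
  qed
  obtain B where B: "\<And>x. x \<in> e \<Longrightarrow> norm x \<le> B"
    using compact_imp_bounded[OF \<open>compact e\<close>] by (auto simp: bounded_iff)
  define s where "s = (B + norm p' + 1) / norm d"
  have "0 \<le> B" using B[OF p(1)] norm_ge_zero order_trans by blast
  then have "s > 0" using p(5) by (simp add: s_def add_nonneg_pos)
  have "norm (s *\<^sub>R d) = B + norm p' + 1"
    using p(5) \<open>0 \<le> B\<close> by (simp add: s_def add_nonneg_nonneg abs_of_nonneg)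
  moreover have "norm (s *\<^sub>R d) \<le> norm (p' + s *\<^sub>R d) + norm p'"
    using norm_triangle_ineq4[of "p' + s *\<^sub>R d" p'] by simp
  ultimately show False
    using B[OF in_e[OF \<open>s > 0\<close>]] by simp
qed

text \<open>The line misses the origin because \<open>m > 0\<close>, and two distinct points of such
  a line determine its equation with right-hand side 1.\<close>

lemma edge_weight_eq:
  assumes "p \<in> e" "p' \<in> e" "p \<noteq> p'" "\<And>t. t \<in> e \<Longrightarrow> fst t + a * snd t = m" "m > 0"
  shows "edge_weight e = (1 / m, a / m)"
  unfolding edge_weight_def
proof (rule the_equality)
  show "e \<subseteq> {t. (1 / m, a / m) \<bullet> t = 1}"
  proof
    fix t assume "t \<in> e"
    then have "(fst t + a * snd t) / m = 1" using assms(4,5) by simp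
    then show "t \<in> {t. (1 / m, a / m) \<bullet> t = 1}"
      by (simp add: inner_prod_def add_divide_distrib)
  qed
  fix \<kappa> assume "e \<subseteq> {t. \<kappa> \<bullet> t = 1}"
  then have k: "fst \<kappa> * fst p + snd \<kappa> * snd p = 1" "fst \<kappa> * fst p' + snd \<kappa> * snd p' = 1"
    using assms(1,2) by (auto simp: inner_prod_def)
  have p: "fst p = m - a * snd p" "fst p' = m - a * snd p'"
    using assms(4)[OF assms(1)] assms(4)[OF assms(2)] by simp_all
  then have ne: "snd p \<noteq> snd p'"
    using assms(3) by (auto simp: prod_eq_iff)
  have "(snd \<kappa> - a * fst \<kappa>) * (snd p - snd p') = 0"
    using k unfolding p by (simp add: algebra_simps)
  then have 2: "snd \<kappa> = a * fst \<kappa>" using ne by simp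
  then have "fst \<kappa> * m = 1"
    using k(1) unfolding p by (simp add: algebra_simps)
  then show "\<kappa> = (1 / m, a / m)"
    using 2 assms(5) by (simp add: prod_eq_iff field_simps)
qed

section \<open>Compact edges and the last vertex\<close>

context newton_support
begin

lemma hull_face_on: "a > 0 \<Longrightarrow> t \<in> convex hull (face a) \<Longrightarrow> t \<in> N \<and> fst t + a * snd t = \<nu> a"
  using hull_face by blast

lemma hull_face_face_of: "a > 0 \<Longrightarrow> convex hull (face a) face_of N"
proof -
  assume a: "a > 0"
  have e: "(1, a) \<bullet> t = fst t + a * snd t" for t :: "real \<times> real"
    by (simp add: inner_prod_def)
  have "(N \<inter> {t. (1, a) \<bullet> t = \<nu> a}) face_of N"
    by (rule face_of_Int_supporting_hyperplane_ge[OF convex_hull_N]) (simp add: e hull_order_le a)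
  then show ?thesis
    unfolding e hull_face[OF a] .
qed

lemma aff_dim_hull_face:
  assumes "a > 0" "p \<in> face a" "p' \<in> face a" "p \<noteq> p'"
  shows "aff_dim (convex hull (face a)) = 1"
proof -
  have e: "(1, a) \<bullet> t = fst t + a * snd t" for t :: "real \<times> real"
    by (simp add: inner_prod_def)
  have "(1, a) \<noteq> (0 :: real \<times> real)" by (simp add: zero_prod_def)
  then have "aff_dim {t::real \<times> real. (1, a) \<bullet> t = \<nu> a} = int (DIM(real \<times> real) - 1)"
    by (rule aff_dim_hyperplane)
  also have "\<dots> = 1" by simp
  finally have "aff_dim {t::real \<times> real. (1, a) \<bullet> t = \<nu> a} = 1" .
  moreover have "convex hull (face a) \<subseteq> {t::real \<times> real. (1, a) \<bullet> t = \<nu> a}"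
    using hull_face_on[OF assms(1)] unfolding e by blast
  moreover have "{p, p'} \<subseteq> convex hull (face a)" "aff_dim {p, p'} = 1"
    using assms by (auto simp: hull_inc)
  ultimately show ?thesis
    using aff_dim_subset[of "{p, p'}" "convex hull (face a)"]
      aff_dim_subset[of "convex hull (face a)" "{t::real \<times> real. (1, a) \<bullet> t = \<nu> a}"] by linarith
qed

lemma hull_face_compact_edge:
  assumes "a > 0" "p \<in> face a" "p' \<in> face a" "p \<noteq> p'"
  shows "convex hull (face a) \<in> compact_edges N"
    and "edge_weight (convex hull (face a)) = (1 / \<nu> a, a / \<nu> a)"
proof -
  show "convex hull (face a) \<in> compact_edges N"
    using hull_face_face_of[OF assms(1)] aff_dim_hull_face[OF assms]
      finite_imp_compact_convex_hull[OF finite_face[OF assms(1)]]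
    by (simp add: compact_edges_def edge_of_def)
  show "edge_weight (convex hull (face a)) = (1 / \<nu> a, a / \<nu> a)"
    by (rule edge_weight_eq[of p _ p'])
      (use assms hull_face_on order_pos in \<open>simp_all add: hull_inc\<close>)
qed

text \<open>A line supporting the polyhedron along the edge has nonnegative weights, as
  \<open>N\<close> is closed under moving up and to the right. A zero weight would make the edge
  parallel to an axis, and then it would contain a ray.\<close>

lemma compact_edge_hull_face:
  assumes "e \<in> compact_edges N"
  shows "\<exists>a>0. e = convex hull (face a) \<and> (\<exists>p\<in>face a. \<exists>p'\<in>face a. p \<noteq> p')"
proof -
  have e: "e face_of N" "aff_dim e = 1" "compact e"
    using assms by (auto simp: compact_edges_def edge_of_def)
  have eN: "e \<subseteq> N" and cv: "convex e"
    using e(1) face_of_imp_subset face_of_imp_convex by blast+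
  have "e \<noteq> {}" using e(2) by auto
  then obtain p where p: "p \<in> e" by blast
  have "e \<noteq> {p}" using e(2) by auto
  then obtain p' where p': "p' \<in> e" "p \<noteq> p'" using p by blast
  have up: "t + s *\<^sub>R d \<in> N" if "t \<in> e" "s \<ge> 0" "fst d \<ge> 0" "snd d \<ge> 0" for t s d
    using hull_upward[of t "s *\<^sub>R d"] eN that by (auto simp: add.commute)
  have no_ray: False if "u \<in> e" "v \<in> e" "v = u + c *\<^sub>R d" "c \<noteq> 0" "d \<noteq> 0" "fst d \<ge> 0" "snd d \<ge> 0"
    for u v d and c :: real
  proof (cases "c > 0")
    case True
    then show False
      using no_ray_in_compact_face[OF e(1,3) that(1,2,3) _ that(5)] up that by blast
  next
    case False
    then have c: "u = v + (- c) *\<^sub>R d" "- c > 0" using that by auto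
    then show False
      using no_ray_in_compact_face[OF e(1,3) that(2,1) c that(5)] up that by blast
  qed
  \<comment> \<open>A proper face lies in the relative boundary, which is what provides a supporting
    line.\<close>
  have "e \<noteq> N"
  proof
    assume "e = N"
    then have "p + 1 *\<^sub>R (1, 0) \<in> e"
      using up[OF p, of 1 "(1, 0)"] by simp
    then show False using no_ray[OF p, of "p + 1 *\<^sub>R (1, 0)" 1 "(1, 0)"] by (simp add: zero_prod_def)
  qed
  \<comment> \<open>A functional minimal at the midpoint takes the same value at both ends, hence on
    the whole line through them.\<close>
  define x where "x = (1/2) *\<^sub>R p + (1/2) *\<^sub>R p'"
  have x: "x \<in> e"
    unfolding x_def using p p' cv by (intro convexD) auto
  then have "x \<notin> rel_interior N"
    using face_of_subset_rel_boundary[OF e(1) \<open>e \<noteq> N\<close>] by blast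
  then have "\<exists>w. w \<noteq> 0 \<and> (\<forall>y\<in>N. w \<bullet> x \<le> w \<bullet> y)"
    by (rule supporting_hyperplane_rel_boundary[OF convex_hull_N subsetD[OF eN x]]) blast
  then obtain w where w: "w \<noteq> 0" "\<And>y. y \<in> N \<Longrightarrow> w \<bullet> x \<le> w \<bullet> y"
    by blast
  have "w \<bullet> x \<le> w \<bullet> p" "w \<bullet> x \<le> w \<bullet> p'" "w \<bullet> x = (w \<bullet> p + w \<bullet> p') / 2"
    using w(2)[OF subsetD[OF eN p]] w(2)[OF subsetD[OF eN p'(1)]]
    by (simp_all add: x_def inner_simps add_divide_distrib)
  then have wp: "w \<bullet> p = w \<bullet> x" "w \<bullet> p' = w \<bullet> x" by simp_all
  have "affine hull {p, p'} = affine hull e"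
    using p p' e(2) hull_mono[of "{p, p'}" e affine] by (intro affine_dim_equal) (simp_all add: affine_affine_hull)
  moreover have "affine hull {p, p'} \<subseteq> {t. w \<bullet> t = w \<bullet> x}"
    using wp by (intro hull_minimal affine_hyperplane) auto
  ultimately have we: "w \<bullet> t = w \<bullet> x" if "t \<in> e" for t
    using that hull_inc[of t e affine] by blast
  have "w \<bullet> x \<le> w \<bullet> (x + 1 *\<^sub>R (1, 0))" "w \<bullet> x \<le> w \<bullet> (x + 1 *\<^sub>R (0, 1))"
    by (intro w(2) up x; simp)+
  then have w0: "0 \<le> fst w" "0 \<le> snd w"
    by (auto simp: inner_prod_def algebra_simps)
  have eq: "fst w * fst p + snd w * snd p = fst w * fst p' + snd w * snd p'"
    using wp by (simp add: inner_prod_def)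
  have "fst w \<noteq> 0"
  proof
    assume "fst w = 0"
    then have "snd w \<noteq> 0" using w(1) by (auto simp: prod_eq_iff)
    then have "snd p = snd p'" using eq \<open>fst w = 0\<close> by simp
    then have "p' = p + (fst p' - fst p) *\<^sub>R (1, 0)" "fst p' - fst p \<noteq> 0"
      using p'(2) by (auto simp: prod_eq_iff)
    from no_ray[OF p p'(1) this] show False by (simp add: zero_prod_def)
  qed
  moreover have "snd w \<noteq> 0"
  proof
    assume "snd w = 0"
    then have "fst p = fst p'" using eq \<open>fst w \<noteq> 0\<close> by simp
    then have "p' = p + (snd p' - snd p) *\<^sub>R (0, 1)" "snd p' - snd p \<noteq> 0"
      using p'(2) by (auto simp: prod_eq_iff)
    from no_ray[OF p p'(1) this] show False by (simp add: zero_prod_def)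
  qed
  ultimately have wpos: "0 < fst w" "0 < snd w" using w0 by auto
  define a where "a = snd w / fst w"
  have a: "a > 0" using wpos by (simp add: a_def)
  have wa: "w \<bullet> t = fst w * (fst t + a * snd t)" for t
    using wpos by (simp add: inner_prod_def a_def field_simps)
  obtain s where s: "s \<in> face a" using face_nonempty[OF a] ..
  have on: "fst t + a * snd t = \<nu> a" if "t \<in> e" for t
  proof -
    have "w \<bullet> t \<le> w \<bullet> s"
      using we[OF that] w(2)[OF subsetD[OF support_subset_hull faceD(1)[OF s]]] by simp
    then have "fst t + a * snd t \<le> fst s + a * snd s"
      using wpos unfolding wa by simp
    then show ?thesis
      using hull_order_le[of t a] that eN a faceD(2)[OF s] by auto
  qed
  have sub: "e \<subseteq> convex hull (face a)"
    using on eN hull_face[OF a] by blast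
  have two: "\<exists>p\<in>face a. \<exists>p'\<in>face a. p \<noteq> p'"
  proof (rule ccontr)
    assume "\<not> ?thesis"
    then have "face a = {s}" using s by blast
    then show False using sub p p' by auto
  qed
  \<comment> \<open>Both sets have dimension 1, and a proper face has smaller dimension.\<close>
  moreover have "e = convex hull (face a)"
  proof (rule ccontr)
    assume ne: "e \<noteq> convex hull (face a)"
    have "e face_of convex hull (face a)"
      using face_of_subset[OF e(1) sub] hull_face[OF a] by blast
    from face_of_aff_dim_lt[OF convex_convex_hull this ne] show False
      using aff_dim_hull_face[OF a] two e(2) by auto
  qed
  ultimately show ?thesis using a by blast
qed

lemma finite_compact_edges: "finite (compact_edges N)"
proof (rule finite_subset)
  show "compact_edges N \<subseteq> (\<lambda>T. convex hull T) ` Pow minimal_points"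
    using compact_edge_hull_face face_subset_minimal by blast
qed (simp add: finite_minimal_points)

text \<open>The last vertex is the left end of the horizontal edge, that is, the leftmost of the
  lowest support points. No extreme point other than this one lies at least as far right, since the
  reflection of the last vertex in it would again belong to \<open>N\<close>.\<close>

lemma last_vertex_lowest:
  "\<exists>v\<in>S. snd (last_vertex N) = snd v \<and> (\<forall>p\<in>S. snd v \<le> snd p)"
proof -
  have Vne: "minimal_points \<noteq> {}"
  proof -
    obtain p where "p \<in> S" using nonempty by blast
    then show ?thesis using minimal_points_below by blast
  qed
  define b where "b = Min (snd ` minimal_points)"
  have b_le: "b \<le> snd v" if "v \<in> minimal_points" for v
    using that finite_minimal_points by (simp add: b_def)
  have "b \<in> snd ` minimal_points"
    unfolding b_def using finite_minimal_points Vne by (intro Min_in) auto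
  then obtain v where v: "v \<in> minimal_points" "snd v = b" by blast
  have low: "b \<le> snd p" if pS: "p \<in> S" for p
  proof -
    obtain u where "u \<in> minimal_points" "fst u \<le> fst p" "snd u \<le> snd p"
      using minimal_points_below[OF pS] by blast
    then show ?thesis using b_le[of u] by simp
  qed
  have left: "fst v \<le> fst p" if pS: "p \<in> S" and "snd p = b" for p
  proof -
    obtain u where u: "u \<in> minimal_points" "fst u \<le> fst p" "snd u \<le> snd p"
      using minimal_points_below[OF pS] by blast
    then have "snd u = b" using b_le[OF u(1)] that by simp
    show ?thesis
    proof (rule ccontr)
      assume "\<not> fst v \<le> fst p"
      then have "fst u < fst v" using u by simp
      moreover have "u = v"
        using v u(1) \<open>snd u = b\<close> \<open>fst u < fst v\<close> unfolding minimal_points_def by fastforce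
      ultimately show False by simp
    qed
  qed
  have vN: "v \<in> N" using v(1) minimal_pointsD support_subset_hull by blast
  have lowN: "b \<le> snd t" if "t \<in> N" for t
    using hull_ge[of 0 1 b t] low that by simp
  have leftN: "fst v \<le> fst t" if "t \<in> N" "snd t = b" for t
  proof -
    \<comment> \<open>All points above the height \<open>b\<close>, plus the ray at height
      \<open>b\<close> that starts at \<open>v\<close> and runs to the right: a convex set
      containing every quadrant, as in \<open>hull_face\<close>.\<close>
    define C where "C = {t::real\<times>real. b < snd t} \<union> {t. snd t = b \<and> fst v \<le> fst t}"
    have "convex C"
    proof (rule convexI)
      fix x y and r s :: real
      assume xy: "x \<in> C" "y \<in> C" and rs: "0 \<le> r" "0 \<le> s" "r + s = 1"
      have gb: "snd (r *\<^sub>R x + s *\<^sub>R y) - b = r * (snd x - b) + s * (snd y - b)"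
      proof -
        have "(r + s) * b = b" using rs by simp
        then show ?thesis by (simp add: algebra_simps)
      qed
      show "r *\<^sub>R x + s *\<^sub>R y \<in> C"
      proof (cases "r = 0 \<or> s = 0 \<or> snd x = b \<and> snd y = b")
        case True
        moreover have "fst v \<le> r * fst x + s * fst y" if "fst v \<le> fst x" "fst v \<le> fst y"
        proof -
          have "r * fst v + s * fst v \<le> r * fst x + s * fst y"
            using that rs by (intro add_mono mult_left_mono) auto
          then show ?thesis using rs(3) by (simp add: distrib_right[symmetric])
        qed
        moreover have "snd (r *\<^sub>R x + s *\<^sub>R y) = b" if "snd x = b" "snd y = b"
          using gb that by simp
        ultimately show ?thesis
          using xy rs unfolding C_def by auto
      next
        case False
        then have "0 < r" "0 < s" "0 < snd x - b \<or> 0 < snd y - b" "0 \<le> snd x - b" "0 \<le> snd y - b"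
          using xy rs by (auto simp: C_def)
        then have "0 < r * (snd x - b) + s * (snd y - b)"
          by (auto intro: add_pos_nonneg add_nonneg_pos)
        then show ?thesis unfolding gb[symmetric] by (simp add: C_def)
      qed
    qed
    moreover have "t \<in> C" if "u \<in> S" "fst u \<le> fst t" "snd u \<le> snd t" for u t
      using low[OF that(1)] left[OF that(1)] that unfolding C_def by force
    ultimately have "N \<subseteq> C" by (rule hull_subsetI)
    then show ?thesis using that by (auto simp: C_def)
  qed
  have extr: "v extreme_point_of N"
    unfolding extreme_point_of_def
  proof (intro conjI ballI vN notI)
    fix s t assume st: "s \<in> N" "t \<in> N" "v \<in> open_segment s t"
    then obtain u where u: "s \<noteq> t" "0 < u" "u < 1" "v = (1 - u) *\<^sub>R s + u *\<^sub>R t"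
      unfolding in_segment by blast
    have comb: "x = y" if "c \<le> x" "c \<le> y" "c = (1 - u) * x + u * y" for x y c
    proof -
      have "(1 - u) * (x - c) + u * (y - c) = 0"
        using that(3) by (simp add: algebra_simps)
      moreover have "0 \<le> (1 - u) * (x - c)" "0 \<le> u * (y - c)"
        using that u by auto
      ultimately have "(1 - u) * (x - c) = 0" "u * (y - c) = 0" by linarith+
      then show ?thesis using u by simp
    qed
    have "snd s = snd t"
      using comb[of b] lowN st(1,2) v(2) u(4) by (simp add: prod_eq_iff)
    moreover from this have "snd s = b"
      using v(2) u(4) by (simp add: algebra_simps)
    moreover have "fst s = fst t"
      using comb[of "fst v"] leftN st(1,2) u(4) calculation by (simp add: prod_eq_iff)
    ultimately show False using u(1) by (simp add: prod_eq_iff)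
  qed
  have right: "w = v" if w: "w extreme_point_of N" "fst v \<le> fst w" for w
  proof (rule ccontr)
    assume ne: "w \<noteq> v"
    have wN: "w \<in> N" using w(1) by (simp add: extreme_point_of_def)
    have "2 *\<^sub>R w - v \<in> N"
      by (rule hull_upward'[OF wN]) (use w(2) lowN[OF wN] v(2) in auto)
    moreover have "w \<in> open_segment v (2 *\<^sub>R w - v)"
    proof -
      have "w = (1 - 1/2) *\<^sub>R v + (1/2) *\<^sub>R (2 *\<^sub>R w - v)"
        by (simp add: algebra_simps)
      moreover have "v \<noteq> 2 *\<^sub>R w - v" using ne
        by (auto simp: prod_eq_iff)
      ultimately show ?thesis
        unfolding in_segment by (intro conjI exI[of _ "1/2"]) auto
    qed
    ultimately show False
      using w(1) vN unfolding extreme_point_of_def by blast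
  qed
  have "last_vertex N = v"
    unfolding last_vertex_def
  proof (rule the_equality)
    show "v extreme_point_of N \<and> (\<forall>w. w extreme_point_of N \<longrightarrow> fst w \<le> fst v)"
      using extr right by (metis linear order_refl)
  qed (use extr right in blast)
  then show ?thesis
    using v low minimal_pointsD[OF v(1)] by (intro bexI[of _ v]) auto
qed

text \<open>With the weight \<open>(1 / \<nu> a, a / \<nu> a)\<close> of an edge the number
  \<open>h_l\<close> becomes \<open>(\<nu> a + \<mu> - a) / (1 + a)\<close>, and the compact edges
  are the slopes whose face has two points.\<close>

lemma edge_heights_iff:
  assumes "\<mu> > 0"
  shows "r \<in> edge_heights \<mu> N \<longleftrightarrow> r = snd (last_vertex N) - 1 \<or>
    (\<exists>a>\<mu>. (\<exists>p\<in>face a. \<exists>p'\<in>face a. p \<noteq> p') \<and> r = (\<nu> a + \<mu> - a) / (1 + a))"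
proof -
  have h: "(1 + \<mu> * (1 / m) - a / m) / (1 / m + a / m) = (m + \<mu> - a) / (1 + a)" if "m > 0" for a m :: real
  proof -
    have "1 + \<mu> * (1 / m) - a / m = (m + \<mu> - a) / m" "1 / m + a / m = (1 + a) / m"
      using that by (simp_all add: field_simps)
    then show ?thesis using that by simp
  qed
  have "(\<exists>\<kappa>1 \<kappa>2. r = (1 + \<mu> * \<kappa>1 - \<kappa>2) / (\<kappa>1 + \<kappa>2) \<and>
      (\<exists>e\<in>compact_edges N. (\<kappa>1, \<kappa>2) = edge_weight e) \<and> \<kappa>2 / \<kappa>1 > \<mu>) \<longleftrightarrow>
    (\<exists>a>\<mu>. (\<exists>p\<in>face a. \<exists>p'\<in>face a. p \<noteq> p') \<and> r = (\<nu> a + \<mu> - a) / (1 + a))" (is "?L \<longleftrightarrow> ?R")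
  proof
    assume ?L
    then obtain \<kappa>1 \<kappa>2 e where L: "r = (1 + \<mu> * \<kappa>1 - \<kappa>2) / (\<kappa>1 + \<kappa>2)"
      "e \<in> compact_edges N" "(\<kappa>1, \<kappa>2) = edge_weight e" "\<kappa>2 / \<kappa>1 > \<mu>" by blast
    obtain a p p' where a: "a > 0" "e = convex hull (face a)" and p: "p \<in> face a" "p' \<in> face a" "p \<noteq> p'"
      using compact_edge_hull_face[OF L(2)] by blast
    have k: "\<kappa>1 = 1 / \<nu> a" "\<kappa>2 = a / \<nu> a"
      using hull_face_compact_edge(2)[OF a(1) p] a(2) L(3) by auto
    have "a > \<mu>"
      using L(4) order_pos[OF a(1)] unfolding k by simp
    then show ?R
      using p L(1) h[OF order_pos[OF a(1)], of a] unfolding k by auto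
  next
    assume ?R
    then obtain a p p' where a: "a > \<mu>" "p \<in> face a" "p' \<in> face a" "p \<noteq> p'"
      "r = (\<nu> a + \<mu> - a) / (1 + a)" by blast
    have a0: "a > 0" using a(1) assms by simp
    have "a / \<nu> a / (1 / \<nu> a) > \<mu>"
      using order_pos[OF a0] a(1) by simp
    then show ?L
      using hull_face_compact_edge[OF a0 a(2-4)] h[OF order_pos[OF a0], of a] a(5)
      by (intro exI[of _ "1 / \<nu> a"] exI[of _ "a / \<nu> a"]) force
  qed
  then show ?thesis
    by (simp add: edge_heights_def)
qed

lemma finite_edge_heights: "finite (edge_heights \<mu> N)"
proof -
  have "edge_heights \<mu> N \<subseteq> insert (snd (last_vertex N) - 1)
      ((\<lambda>e. (1 + \<mu> * fst (edge_weight e) - snd (edge_weight e)) / (fst (edge_weight e) + snd (edge_weight e)))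
        ` compact_edges N)"
    unfolding edge_heights_def
    by (auto intro!: rev_image_eqI) (metis fst_conv snd_conv)
  then show ?thesis
    using finite_compact_edges finite_subset by blast
qed

end

lemma finite_minimizer:
  fixes f :: "'a \<Rightarrow> real"
  assumes "finite W" "W \<noteq> {}"
  shows "\<exists>w\<in>W. \<forall>v\<in>W. f w \<le> f v"
proof -
  have "Min (f ` W) \<in> f ` W" using assms by simp
  then obtain w where "w \<in> W" "f w = Min (f ` W)" by auto
  then show ?thesis using assms by (intro bexI[of _ w]) simp_all
qed

section \<open>Heights over slopes as bounds for the weighted order\<close>

context newton_support
begin

lemma edge_height_le_imp:
  assumes R: "(\<nu> a + \<mu> - a) / (1 + a) \<le> R" and a: "a > 0"
  shows "\<nu> a \<le> (R - \<mu>) + a * (R + 1)"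
proof -
  have "\<nu> a + \<mu> - a \<le> R * (1 + a)"
    using R a by (simp add: pos_divide_le_eq)
  then show ?thesis by (simp add: algebra_simps)
qed

text \<open>\<open>\<nu> a - p1 - a p2\<close> is concave and piecewise linear in \<open>a\<close>, and its breakpoints
  are the slopes of the compact edges. Hence it is nonpositive on \<open>[\<mu>, \<infinity>)\<close> as soon as it is so
  at \<open>\<mu>\<close>, at the edges and in the limit \<open>a \<rightarrow> \<infinity>\<close>.\<close>

lemma order_bound_of_edges:
  assumes \<mu>: "\<mu> > 0" and at_\<mu>: "\<nu> \<mu> \<le> p1 + \<mu> * p2"
    and low: "v0 \<in> S" "snd v0 \<le> p2"
    and edges: "\<And>a p p'. a > \<mu> \<Longrightarrow> p \<in> face a \<Longrightarrow> p' \<in> face a \<Longrightarrow> p \<noteq> p' \<Longrightarrow> \<nu> a \<le> p1 + a * p2"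
    and a: "\<mu> \<le> a"
  shows "\<nu> a \<le> p1 + a * p2"
proof (rule ccontr)
  assume "\<not> ?thesis"
  then have gt: "\<nu> a > p1 + a * p2" by simp
  then have a\<mu>: "a > \<mu>" using at_\<mu> a by (cases "a = \<mu>") auto
  have a0: "a > 0" using \<mu> a by simp
  have fin: "finite (face a)" "face a \<noteq> {}"
    using finite_face[OF a0] face_nonempty[OF a0] by blast+
  \<comment> \<open>The lowest and the highest point of the face govern the weighted order just
    beyond and just before the slope \<open>a\<close>, respectively.\<close>
  obtain P where P: "P \<in> face a" "\<And>v. v \<in> face a \<Longrightarrow> snd P \<le> snd v"
    using finite_minimizer[OF fin, of snd] by blast
  obtain Q where Q: "Q \<in> face a" "\<And>v. v \<in> face a \<Longrightarrow> snd v \<le> snd Q"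
    using finite_minimizer[OF fin, of "\<lambda>v. - snd v"] by auto
  note PS = faceD(1)[OF P(1)] and P\<nu> = faceD(2)[OF P(1)]
  note QS = faceD(1)[OF Q(1)] and Q\<nu> = faceD(2)[OF Q(1)]
  have min_le: "fst p + b * snd p \<le> fst v + b * snd v"
    if b: "b > 0" and m: "\<And>u. u \<in> minimal_points \<Longrightarrow> fst p + b * snd p \<le> fst u + b * snd u"
      and vS: "v \<in> S" for p v b
  proof -
    obtain u where u: "u \<in> minimal_points" "fst u \<le> fst v" "snd u \<le> snd v"
      using minimal_points_below[OF vS] by blast
    then have "b * snd u \<le> b * snd v" using b by simp
    then show ?thesis using m[OF u(1)] u(2) by linarith
  qed
  consider "snd P > p2" | "snd P \<le> p2" "snd Q > p2" | "snd Q \<le> p2" by linarith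
  then show False
  proof cases
    case 1
    define W where "W = {v \<in> minimal_points. snd v < snd P}"
    \<comment> \<open>\<open>s v\<close> is the slope at which \<open>v\<close> and \<open>P\<close>
      have equal weight; the least one over the points below \<open>P\<close> is the next breakpoint
      \<open>b\<close>. Such points exist because of \<open>v0\<close>, and up to \<open>b\<close>
      the violation at \<open>P\<close> only grows, since \<open>snd P > p2\<close>.\<close>
    define s where "s v = (fst v - fst P) / (snd P - snd v)" for v
    obtain u where "u \<in> minimal_points" "fst u \<le> fst v0" "snd u \<le> snd v0"
      using minimal_points_below[OF low(1)] by blast
    then have "u \<in> W" using low(2) 1 by (simp add: W_def)
    then have "W \<noteq> {}" by blast
    moreover have "finite W" using finite_minimal_points by (simp add: W_def)
    ultimately obtain w where w: "w \<in> W" "\<And>v. v \<in> W \<Longrightarrow> s w \<le> s v"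
      using finite_minimizer[of W s] by blast
    have s_gt: "a < s v" if "v \<in> W" for v
    proof -
      have v: "v \<in> S" "snd v < snd P" using that minimal_pointsD by (auto simp: W_def)
      then have "v \<notin> face a" using P(2)[of v] by auto
      then have "\<nu> a < fst v + a * snd v"
        using order_le[OF v(1) a0] v(1) by (auto simp: face_def)
      then have "a * (snd P - snd v) < fst v - fst P"
        using P\<nu> by (simp add: algebra_simps)
      then show ?thesis using v(2) by (simp add: s_def pos_less_divide_eq)
    qed
    define b where "b = s w"
    have b: "b > a" using s_gt[OF w(1)] by (simp add: b_def)
    then have b0: "b > 0" using a0 by simp
    have le: "fst P + b * snd P \<le> fst v + b * snd v" if v: "v \<in> minimal_points" for v
    proof (cases "snd v < snd P")
      case True
      then have "b \<le> s v" using w(2)[of v] v by (simp add: W_def b_def)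
      then have "b * (snd P - snd v) \<le> fst v - fst P"
        using True by (simp add: s_def pos_le_divide_eq)
      then show ?thesis by (simp add: algebra_simps)
    next
      case False
      then have "0 \<le> (b - a) * (snd v - snd P)" using b by simp
      moreover have "fst P + a * snd P \<le> fst v + a * snd v"
        using order_le[OF minimal_pointsD[OF v] a0] P\<nu> by simp
      ultimately show ?thesis by (simp add: algebra_simps)
    qed
    have Pb: "P \<in> face b"
      by (rule order_eqI[OF b0 PS min_le[OF b0 le]])
    moreover have "w \<in> face b"
    proof -
      have "snd w < snd P" "w \<in> S" using w(1) minimal_pointsD by (auto simp: W_def)
      then have "b * (snd P - snd w) = fst w - fst P"
        by (simp add: b_def s_def)
      then have "fst w + b * snd w = fst P + b * snd P"
        by (simp add: algebra_simps)
      then show ?thesis using faceD(2)[OF Pb] \<open>w \<in> S\<close> by (simp add: face_def)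
    qed
    moreover have "P \<noteq> w" using w(1) by (auto simp: W_def)
    ultimately have "\<nu> b \<le> p1 + b * p2"
      using edges[of b P w] b a\<mu> by simp
    moreover have "0 \<le> (b - a) * (snd P - p2)" using b 1 by simp
    ultimately show False
      using gt P\<nu> faceD(2)[OF Pb] by (simp add: algebra_simps)
  next
    case 2
    then have "P \<noteq> Q" by auto
    then show False using edges[OF a\<mu> P(1) Q(1)] gt by simp
  next
    case 3
    \<comment> \<open>Mirror image of the first case: the points that overtake \<open>Q\<close>
      before the slope has decreased to \<open>\<mu>\<close>. The largest crossing slope is the
      previous breakpoint; if there is none, \<open>Q\<close> stays on the face down to
      \<open>\<mu>\<close>, where the bound is assumed.\<close>
    define W where "W = {v \<in> minimal_points. snd v > snd Q \<and> fst v + \<mu> * snd v < fst Q + \<mu> * snd Q}"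
    define s where "s v = (fst Q - fst v) / (snd v - snd Q)" for v
    have above: "fst Q + a * snd Q < fst v + a * snd v" if "v \<in> S" "snd v > snd Q" for v
    proof -
      have "v \<notin> face a" using Q(2)[of v] that by auto
      then show ?thesis
        using order_le[OF that(1) a0] that(1) Q\<nu> by (auto simp: face_def)
    qed
    show False
    proof (cases "W = {}")
      case True
      have "fst Q + \<mu> * snd Q \<le> fst v + \<mu> * snd v" if v: "v \<in> minimal_points" for v
      proof (cases "snd v > snd Q")
        case True
        moreover have "v \<notin> W" using \<open>W = {}\<close> by simp
        ultimately show ?thesis using v by (simp add: W_def)
      next
        case False
        then have "0 \<le> (a - \<mu>) * (snd Q - snd v)" using a\<mu> by simp
        moreover have "fst Q + a * snd Q \<le> fst v + a * snd v"
          using order_le[OF minimal_pointsD[OF v] a0] Q\<nu> by simp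
        ultimately show ?thesis by (simp add: algebra_simps)
      qed
      then have "Q \<in> face \<mu>"
        by (intro order_eqI[OF \<mu> QS min_le[OF \<mu>]])
      then have "\<nu> \<mu> = fst Q + \<mu> * snd Q"
        using faceD(2) by simp
      moreover have "0 \<le> (a - \<mu>) * (p2 - snd Q)" using a\<mu> 3 by simp
      ultimately show False
        using gt at_\<mu> Q\<nu> by (simp add: algebra_simps)
    next
      case False
      moreover have "finite W" using finite_minimal_points by (simp add: W_def)
      ultimately obtain w where w: "w \<in> W" "\<And>v. v \<in> W \<Longrightarrow> s v \<le> s w"
        using finite_minimizer[of W "\<lambda>v. - s v"] by auto
      define b where "b = s w"
      have wS: "w \<in> S" "snd w > snd Q" "fst w + \<mu> * snd w < fst Q + \<mu> * snd Q"
        using w(1) minimal_pointsD by (auto simp: W_def)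
      then have "\<mu> * (snd w - snd Q) < fst Q - fst w"
        by (simp add: algebra_simps)
      then have b\<mu>: "b > \<mu>"
        using wS(2) by (simp add: b_def s_def pos_less_divide_eq)
      have "fst Q - fst w < a * (snd w - snd Q)"
        using above[OF wS(1,2)] by (simp add: algebra_simps)
      then have ba: "b < a"
        using wS(2) by (simp add: b_def s_def pos_divide_less_eq)
      have b0: "b > 0" using b\<mu> \<mu> by simp
      have le: "fst Q + b * snd Q \<le> fst v + b * snd v" if v: "v \<in> minimal_points" for v
      proof -
        consider "v \<in> W" | "snd v > snd Q" "v \<notin> W" | "snd v \<le> snd Q" by linarith
        then show ?thesis
        proof cases
          case 1
          then have "s v \<le> b" "snd Q < snd v" using w(2)[of v] by (auto simp: W_def b_def)
          then have "fst Q - fst v \<le> b * (snd v - snd Q)"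
            by (simp add: s_def pos_divide_le_eq)
          then show ?thesis by (simp add: algebra_simps)
        next
          case 2
          then have "fst Q + \<mu> * snd Q \<le> fst v + \<mu> * snd v" using v by (auto simp: W_def)
          moreover have "0 \<le> (b - \<mu>) * (snd v - snd Q)" using b\<mu> 2 by simp
          ultimately show ?thesis by (simp add: algebra_simps)
        next
          case 3
          then have "0 \<le> (a - b) * (snd Q - snd v)" using ba by simp
          moreover have "fst Q + a * snd Q \<le> fst v + a * snd v"
            using order_le[OF minimal_pointsD[OF v] a0] Q\<nu> by simp
          ultimately show ?thesis by (simp add: algebra_simps)
        qed
      qed
      have Qb: "Q \<in> face b"
        by (rule order_eqI[OF b0 QS min_le[OF b0 le]])
      moreover have "w \<in> face b"
      proof -
        have "b * (snd w - snd Q) = fst Q - fst w"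
          using wS(2) by (simp add: b_def s_def)
        then have "fst w + b * snd w = fst Q + b * snd Q"
          by (simp add: algebra_simps)
        then show ?thesis using faceD(2)[OF Qb] wS(1) by (simp add: face_def)
      qed
      moreover have "Q \<noteq> w" using wS(2) by auto
      ultimately have "\<nu> b \<le> p1 + b * p2"
        using edges[OF b\<mu>, of Q w] by simp
      moreover have "0 \<le> (a - b) * (p2 - snd Q)" using ba 3 by simp
      ultimately show False
        using gt Q\<nu> faceD(2)[OF Qb] by (simp add: algebra_simps)
    qed
  qed
qed

text \<open>The height over a slope \<open>a\<close> is at most \<open>R\<close> iff the point \<open>(R - \<mu>, R + 1)\<close> of the line
  \<open>t\<^sub>2 = t\<^sub>1 + \<mu> + 1\<close> lies on or above the supporting line of that slope.\<close>

lemma max_edge_heights_le_iff: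
  assumes \<mu>: "\<mu> > 0"
  shows "max (\<nu> \<mu> / (1 + \<mu>)) (Max (edge_heights \<mu> N)) \<le> R \<longleftrightarrow>
    (\<forall>a\<ge>\<mu>. \<nu> a \<le> (R - \<mu>) + a * (R + 1))"
proof -
  obtain v where v: "v \<in> S" "snd (last_vertex N) = snd v" "\<And>p. p \<in> S \<Longrightarrow> snd v \<le> snd p"
    using last_vertex_lowest by blast
  have ne: "edge_heights \<mu> N \<noteq> {}" by (simp add: edge_heights_def)
  have at_\<mu>: "\<nu> \<mu> / (1 + \<mu>) \<le> R \<longleftrightarrow> \<nu> \<mu> \<le> (R - \<mu>) + \<mu> * (R + 1)"
    using \<mu> by (simp add: field_simps)
  show ?thesis
  proof
    assume L: "max (\<nu> \<mu> / (1 + \<mu>)) (Max (edge_heights \<mu> N)) \<le> R"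
    then have L': "r \<le> R" if "r \<in> edge_heights \<mu> N" for r
      using Max_ge[OF finite_edge_heights that] by simp
    show "\<forall>a\<ge>\<mu>. \<nu> a \<le> (R - \<mu>) + a * (R + 1)"
    proof (intro allI impI)
      fix a assume "\<mu> \<le> a"
      show "\<nu> a \<le> (R - \<mu>) + a * (R + 1)"
      proof (rule order_bound_of_edges[OF \<mu> _ v(1) _ _ \<open>\<mu> \<le> a\<close>])
        show "\<nu> \<mu> \<le> (R - \<mu>) + \<mu> * (R + 1)" using L at_\<mu> by simp
        have "snd v - 1 \<in> edge_heights \<mu> N"
          unfolding edge_heights_iff[OF \<mu>] v(2) by simp
        then show "snd v \<le> R + 1" using L' by fastforce
        fix a p p' assume a: "a > \<mu>" "p \<in> face a" "p' \<in> face a" "p \<noteq> p'"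
        then have "(\<nu> a + \<mu> - a) / (1 + a) \<in> edge_heights \<mu> N"
          unfolding edge_heights_iff[OF \<mu>] by blast
        from edge_height_le_imp[OF L'[OF this]] show "\<nu> a \<le> (R - \<mu>) + a * (R + 1)"
          using a(1) \<mu> by simp
      qed
    qed
  next
    assume H: "\<forall>a\<ge>\<mu>. \<nu> a \<le> (R - \<mu>) + a * (R + 1)"
    have "r \<le> R" if rH: "r \<in> edge_heights \<mu> N" for r
    proof -
      consider "r = snd v - 1" | a where "a > \<mu>" "r = (\<nu> a + \<mu> - a) / (1 + a)"
        using rH unfolding edge_heights_iff[OF \<mu>] v(2) by blast
      then show ?thesis
      proof cases
        case 1
        show ?thesis
        proof (rule ccontr)
          assume "\<not> r \<le> R"
          then have pos: "0 < snd v - 1 - R" using 1 by simp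
          \<comment> \<open>A slope so large that the height of the horizontal edge alone violates
            the bound, namely \<open>a * (snd v - 1 - R) > R - \<mu>\<close>.\<close>
          define a where "a = max \<mu> ((R - \<mu>) / (snd v - 1 - R) + 1)"
          have "a * snd v \<le> \<nu> a"
          proof -
            have "a > 0" using \<mu> by (simp add: a_def)
            obtain p where p: "p \<in> face a" using face_nonempty[OF \<open>a > 0\<close>] ..
            have "a * snd v \<le> a * snd p" using v(3)[OF faceD(1)[OF p]] \<open>a > 0\<close> by simp
            then show ?thesis using faceD(2)[OF p] nonneg(1)[OF faceD(1)[OF p]] by linarith
          qed
          also have "\<nu> a \<le> (R - \<mu>) + a * (R + 1)" using H by (simp add: a_def)
          finally have "a * (snd v - 1 - R) \<le> R - \<mu>" by (simp add: algebra_simps)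
          then have "a \<le> (R - \<mu>) / (snd v - 1 - R)"
            using pos by (simp add: pos_le_divide_eq)
          then show False by (simp add: a_def)
        qed
      next
        case 2
        then have "\<nu> a \<le> (R - \<mu>) + a * (R + 1)" "0 < 1 + a" using H \<mu> by auto
        then show ?thesis using 2(2) by (simp add: pos_divide_le_eq algebra_simps)
      qed
    qed
    then show "max (\<nu> \<mu> / (1 + \<mu>)) (Max (edge_heights \<mu> N)) \<le> R"
      using H at_\<mu> Max.boundedI[OF finite_edge_heights ne] by auto
  qed
qed

section \<open>The Newton distance and the principal face\<close>

definition distance :: real where
  "distance = (THE d. (d, d) \<in> frontier N)"

text \<open>The diagonal meets \<open>N\<close> in a closed ray. Only its end is a frontier point,
  because beyond it an open quadrant contained in \<open>N\<close> surrounds the point; hence the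
  definite description is justified.\<close>

lemma distance_characterization:
  "(distance, distance) \<in> N" "(t, t) \<in> N \<Longrightarrow> distance \<le> t"
proof -
  define T where "T = {t. (t, t) \<in> N}"
  obtain p where p: "p \<in> S" using nonempty by blast
  have up: "u \<in> T" if "t \<in> T" "t \<le> u" for t u
    using hull_upward'[of "(t, t)" "(u, u)"] that by (simp add: T_def)
  have "(max (fst p) (snd p), max (fst p) (snd p)) \<in> N"
    by (rule hull_upward'[OF subsetD[OF support_subset_hull p]]) auto
  then have ne: "T \<noteq> {}" unfolding T_def by blast
  have "0 \<le> t" if "t \<in> T" for t
    using hull_ge[of 1 0 0 "(t, t)"] nonneg that by (simp add: T_def)
  then have bdd: "bdd_below T" by (rule bdd_belowI)
  have "closed ((\<lambda>t. (t, t)) -` N)"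
    by (intro closed_vimage closed_hull continuous_intros)
  then have "closed T" by (simp add: T_def vimage_def)
  then have m: "Inf T \<in> T" "\<And>t. t \<in> T \<Longrightarrow> Inf T \<le> t"
    using closed_contains_Inf[OF ne bdd] cInf_lower[OF _ bdd] by auto
  define i where "i = Inf T"
  have mem: "t \<in> T \<longleftrightarrow> (t, t) \<in> N" for t by (simp add: T_def)
  note m = m[folded i_def]
  have "distance = i"
    unfolding distance_def
  proof (rule the_equality)
    have "(i, i) \<notin> interior N"
    proof
      assume "(i, i) \<in> interior N"
      then obtain e where e: "e > 0" "ball (i, i) e \<subseteq> N"
        using mem_interior by blast
      have "dist (i, i) (i - e / 3, i - e / 3) \<le> norm (e / 3) + norm (e / 3)"
        using norm_Pair_le[of "e / 3" "e / 3"] by (simp add: dist_norm)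
      also have "\<dots> < e" using e(1) by simp
      finally have "i - e / 3 \<in> T" using e(2) by (auto simp: mem)
      then show False using m(2) e(1) by fastforce
    qed
    then show "(i, i) \<in> frontier N"
      using m(1) closure_subset unfolding frontier_def mem by blast
    fix d assume d: "(d, d) \<in> frontier N"
    then have "d \<in> T" using frontier_subset_closed[OF closed_hull] by (auto simp: mem)
    moreover have "\<not> i < d"
    proof
      assume less: "i < d"
      let ?O = "{p::real\<times>real. i < fst p \<and> i < snd p}"
      have "open ?O" by (intro open_Collect_conj open_Collect_less continuous_intros)
      moreover have "?O \<subseteq> N"
      proof
        fix p assume "p \<in> ?O"
        then show "p \<in> N" by (intro hull_upward'[OF m(1)[unfolded mem]]) auto
      qed
      moreover have "(d, d) \<in> ?O" using less by simp
      ultimately have "(d, d) \<in> interior N" using interior_maximal by blast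
      then show False using d by (simp add: frontier_def)
    qed
    ultimately show "d = i" using m(2) by force
  qed
  then show "(distance, distance) \<in> N" "(t, t) \<in> N \<Longrightarrow> distance \<le> t"
    using m by (auto simp: mem)
qed

lemma order_le_distance:
  assumes "a > 0" shows "\<nu> a \<le> (1 + a) * distance"
  using hull_order_le[OF distance_characterization(1) assms] by (simp add: distrib_right)

lemma distance_pos: "distance > 0"
  using order_le_distance[of 1] order_pos[of 1] by simp

text \<open>The slope is to be rational because it will serve as exponent of a fractional function.
  A line separating \<open>(r, r)\<close> from \<open>N\<close> may be parallel to an axis or
  irrational, so its weights are enlarged slightly to positive rational numbers.\<close>

lemma order_near_distance:
  assumes r: "0 \<le> r" "r < distance"
  shows "\<exists>m n::nat. m > 0 \<and> n > 0 \<and> (1 + real m / real n) * r < \<nu> (real m / real n)"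
proof -
  have "(r, r) \<notin> N" using distance_characterization(2) r by force
  then obtain w b where w: "w \<bullet> (r, r) < b" "\<And>t. t \<in> N \<Longrightarrow> b < w \<bullet> t"
    using separating_hyperplane_closed_point[OF convex_hull_N closed_hull] by blast
  obtain p where p: "p \<in> N" using nonempty support_subset_hull by blast
  have wt: "w \<bullet> t = fst w * fst t + snd w * snd t" for t
    by (simp add: inner_prod_def)
  \<comment> \<open>Otherwise the functional would be unbounded below on \<open>N\<close>;
    \<open>s\<close> is how far to go along \<open>d\<close> to bring its value down to
    \<open>b\<close>.\<close>
  have dir: "0 \<le> w \<bullet> d" if d: "0 \<le> fst d" "0 \<le> snd d" for d
  proof (rule ccontr)
    assume "\<not> 0 \<le> w \<bullet> d"
    then have neg: "w \<bullet> d < 0" by simp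
    define s where "s = (w \<bullet> p - b) / (- (w \<bullet> d))"
    have "s \<ge> 0" unfolding s_def using w(2)[OF p] neg by (intro divide_nonneg_nonneg) linarith+
    then have "s *\<^sub>R d + p \<in> N" using hull_upward[OF p, of "s *\<^sub>R d"] d by simp
    from w(2)[OF this] have "b < s * (w \<bullet> d) + w \<bullet> p" by (simp add: inner_simps)
    moreover have "s * (w \<bullet> d) = - (w \<bullet> p - b)" using neg by (simp add: s_def)
    ultimately show False by simp
  qed
  have w0: "0 \<le> fst w" "0 \<le> snd w"
    using dir[of "(1, 0)"] dir[of "(0, 1)"] by (simp_all add: wt)
  \<comment> \<open>Enlarging both weights by at most \<open>e\<close> raises the value at
    \<open>(r, r)\<close> by at most \<open>2 * e * r\<close>, less than the gap; the summand 1
    covers \<open>r = 0\<close>.\<close>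
  define e where "e = (b - w \<bullet> (r, r)) / (2 * (r + 1))"
  have e: "e > 0" using w(1) r by (simp add: e_def)
  obtain x y where x: "x \<in> \<rat>" "fst w < x" "x < fst w + e" and y: "y \<in> \<rat>" "snd w < y" "y < snd w + e"
    using Rats_dense_in_real[of "fst w" "fst w + e"] Rats_dense_in_real[of "snd w" "snd w + e"] e by auto
  have xy: "0 < x" "0 < y" using x y w0 by auto
  define a where "a = y / x"
  have a: "a > 0" using xy by (simp add: a_def)
  have "(x + y) * r < b"
  proof -
    have "(x + y) * r \<le> (fst w + snd w + 2 * e) * r"
      using x y r by (intro mult_right_mono) auto
    also have "\<dots> = w \<bullet> (r, r) + 2 * e * r" by (simp add: wt algebra_simps)
    also have "\<dots> < w \<bullet> (r, r) + 2 * e * (r + 1)" using e by simp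
    also have "2 * e * (r + 1) = b - w \<bullet> (r, r)" using r by (simp add: e_def field_simps)
    finally show ?thesis by simp
  qed
  obtain p where p: "p \<in> face a" using face_nonempty[OF a] ..
  have "b < fst w * fst p + snd w * snd p"
    using w(2)[OF subsetD[OF support_subset_hull faceD(1)[OF p]]] unfolding wt .
  also have "\<dots> \<le> x * fst p + y * snd p"
    using nonneg[OF faceD(1)[OF p]] x y by (intro add_mono mult_right_mono) auto
  also have "\<dots> = x * \<nu> a"
    using faceD(2)[OF p] xy by (simp add: a_def field_simps)
  finally have "(x + y) * r < x * \<nu> a" using \<open>(x + y) * r < b\<close> by simp
  moreover have "x + y = x * (1 + a)" using xy by (simp add: a_def field_simps)
  ultimately have "x * ((1 + a) * r) < x * \<nu> a" by simp
  then have "(1 + a) * r < \<nu> a" using xy by simp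
  moreover have "a \<in> \<rat>" using x y by (simp add: a_def)
  then obtain m n :: nat where "n \<noteq> 0" "\<bar>a\<bar> = real m / real n"
    using Rats_abs_nat_div_natE by metis
  moreover have "a = real m / real n" using a calculation by simp
  moreover from this have "m > 0" using a by (cases m) auto
  ultimately show ?thesis by blast
qed

text \<open>The segment crosses the diagonal at a point of \<open>N\<close> on the supporting line.
  Membership in \<open>N\<close> bounds the distance from above, the supporting line bounds it from
  below.\<close>

lemma diagonal_point_of_mixed_face:
  assumes a: "a > 0" and p: "p \<in> face a" "fst p < snd p" and p': "p' \<in> face a" "snd p' < fst p'"
  shows "distance = \<nu> a / (1 + a)" and "(distance, distance) \<in> open_segment p p'"
proof -
  define g where "g t = fst t - snd t" for t :: "real \<times> real"
  define u where "u = - g p / (g p' - g p)"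
  have g: "g p < 0" "0 < g p'" using p p' by (auto simp: g_def)
  then have u: "0 < u" "u < 1" by (auto simp: u_def field_simps)
  define z where "z = (1 - u) *\<^sub>R p + u *\<^sub>R p'"
  have zs: "z \<in> open_segment p p'"
    unfolding in_segment using p p' u z_def by auto
  have "g z = g p + u * (g p' - g p)" by (simp add: g_def z_def algebra_simps)
  also have "\<dots> = 0" using g by (simp add: u_def)
  finally have zd: "fst z = snd z" by (simp add: g_def)
  have "z \<in> convex hull (face a)"
    unfolding z_def using p(1) p'(1) u by (intro convexD[OF convex_convex_hull]) (auto simp: hull_inc)
  then have z: "z \<in> N" "fst z + a * snd z = \<nu> a" using hull_face_on[OF a] by auto
  then have "(1 + a) * fst z = \<nu> a" using zd by (simp add: algebra_simps)
  then have zv: "fst z = \<nu> a / (1 + a)" using a by (simp add: field_simps)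
  have "z = (fst z, fst z)" using zd by (simp add: prod_eq_iff)
  then have "distance \<le> fst z" using distance_characterization(2) z(1) by metis
  moreover have "fst z \<le> distance" using order_le_distance[OF a] a unfolding zv by (simp add: field_simps)
  ultimately have d: "distance = fst z" by simp
  then show "distance = \<nu> a / (1 + a)" using zv by simp
  show "(distance, distance) \<in> open_segment p p'" using zs d \<open>z = (fst z, fst z)\<close> by metis
qed

definition main_face :: "(real \<times> real) set" where
  "main_face = (THE F. F face_of N \<and> (distance, distance) \<in> F \<and>
     (\<forall>G. G face_of N \<and> (distance, distance) \<in> G \<longrightarrow> aff_dim F \<le> aff_dim G))"

text \<open>Faces are closed under intersection and a proper face has smaller dimension, so there is
  only one face of least dimension through the diagonal point.\<close>

lemma main_face_unique:
  assumes F: "F face_of N" "(distance, distance) \<in> F"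
    "\<And>G. G face_of N \<Longrightarrow> (distance, distance) \<in> G \<Longrightarrow> aff_dim F \<le> aff_dim G"
  shows "main_face = F"
  unfolding main_face_def
proof (rule the_equality)
  fix F' assume F': "F' face_of N \<and> (distance, distance) \<in> F' \<and>
     (\<forall>G. G face_of N \<and> (distance, distance) \<in> G \<longrightarrow> aff_dim F' \<le> aff_dim G)"
  have I: "(F \<inter> F') face_of N" "(distance, distance) \<in> F \<inter> F'"
    using F F' face_of_Int by blast+
  have "F \<inter> F' = G" if G: "G face_of N" "F \<inter> F' \<subseteq> G" "aff_dim G \<le> aff_dim (F \<inter> F')" for G
  proof (rule ccontr)
    assume "F \<inter> F' \<noteq> G"
    moreover have "(F \<inter> F') face_of G"
      using face_of_subset[OF I(1) G(2) face_of_imp_subset[OF G(1)]] .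
    ultimately show False
      using face_of_aff_dim_lt[OF face_of_imp_convex[OF G(1)]] G(3) by fastforce
  qed
  from this[of F] this[of F'] show "F' = F"
    using F F' I by auto
qed (use F in blast)

lemma main_face_mem: "main_face face_of N" "(distance, distance) \<in> main_face"
proof -
  define P where "P F \<longleftrightarrow> F face_of N \<and> (distance, distance) \<in> F" for F
  have "P N" using face_of_refl[OF convex_hull_N] distance_characterization(1) by (simp add: P_def)
  \<comment> \<open>\<open>aff_dim\<close> is at least -1, so after a shift by 1 it can be minimized
    as a natural number.\<close>
  then obtain F where F: "P F" "\<And>G. P G \<Longrightarrow> nat (aff_dim F + 1) \<le> nat (aff_dim G + 1)"
    using ex_has_least_nat[of P N "\<lambda>F. nat (aff_dim F + 1)"] by blast
  have "aff_dim F \<le> aff_dim G" if "P G" for G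
    using F(2)[OF that] aff_dim_geq[of F] aff_dim_geq[of G] by simp
  then have "main_face = F"
    using F(1) by (intro main_face_unique) (auto simp: P_def)
  then show "main_face face_of N" "(distance, distance) \<in> main_face"
    using F(1) by (auto simp: P_def)
qed

text \<open>The diagonal point lies inside a segment between two points of the face, so every face
  through it contains both ends and has dimension at least 1.\<close>

lemma main_face_of_mixed_face:
  assumes a: "a > 0" and p: "p \<in> face a" "fst p < snd p" and p': "p' \<in> face a" "snd p' < fst p'"
  shows "main_face = convex hull (face a)"
proof (rule main_face_unique)
  note d = diagonal_point_of_mixed_face[OF assms]
  have pp': "p \<noteq> p'" "p \<in> N" "p' \<in> N"
    using p p' subsetD[OF support_subset_hull faceD(1)] by auto
  show "convex hull (face a) face_of N" by (rule hull_face_face_of[OF a])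
  show "(distance, distance) \<in> convex hull (face a)"
    using d(2) p(1) p'(1) convex_contains_open_segment[of "convex hull (face a)"] by (meson convex_convex_hull hull_inc subsetD)
  fix G assume G: "G face_of N" "(distance, distance) \<in> G"
  then have "{p, p'} \<subseteq> G" using face_ofD[OF G(1) d(2)] pp' by blast
  then have "1 \<le> aff_dim G" using aff_dim_subset[of "{p, p'}" G] pp' by simp
  then show "aff_dim (convex hull (face a)) \<le> aff_dim G"
    using aff_dim_hull_face[OF a p(1) p'(1)] pp' by simp
qed

lemma main_face_compact_edge:
  assumes "main_face \<in> compact_edges N"
  obtains a p where "a > 0" "main_face = convex hull (face a)" "edge_weight main_face = (1 / \<nu> a, a / \<nu> a)"
    "\<nu> a = (1 + a) * distance" "p \<in> face a" "distance \<le> snd p"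
proof -
  obtain a p p' where a: "a > 0" "main_face = convex hull (face a)" and p: "p \<in> face a" "p' \<in> face a" "p \<noteq> p'"
    using compact_edge_hull_face[OF assms] by blast
  have on: "\<nu> a = (1 + a) * distance"
    using hull_face_on[OF a(1), of "(distance, distance)"] main_face_mem(2) a(2) by (simp add: algebra_simps)
  \<comment> \<open>The diagonal point is a convex combination of points of the face, which
    therefore cannot all lie strictly below it.\<close>
  have "\<exists>p\<in>face a. distance \<le> snd p"
  proof (rule ccontr)
    assume "\<not> ?thesis"
    then have "face a \<subseteq> {t. (0, 1) \<bullet> t < distance}" by (auto simp: inner_prod_def)
    then have "convex hull (face a) \<subseteq> {t. (0, 1) \<bullet> t < distance}"
      by (intro hull_minimal convex_halfspace_lt)
    then show False using main_face_mem(2) a(2) by (auto simp: inner_prod_def)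
  qed
  then show thesis
    using that[OF a _ on] hull_face_compact_edge(2)[OF a(1) p] a(2) by auto
qed

lemma supporting_weight_eq:
  assumes "\<mu> > 0"
  shows "supporting_weight \<mu> N = (1 / \<nu> \<mu>, \<mu> / \<nu> \<mu>)"
  unfolding supporting_weight_def
proof (rule the_equality)
  have \<nu>: "\<nu> \<mu> > 0" by (rule order_pos[OF assms])
  obtain p where p: "p \<in> face \<mu>" using face_nonempty[OF assms] ..
  have pN: "p \<in> N" using p faceD(1) support_subset_hull by blast
  have e: "(1 / \<nu> \<mu>, \<mu> / \<nu> \<mu>) \<bullet> t = (fst t + \<mu> * snd t) / \<nu> \<mu>" for t
    by (simp add: inner_prod_def add_divide_distrib)
  show "0 < fst (1 / \<nu> \<mu>, \<mu> / \<nu> \<mu>) \<and> snd (1 / \<nu> \<mu>, \<mu> / \<nu> \<mu>) / fst (1 / \<nu> \<mu>, \<mu> / \<nu> \<mu>) = \<mu> \<and>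
    N \<subseteq> {t. 1 \<le> (1 / \<nu> \<mu>, \<mu> / \<nu> \<mu>) \<bullet> t} \<and> N \<inter> {t. (1 / \<nu> \<mu>, \<mu> / \<nu> \<mu>) \<bullet> t = 1} \<noteq> {}"
    unfolding e using \<nu> hull_order_le[OF _ assms] pN faceD(2)[OF p] by (auto simp: pos_le_divide_eq)
  fix \<kappa> assume k: "0 < fst \<kappa> \<and> snd \<kappa> / fst \<kappa> = \<mu> \<and> N \<subseteq> {t. 1 \<le> \<kappa> \<bullet> t} \<and> N \<inter> {t. \<kappa> \<bullet> t = 1} \<noteq> {}"
  then have sk: "snd \<kappa> = \<mu> * fst \<kappa>" by (auto simp: field_simps)
  have kt: "\<kappa> \<bullet> t = fst \<kappa> * (fst t + \<mu> * snd t)" for t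
    by (simp add: inner_prod_def sk algebra_simps)
  obtain t where t: "t \<in> N" "\<kappa> \<bullet> t = 1" using k by blast
  have "1 \<le> fst \<kappa> * \<nu> \<mu>" using k pN kt[of p] faceD(2)[OF p] by auto
  moreover have "fst \<kappa> * \<nu> \<mu> \<le> 1"
    using t hull_order_le[OF t(1) assms] k unfolding kt by (metis mult_le_cancel_left_pos)
  ultimately have "fst \<kappa> * \<nu> \<mu> = 1" by simp
  then show "\<kappa> = (1 / \<nu> \<mu>, \<mu> / \<nu> \<mu>)"
    using \<nu> sk by (simp add: prod_eq_iff field_simps)
qed

lemma supporting_distance:
  assumes "\<mu> > 0"
  shows "(THE d. supporting_weight \<mu> N \<bullet> (d, d) = 1) = \<nu> \<mu> / (1 + \<mu>)"
proof (rule the_equality)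
  have e: "supporting_weight \<mu> N \<bullet> (d, d) = d * (1 + \<mu>) / \<nu> \<mu>" for d
    unfolding supporting_weight_eq[OF assms]
    by (simp add: inner_prod_def distrib_left add_divide_distrib mult.commute)
  show "supporting_weight \<mu> N \<bullet> (\<nu> \<mu> / (1 + \<mu>), \<nu> \<mu> / (1 + \<mu>)) = 1"
    unfolding e using assms order_pos[OF assms] by simp
  fix d assume "supporting_weight \<mu> N \<bullet> (d, d) = 1"
  then show "d = \<nu> \<mu> / (1 + \<mu>)"
    unfolding e using assms order_pos[OF assms] by (simp add: field_simps)
qed

end

section \<open>Multiplicities of roots\<close>

text \<open>If the constant term vanishes, dividing by the variable changes neither number. If not,
  differentiation removes exactly one monomial and lowers the multiplicity by at most one.\<close>

lemma order_less_card_coeffs: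
  fixes P :: "real poly"
  assumes "P \<noteq> 0" "\<gamma> \<noteq> 0"
  shows "order \<gamma> P < card {b. coeff P b \<noteq> 0}"
  using assms(1)
proof (induction "degree P" arbitrary: P rule: less_induct)
  case less
  have fin: "finite {b. coeff Q b \<noteq> 0}" for Q :: "real poly"
    by (rule finite_subset[of _ "{..degree Q}"]) (auto intro: le_degree)
  show ?case
  proof (cases "degree P = 0")
    case True
    then obtain c where c: "P = [:c:]" by (rule degree_eq_zeroE)
    then have "poly P \<gamma> \<noteq> 0" using less.prems by simp
    then have "order \<gamma> P = 0" by (rule order_0I)
    moreover have "degree P \<in> {b. coeff P b \<noteq> 0}"
      using leading_coeff_neq_0[OF less.prems] by simp
    then have "0 < card {b. coeff P b \<noteq> 0}"
      using fin[of P] card_gt_0_iff by blast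
    ultimately show ?thesis by simp
  next
    case deg: False
    show ?thesis
    proof (cases "coeff P 0 = 0")
      case True
      obtain c Q where cQ: "P = pCons c Q" by (cases P)
      then have Q: "P = pCons 0 Q" using True by simp
      have Q0: "Q \<noteq> 0" using Q less.prems by auto
      have "order \<gamma> P = order \<gamma> ([:0, 1:] * Q)" by (simp add: Q)
      also have "\<dots> = order \<gamma> [:0, 1:] + order \<gamma> Q"
        using Q0 by (intro order_mult) simp
      also have "order \<gamma> [:0, 1:] = 0" using assms(2) by (intro order_0I) simp
      finally have "order \<gamma> P = order \<gamma> Q" by simp
      moreover have "{b. coeff P b \<noteq> 0} = Suc ` {b. coeff Q b \<noteq> 0}"
      proof (intro set_eqI iffI)
        fix b assume "b \<in> {b. coeff P b \<noteq> 0}"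
        then show "b \<in> Suc ` {b. coeff Q b \<noteq> 0}" by (cases b) (auto simp: Q)
      qed (auto simp: Q)
      moreover have "order \<gamma> Q < card {b. coeff Q b \<noteq> 0}"
        using less.hyps[of Q] Q0 by (simp add: Q)
      ultimately show ?thesis by (simp add: card_image)
    next
      case False
      have pd: "pderiv P \<noteq> 0" using deg by (simp add: pderiv_eq_0_iff)
      have "{b. coeff P b \<noteq> 0} = insert 0 (Suc ` {b. coeff (pderiv P) b \<noteq> 0})"
      proof (intro set_eqI iffI)
        fix b assume "b \<in> {b. coeff P b \<noteq> 0}"
        then show "b \<in> insert 0 (Suc ` {b. coeff (pderiv P) b \<noteq> 0})"
          by (cases b) (auto simp: coeff_pderiv)
      qed (use False in \<open>auto simp: coeff_pderiv\<close>)
      then have card: "card {b. coeff P b \<noteq> 0} = Suc (card {b. coeff (pderiv P) b \<noteq> 0})"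
        using fin[of "pderiv P"] by (simp add: card_image)
      have "degree (pderiv P) < degree P" using deg by (simp add: degree_pderiv)
      from less.hyps[OF this pd] have *: "order \<gamma> (pderiv P) < card {b. coeff (pderiv P) b \<noteq> 0}" .
      have "order \<gamma> P \<le> Suc (order \<gamma> (pderiv P))"
        using order_pderiv[OF less.prems, of \<gamma>] order_0I[of P \<gamma>] by (cases "poly P \<gamma> = 0") auto
      then show ?thesis using card * by simp
    qed
  qed
qed

lemma pcompose_power: "pcompose (p ^ n) r = pcompose p r ^ n" for p r :: "real poly"
  by (induction n) (simp_all add: pcompose_mult pcompose_1)

text \<open>The translation moves the root to 0, where the multiplicity is the least exponent that
  occurs.\<close>

lemma power_dvd_iff_translated_coeffs:
  fixes P :: "real poly"
  shows "[:- \<gamma>, 1:] ^ n dvd P \<longleftrightarrow> (\<forall>k<n. coeff (pcompose P [:\<gamma>, 1:]) k = 0)"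
proof -
  have "monom 1 n dvd pcompose P [:\<gamma>, 1:] \<longleftrightarrow> [:- \<gamma>, 1:] ^ n dvd P"
  proof
    assume "[:- \<gamma>, 1:] ^ n dvd P"
    then obtain R where "P = [:- \<gamma>, 1:] ^ n * R" by (auto elim: dvdE)
    then have "pcompose P [:\<gamma>, 1:] = monom 1 n * pcompose R [:\<gamma>, 1:]"
      by (simp add: pcompose_mult pcompose_power pcompose_pCons monom_altdef)
    then show "monom 1 n dvd pcompose P [:\<gamma>, 1:]" by simp
  next
    assume "monom 1 n dvd pcompose P [:\<gamma>, 1:]"
    then obtain R where R: "pcompose P [:\<gamma>, 1:] = monom 1 n * R" by (auto elim: dvdE)
    have "P = pcompose (pcompose P [:\<gamma>, 1:]) [:- \<gamma>, 1:]"
      by (simp add: pcompose_assoc[symmetric] pcompose_pCons)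
    also have "\<dots> = [:- \<gamma>, 1:] ^ n * pcompose R [:- \<gamma>, 1:]"
      unfolding R by (simp add: pcompose_mult pcompose_power pcompose_pCons monom_altdef)
    finally show "[:- \<gamma>, 1:] ^ n dvd P" by simp
  qed
  then show ?thesis by (simp add: monom_1_dvd_iff')
qed

section \<open>Puiseux expansions of smooth functions\<close>

text \<open>The coefficient of \<open>x^\<alpha> y^b\<close> in the expansion of
  \<open>G (\<sigma> x^(1/q), y)\<close>, where the sign \<open>\<sigma>\<close> selects the
  half-plane. The floor recovers the integer \<open>\<alpha> q\<close>.\<close>

definition puiseux_coeff :: "real \<Rightarrow> nat \<Rightarrow> (real \<times> real \<Rightarrow> real) \<Rightarrow> real \<Rightarrow> nat \<Rightarrow> real" where
  "puiseux_coeff \<sigma> q G \<alpha> b = (if \<exists>k::nat. \<alpha> = real k / real q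
     then \<sigma> ^ nat \<lfloor>\<alpha> * real q\<rfloor> * taylor_coeff G (nat \<lfloor>\<alpha> * real q\<rfloor>) b else 0)"

lemma puiseux_coeff_at: "q > 0 \<Longrightarrow> puiseux_coeff \<sigma> q G (real k / real q) b = \<sigma> ^ k * taylor_coeff G k b"
  by (auto simp: puiseux_coeff_def)

lemma puiseux_coeff_nonzero:
  assumes "q > 0" "puiseux_coeff \<sigma> q G \<alpha> b \<noteq> 0"
  shows "\<exists>k. \<alpha> = real k / real q \<and> taylor_coeff G k b \<noteq> 0"
proof -
  obtain k where k: "\<alpha> = real k / real q"
    using assms(2) by (auto simp: puiseux_coeff_def split: if_splits)
  then show ?thesis using assms puiseux_coeff_at[OF assms(1), of \<sigma> G k b] by auto
qed

lemma coeff_support_puiseux_coeff: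
  assumes "q > 0" "\<sigma> \<noteq> 0"
  shows "coeff_support (puiseux_coeff \<sigma> q G) = {(real k / real q, real b) | k b. taylor_coeff G k b \<noteq> 0}"
proof (intro set_eqI iffI)
  fix p assume "p \<in> coeff_support (puiseux_coeff \<sigma> q G)"
  then obtain \<alpha> b where p: "p = (\<alpha>, real b)" "puiseux_coeff \<sigma> q G \<alpha> b \<noteq> 0"
    unfolding coeff_support_def by blast
  from puiseux_coeff_nonzero[OF assms(1) p(2)] p(1)
  show "p \<in> {(real k / real q, real b) | k b. taylor_coeff G k b \<noteq> 0}" by blast
next
  fix p assume "p \<in> {(real k / real q, real b) | k b. taylor_coeff G k b \<noteq> 0}"
  then obtain k b where p: "p = (real k / real q, real b)" "taylor_coeff G k b \<noteq> 0" by blast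
  then have "puiseux_coeff \<sigma> q G (real k / real q) b \<noteq> 0"
    using puiseux_coeff_at[OF assms(1)] assms(2) by simp
  then show "p \<in> coeff_support (puiseux_coeff \<sigma> q G)"
    using coeff_supportI p(1) by blast
qed

lemma lattice_puiseux_coeff: "q > 0 \<Longrightarrow> lattice_set q (coeff_support (puiseux_coeff \<sigma> q G))"
  using puiseux_coeff_nonzero by (intro lattice_coeff_support) blast+

lemma puiseux_expansion_smooth:
  assumes G: "smooth_near_0 G" and q: "q > 0" and \<sigma>: "\<bar>\<sigma>\<bar> = 1" and r: "0 < r"
    and F: "\<And>x y. 0 < x \<Longrightarrow> x < r \<Longrightarrow> \<bar>y\<bar> < r \<Longrightarrow> F x y = G (\<sigma> * root q x, y)"
  shows "puiseux_expansion F (puiseux_coeff \<sigma> q G)"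
  unfolding puiseux_expansion_def
proof (intro conjI allI)
  let ?c = "puiseux_coeff \<sigma> q G"
  have lat: "lattice_set q (coeff_support ?c)" by (rule lattice_puiseux_coeff[OF q])
  then show "\<exists>q. lattice_set q (coeff_support ?c)" by blast
  fix N
  \<comment> \<open>The Taylor order in \<open>s = \<sigma> x^(1/q)\<close> for which the remainder
    \<open>\<bar>s\<bar> ^ ?M\<close> is exactly \<open>x ^ N\<close>.\<close>
  let ?M = "q * N"
  let ?t = "taylor_coeff G"
  obtain C e where e: "0 < e" "e \<le> 1" "0 \<le> C" "\<And>s y. \<bar>s\<bar> \<le> e \<Longrightarrow> \<bar>y\<bar> \<le> e \<Longrightarrow>
      \<bar>G (s, y) - (\<Sum>a<?M. \<Sum>b<?M. ?t a b * s ^ a * y ^ b)\<bar> \<le> C * (\<bar>s\<bar> ^ ?M + \<bar>y\<bar> ^ ?M)"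
    using taylor_estimate[OF G, of ?M] by blast
  \<comment> \<open>The Taylor polynomial reaches up to \<open>?M\<close> in \<open>y\<close> as
    well, whereas the truncation stops at \<open>N\<close>; \<open>K\<close> bounds the excess terms
    against \<open>\<bar>y\<bar> ^ N\<close>.\<close>
  define K where "K = (\<Sum>a<?M. \<Sum>b\<in>{N..<?M}. \<bar>?t a b\<bar>)"
  have K: "0 \<le> K" unfolding K_def by (intro sum_nonneg) auto
  have NM: "N \<le> ?M" using q by simp
  have main: "\<bar>F x y - puiseux_sum ?c N x y\<bar>
      \<le> (C + K) * (x ^ N + \<bar>y\<bar> ^ N)" if x: "0 < x" "x < min r (e ^ q)" and y: "\<bar>y\<bar> < min r e" for x y
  proof -
    define s where "s = \<sigma> * root q x"
    have rt: "0 < root q x" "root q x ^ q = x" using x q by simp_all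
    have "root q x \<le> root q (e ^ q)" using x q by simp
    then have "root q x \<le> e" using q e(1) by (simp add: real_root_power_cancel)
    then have s: "\<bar>s\<bar> = root q x" "\<bar>s\<bar> \<le> e" using rt \<sigma> by (auto simp: s_def abs_mult)
    have s1: "\<bar>s\<bar> \<le> 1" "\<bar>y\<bar> \<le> 1" using s(2) e(2) y by auto
    have sM: "\<bar>s\<bar> ^ ?M = x ^ N" by (simp add: s(1) power_mult rt(2))
    have yM: "\<bar>y\<bar> ^ ?M \<le> \<bar>y\<bar> ^ N" using s1(2) NM by (intro power_decreasing) auto
    have trunc: "puiseux_sum ?c N x y = (\<Sum>a<?M. \<Sum>b<N. ?t a b * s ^ a * y ^ b)"
    proof -
      let ?i = "\<lambda>(k::nat, b::nat). (real k / real q, b)"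
      have inj: "inj_on ?i ({..<?M} \<times> {..<N})" using q by (auto simp: inj_on_def)
      have "puiseux_sum ?c N x y
          = (\<Sum>(\<alpha>, b)\<in>?i ` ({..<?M} \<times> {..<N}). ?c \<alpha> b * x powr \<alpha> * y ^ b)"
      proof (rule sum.mono_neutral_left)
        show "puiseux_trunc ?c N \<subseteq> ?i ` ({..<?M} \<times> {..<N})"
        proof
          fix p assume "p \<in> puiseux_trunc ?c N"
          then obtain \<alpha> b where p: "p = (\<alpha>, b)" "?c \<alpha> b \<noteq> 0" "\<alpha> < real N" "b < N"
            unfolding puiseux_trunc_def by blast
          from puiseux_coeff_nonzero[OF q p(2)] obtain k where k: "\<alpha> = real k / real q" by blast
          then have "real k < real N * real q" using p(3) q by (simp add: pos_divide_less_eq)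
          then have "k < ?M" by (metis mult.commute of_nat_less_iff of_nat_mult)
          then show "p \<in> ?i ` ({..<?M} \<times> {..<N})" using p k by force
        qed
        show "\<forall>p\<in>?i ` ({..<?M} \<times> {..<N}) - puiseux_trunc ?c N. (case p of (\<alpha>, b) \<Rightarrow> ?c \<alpha> b * x powr \<alpha> * y ^ b) = 0"
        proof
          fix p assume p: "p \<in> ?i ` ({..<?M} \<times> {..<N}) - puiseux_trunc ?c N"
          then obtain k b where kb: "p = (real k / real q, b)" "k < ?M" "b < N" by auto
          have "real k < real N * real q" using kb(2) by (metis mult.commute of_nat_less_iff of_nat_mult)
          then have "real k / real q < real N" using q by (simp add: pos_divide_less_eq)
          then have "?c (real k / real q) b = 0" using p kb by (auto simp: puiseux_trunc_def)
          then show "(case p of (\<alpha>, b) \<Rightarrow> ?c \<alpha> b * x powr \<alpha> * y ^ b) = 0" by (simp add: kb)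
        qed
      qed simp
      also have "\<dots> = (\<Sum>(k, b)\<in>{..<?M} \<times> {..<N}. ?c (real k / real q) b * x powr (real k / real q) * y ^ b)"
        by (subst sum.reindex[OF inj]) (simp add: case_prod_beta)
      also have "\<dots> = (\<Sum>(k, b)\<in>{..<?M} \<times> {..<N}. ?t k b * s ^ k * y ^ b)"
      proof (intro sum.cong refl, clarify)
        fix k b
        have "x powr (real k / real q) = root q x ^ k"
          using x q by (simp add: root_powr_inverse powr_powr powr_realpow[symmetric])
        then show "?c (real k / real q) b * x powr (real k / real q) * y ^ b = ?t k b * s ^ k * y ^ b"
          by (simp add: puiseux_coeff_at[OF q] s_def power_mult_distrib)
      qed
      finally show ?thesis by (simp add: sum.cartesian_product)
    qed
    have split: "(\<Sum>a<?M. \<Sum>b<?M. ?t a b * s ^ a * y ^ b)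
        = (\<Sum>a<?M. \<Sum>b<N. ?t a b * s ^ a * y ^ b) + (\<Sum>a<?M. \<Sum>b\<in>{N..<?M}. ?t a b * s ^ a * y ^ b)"
    proof -
      have "(\<Sum>b<?M. h b) = (\<Sum>b<N. h b) + (\<Sum>b\<in>{N..<?M}. h b)" for h :: "nat \<Rightarrow> real"
        using sum.atLeastLessThan_concat[OF le0 NM, of h] by (simp add: lessThan_atLeast0)
      then show ?thesis by (simp add: sum.distrib)
    qed
    have tail: "\<bar>\<Sum>a<?M. \<Sum>b\<in>{N..<?M}. ?t a b * s ^ a * y ^ b\<bar> \<le> K * \<bar>y\<bar> ^ N"
    proof -
      have "\<bar>?t a b * s ^ a * y ^ b\<bar> \<le> \<bar>?t a b\<bar> * \<bar>y\<bar> ^ N" if "b \<in> {N..<?M}" for a b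
      proof -
        have "\<bar>s\<bar> ^ a \<le> 1" using s1(1) by (simp add: power_le_one)
        moreover have "\<bar>y\<bar> ^ b \<le> \<bar>y\<bar> ^ N" using s1(2) that by (intro power_decreasing) auto
        ultimately have "\<bar>s\<bar> ^ a * \<bar>y\<bar> ^ b \<le> 1 * \<bar>y\<bar> ^ N" by (intro mult_mono) auto
        then have "\<bar>?t a b\<bar> * (\<bar>s\<bar> ^ a * \<bar>y\<bar> ^ b) \<le> \<bar>?t a b\<bar> * \<bar>y\<bar> ^ N" by (intro mult_left_mono) auto
        then show ?thesis by (simp add: abs_mult power_abs mult.assoc)
      qed
      then show ?thesis
        unfolding K_def sum_distrib_right by (intro order_trans[OF sum_abs] sum_mono) blast
    qed
    have "\<bar>G (s, y) - (\<Sum>a<?M. \<Sum>b<?M. ?t a b * s ^ a * y ^ b)\<bar> \<le> C * (x ^ N + \<bar>y\<bar> ^ N)"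
    proof -
      have "C * (\<bar>s\<bar> ^ ?M + \<bar>y\<bar> ^ ?M) \<le> C * (x ^ N + \<bar>y\<bar> ^ N)"
        using sM yM e(3) by (intro mult_left_mono) auto
      then show ?thesis using e(4)[of s y] s(2) y by simp
    qed
    moreover have "F x y = G (s, y)" using F[of x y] x y by (simp add: s_def)
    moreover have "K * \<bar>y\<bar> ^ N \<le> K * (x ^ N + \<bar>y\<bar> ^ N)" using K x(1) by (intro mult_left_mono) auto
    ultimately show ?thesis
      using trunc split tail unfolding distrib_right[of C K] by linarith
  qed
  show "\<exists>C r. 0 < r \<and> (\<forall>x y. 0 < x \<longrightarrow> x < r \<longrightarrow> \<bar>y\<bar> < r \<longrightarrow>
      \<bar>F x y - puiseux_sum ?c N x y\<bar> \<le> C * (x ^ N + \<bar>y\<bar> ^ N))"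
  proof (intro exI conjI allI impI)
    show "0 < Min {r, e, e ^ q}" using r e(1) by simp
    fix x y assume "0 < x" "x < Min {r, e, e ^ q}" "\<bar>y\<bar> < Min {r, e, e ^ q}"
    then show "\<bar>F x y - puiseux_sum ?c N x y\<bar>
        \<le> (C + K) * (x ^ N + \<bar>y\<bar> ^ N)" by (intro main) auto
  qed
qed

lemma tendsto_powr_at_right_0:
  fixes e :: real
  assumes "e \<ge> 0"
  shows "((\<lambda>x::real. x powr e) \<longlongrightarrow> (if e = 0 then 1 else 0)) (at_right 0)"
proof (cases "e = 0")
  case True
  have "\<forall>\<^sub>F x::real in at_right 0. x powr 0 = 1"
    by (simp add: eventually_at_filter)
  then show ?thesis using True by (simp add: tendsto_eventually)
next
  case False
  have "((\<lambda>x::real. x powr e) \<longlongrightarrow> 0 powr e) (at_right 0)"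
    using assms False by (intro tendsto_powr' tendsto_intros) (auto simp: eventually_at_filter)
  then show ?thesis using False by simp
qed

text \<open>At most one \<open>j\<close> satisfies \<open>j / q = a\<close>, so the limit is the
  coefficient of \<open>x^a\<close> or 0. The condition on \<open>N\<close> makes the Taylor
  remainder negligible against \<open>x^a\<close>.\<close>

lemma fractional_limit:
  assumes g: "smooth_near_0 g" and q: "q > 0"
    and a: "\<And>j. taylor_coeff1 g j \<noteq> 0 \<Longrightarrow> a \<le> real j / real q" and N: "a < real N / real q"
  shows "((\<lambda>x. g (root q x) / x powr a) \<longlongrightarrow>
    (\<Sum>j<N. if real j / real q = a then taylor_coeff1 g j else 0)) (at_right 0)"
proof -
  let ?t = "taylor_coeff1 g"
  obtain C e where e: "0 < e" "e \<le> 1" "0 \<le> C"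
    "\<And>s. \<bar>s\<bar> \<le> e \<Longrightarrow> \<bar>g s - (\<Sum>j<N. ?t j * s ^ j)\<bar> \<le> C * \<bar>s\<bar> ^ N"
    using taylor_estimate1[OF g, of N] by blast
  have pw: "root q x ^ j = x powr (real j / real q)" if "0 < x" for x j
    using that q by (simp add: root_powr_inverse powr_powr powr_realpow[symmetric])
  have ev: "\<forall>\<^sub>F x::real in at_right 0. 0 < x \<and> x < e ^ q"
    unfolding eventually_at_right_field using e(1) by (intro exI[of _ "e ^ q"]) simp
  have "((\<lambda>x. \<Sum>j<N. ?t j * x powr (real j / real q - a)) \<longlongrightarrow>
      (\<Sum>j<N. ?t j * (if real j / real q - a = 0 then 1 else 0))) (at_right 0)"
  proof (rule tendsto_sum)
    fix j
    show "((\<lambda>x. ?t j * x powr (real j / real q - a)) \<longlongrightarrow> ?t j * (if real j / real q - a = 0 then 1 else 0)) (at_right 0)"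
    proof (cases "?t j = 0")
      case False
      then show ?thesis using a[of j] by (intro tendsto_mult tendsto_const tendsto_powr_at_right_0) simp
    qed simp
  qed
  moreover have "(\<Sum>j<N. ?t j * (if real j / real q - a = 0 then 1 else 0)) = (\<Sum>j<N. if real j / real q = a then ?t j else 0)"
    by (intro sum.cong) auto
  moreover have "((\<lambda>x. g (root q x) / x powr a - (\<Sum>j<N. ?t j * x powr (real j / real q - a))) \<longlongrightarrow> 0) (at_right 0)"
  proof (rule Lim_null_comparison)
    have "((\<lambda>x::real. C * x powr (real N / real q - a)) \<longlongrightarrow> C * 0) (at_right 0)"
      using tendsto_powr_at_right_0[of "real N / real q - a"] N by (intro tendsto_mult tendsto_const) simp
    then show "((\<lambda>x::real. C * x powr (real N / real q - a)) \<longlongrightarrow> 0) (at_right 0)" by simp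
    show "\<forall>\<^sub>F x in at_right 0. norm (g (root q x) / x powr a - (\<Sum>j<N. ?t j * x powr (real j / real q - a)))
        \<le> C * x powr (real N / real q - a)"
      using ev
    proof eventually_elim
      case (elim x)
      have "root q x \<le> root q (e ^ q)" using elim q by simp
      then have "\<bar>root q x\<bar> \<le> e" using q e(1) elim by (simp add: real_root_power_cancel)
      from e(4)[OF this] have "\<bar>g (root q x) - (\<Sum>j<N. ?t j * root q x ^ j)\<bar> \<le> C * root q x ^ N"
        using elim q by simp
      then have "\<bar>g (root q x) - (\<Sum>j<N. ?t j * root q x ^ j)\<bar> / x powr a \<le> C * root q x ^ N / x powr a"
        by (intro divide_right_mono) auto
      moreover have "(\<Sum>j<N. ?t j * x powr (real j / real q - a)) = (\<Sum>j<N. ?t j * root q x ^ j) / x powr a"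
        using elim by (simp add: sum_divide_distrib pw powr_diff)
      ultimately show ?case
        using elim by (simp add: pw powr_diff diff_divide_distrib[symmetric])
    qed
  qed
  ultimately show ?thesis
    using tendsto_add by force
qed

lemma powr_limit_lower:
  assumes "((\<lambda>x. \<delta> x / x powr a) \<longlongrightarrow> \<gamma>) (at_right (0::real))" "b < a"
  shows "((\<lambda>x. \<delta> x / x powr b) \<longlongrightarrow> 0) (at_right 0)"
proof -
  have "((\<lambda>x. \<delta> x / x powr a * x powr (a - b)) \<longlongrightarrow> \<gamma> * 0) (at_right 0)"
    using tendsto_powr_at_right_0[of "a - b"] assms by (intro tendsto_mult) auto
  moreover have "\<forall>\<^sub>F x::real in at_right 0. \<delta> x / x powr a * x powr (a - b) = \<delta> x / x powr b"
    by (simp add: eventually_at_filter powr_diff)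
  ultimately show ?thesis by (simp add: tendsto_cong)
qed

lemma fractional_leading_term:
  assumes g: "smooth_near_0 g" and q: "q > 0"
    and k: "taylor_coeff1 g k \<noteq> 0" "\<And>j. j < k \<Longrightarrow> taylor_coeff1 g j = 0"
  shows "((\<lambda>x. g (root q x) / x powr (real k / real q)) \<longlongrightarrow> taylor_coeff1 g k) (at_right 0)"
proof -
  have "((\<lambda>x. g (root q x) / x powr (real k / real q)) \<longlongrightarrow>
    (\<Sum>j<Suc k. if real j / real q = real k / real q then taylor_coeff1 g j else 0)) (at_right 0)"
  proof (rule fractional_limit[OF g q])
    fix j assume "taylor_coeff1 g j \<noteq> 0"
    then have "k \<le> j" using k(2) by (metis not_le)
    then show "real k / real q \<le> real j / real q" by (simp add: divide_right_mono)
  qed (use q in \<open>simp add: divide_strict_right_mono\<close>)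
  moreover have "(\<Sum>j<Suc k. if real j / real q = real k / real q then taylor_coeff1 g j else 0) = taylor_coeff1 g k"
    using q by (simp add: sum.delta)
  ultimately show ?thesis by simp
qed

lemma fractional_flat:
  assumes g: "smooth_near_0 g" and q: "q > 0" and 0: "\<And>j. taylor_coeff1 g j = 0"
  shows "((\<lambda>x. g (root q x) / x powr a) \<longlongrightarrow> 0) (at_right 0)"
proof -
  obtain N where "a * real q < real N" using reals_Archimedean2 by blast
  then have "a < real N / real q" using q by (simp add: pos_less_divide_eq)
  moreover have "(\<Sum>j<N. if real j / real q = a then taylor_coeff1 g j else 0) = 0"
    by (intro sum.neutral) (simp add: 0)
  ultimately show ?thesis
    using fractional_limit[OF g q, of a N] 0 by simp
qed

section \<open>Fractional shears\<close>

text \<open>The sign \<open>\<sigma>\<close> treats both half-lines at once, by pulling everything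
  back to \<open>x > 0\<close>.\<close>

lemma eventually_at_half_line:
  assumes "\<bar>\<sigma>\<bar> = (1::real)"
  shows "eventually P (at 0 within {x. 0 < \<sigma> * x}) \<longleftrightarrow> (\<exists>r>0. \<forall>x. 0 < x \<longrightarrow> x < r \<longrightarrow> P (\<sigma> * x))"
proof -
  have pm: "\<sigma> = 1 \<or> \<sigma> = - 1" using assms by linarith
  have "(\<forall>x\<in>{x. 0 < \<sigma> * x}. x \<noteq> 0 \<and> dist x 0 < r \<longrightarrow> P x) \<longleftrightarrow> (\<forall>x. 0 < x \<longrightarrow> x < r \<longrightarrow> P (\<sigma> * x))" for r
    using pm
  proof
    assume "\<sigma> = - 1"
    moreover have "(\<forall>x<0. - x < r \<longrightarrow> P x) \<longleftrightarrow> (\<forall>x>0. x < r \<longrightarrow> P (- x))"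
      by (metis minus_minus neg_0_less_iff_less)
    ultimately show ?thesis by auto
  qed auto
  then show ?thesis unfolding eventually_at by simp
qed

lemma eventually_at_half_plane:
  assumes \<sigma>1: "\<bar>\<sigma>\<bar> = (1::real)"
    and ev: "eventually P (at 0 within {x. 0 < \<sigma> * x} \<times> (UNIV :: real set))"
  shows "\<exists>r>0. \<forall>x y. 0 < x \<longrightarrow> x < r \<longrightarrow> \<bar>y\<bar> < r \<longrightarrow> P (\<sigma> * x, y)"
proof -
  obtain d where d: "d > 0" "\<And>p. p \<in> {x. 0 < \<sigma> * x} \<times> UNIV \<Longrightarrow> p \<noteq> 0 \<Longrightarrow> dist p 0 < d \<Longrightarrow> P p"
    using ev unfolding eventually_at by auto
  have "P (\<sigma> * x, y)" if "0 < x" "x < d / 2" "\<bar>y\<bar> < d / 2" for x y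
  proof (rule d(2))
    have "\<sigma> = 1 \<or> \<sigma> = - 1" using \<sigma>1 by linarith
    then show "(\<sigma> * x, y) \<in> {x. 0 < \<sigma> * x} \<times> UNIV" using that by auto
    show "(\<sigma> * x, y) \<noteq> 0" using that \<sigma>1 by (auto simp: zero_prod_def)
    have "norm (\<sigma> * x, y) \<le> \<bar>x\<bar> + \<bar>y\<bar>"
      using norm_Pair_le[of "\<sigma> * x" y] \<sigma>1 by (simp add: abs_mult)
    then show "dist (\<sigma> * x, y) 0 < d" using that by simp
  qed
  then show ?thesis using d(1) by (intro exI[of _ "d / 2"]) simp
qed

lemma eventually_at_half_planeI:
  assumes \<sigma>1: "\<bar>\<sigma>\<bar> = (1::real)" and r: "r > 0"
    and P: "\<And>x y. 0 < x \<Longrightarrow> x < r \<Longrightarrow> \<bar>y\<bar> < r \<Longrightarrow> P (\<sigma> * x, y)"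
  shows "eventually P (at 0 within {x. 0 < \<sigma> * x} \<times> (UNIV :: real set))"
  unfolding eventually_at
proof (intro exI[of _ r] conjI ballI impI r)
  fix p assume p: "p \<in> {x. 0 < \<sigma> * x} \<times> (UNIV :: real set)" "p \<noteq> 0 \<and> dist p 0 < r"
  obtain u y where uy: "p = (u, y)" by (cases p)
  have n: "\<bar>u\<bar> < r" "\<bar>y\<bar> < r"
    using p(2) norm_fst_le[of u y] norm_snd_le[of y u] by (auto simp: uy)
  have "\<sigma> = 1 \<or> \<sigma> = - 1" using \<sigma>1 by linarith
  then have "\<sigma> * u = \<bar>u\<bar>" "\<sigma> * (\<sigma> * u) = u"
    using p(1) by (auto simp: uy)
  then show "P p" using P[of "\<sigma> * u" y] n p(1) by (simp add: uy)
qed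

lemma half_line_cases:
  assumes "H \<in> {{0<..}, {..<0::real}}"
  shows "\<exists>\<sigma>. \<bar>\<sigma>\<bar> = (1::real) \<and> H = {x. 0 < \<sigma> * x}"
proof -
  have "{0<..} = {x. 0 < 1 * (x::real)}" "{..<0} = {x. 0 < (- 1) * (x::real)}"
    by auto
  then show ?thesis using assms by (metis abs_minus_cancel abs_one insert_iff singletonD)
qed

lemma tendsto_half_line:
  assumes "\<bar>\<sigma>\<bar> = (1::real)"
  shows "(f \<longlongrightarrow> (l::real)) (at 0 within {x. 0 < \<sigma> * x}) \<longleftrightarrow> ((\<lambda>x. f (\<sigma> * x)) \<longlongrightarrow> l) (at_right 0)"
  unfolding tendsto_iff eventually_at_half_line[OF assms] eventually_at_right_field by auto

lemma fractional_repD: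
  assumes "fractional_rep {x. 0 < \<sigma> * x} f q g" and \<sigma>: "\<bar>\<sigma>\<bar> = 1"
  shows "q > 0" "smooth_near_0 g" "\<exists>r>0. \<forall>x. 0 < x \<longrightarrow> x < r \<longrightarrow> f (\<sigma> * x) = g (root q x)"
proof -
  show "q > 0" "smooth_near_0 g" using assms(1) by (auto simp: fractional_rep_def)
  obtain r where r: "r > 0" "\<forall>x. 0 < x \<longrightarrow> x < r \<longrightarrow> f (\<sigma> * x) = g (root q \<bar>\<sigma> * x\<bar>)"
    using assms(1) unfolding fractional_rep_def eventually_at_half_line[OF \<sigma>] by blast
  then show "\<exists>r>0. \<forall>x. 0 < x \<longrightarrow> x < r \<longrightarrow> f (\<sigma> * x) = g (root q x)"
    using \<sigma> by (intro exI[of _ r]) (simp add: abs_mult)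
qed

lemma tendsto_at_right_cong:
  fixes r :: real
  assumes "r > 0" "\<And>x. 0 < x \<Longrightarrow> x < r \<Longrightarrow> f x = g x"
  shows "(f \<longlongrightarrow> l) (at_right 0) \<longleftrightarrow> (g \<longlongrightarrow> l) (at_right 0)"
  by (rule tendsto_cong) (unfold eventually_at_right_field, use assms in blast)

text \<open>A nonzero limit at the exponent \<open>a\<close> excludes convergence at any larger
  exponent. Used in both directions, this identifies leading exponents.\<close>

lemma leading_exponent_unique:
  assumes "((\<lambda>x. \<delta> x / x powr a) \<longlongrightarrow> \<gamma>) (at_right (0::real))" "((\<lambda>x. \<delta> x / x powr b) \<longlongrightarrow> \<gamma>') (at_right 0)"
    and "\<gamma> \<noteq> 0"
  shows "b \<le> a"
proof (rule ccontr)
  assume "\<not> b \<le> a"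
  then have "((\<lambda>x. \<delta> x / x powr a) \<longlongrightarrow> 0) (at_right 0)"
    using powr_limit_lower[OF assms(2)] by simp
  then show False
    using tendsto_unique[OF trivial_limit_at_right_real assms(1)] assms(3) by blast
qed

text \<open>Decided by the first nonzero Taylor coefficient of \<open>g\<close>, whose index is
  positive since \<open>g 0 = 0\<close>. It is applied to a single curve and to the difference of
  two curves; in the latter case flatness means that they never branch.\<close>

lemma fractional_dichotomy:
  assumes g: "smooth_near_0 g" "g 0 = 0" and q: "q > 0" and r: "r > 0"
    and \<delta>: "\<And>x. 0 < x \<Longrightarrow> x < r \<Longrightarrow> \<delta> x = g (root q x)"
  shows "(\<forall>j. taylor_coeff1 g j = 0) \<and> (\<forall>a. ((\<lambda>x. \<delta> x / x powr a) \<longlongrightarrow> 0) (at_right 0)) \<or>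
    (\<exists>k>0. taylor_coeff1 g k \<noteq> 0 \<and> (\<forall>j<k. taylor_coeff1 g j = 0) \<and>
      ((\<lambda>x. \<delta> x / x powr (real k / real q)) \<longlongrightarrow> taylor_coeff1 g k) (at_right 0))"
proof (cases "\<forall>j. taylor_coeff1 g j = 0")
  case True
  then have "((\<lambda>x. g (root q x) / x powr a) \<longlongrightarrow> 0) (at_right 0)" for a
    by (intro fractional_flat g q) simp
  moreover have "((\<lambda>x. \<delta> x / x powr a) \<longlongrightarrow> 0) (at_right 0) \<longleftrightarrow> ((\<lambda>x. g (root q x) / x powr a) \<longlongrightarrow> 0) (at_right 0)" for a
    by (rule tendsto_at_right_cong[OF r]) (simp add: \<delta>)
  ultimately show ?thesis using True by simp
next
  case False
  define k where "k = (LEAST k. taylor_coeff1 g k \<noteq> 0)"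
  have k: "taylor_coeff1 g k \<noteq> 0" "\<And>j. j < k \<Longrightarrow> taylor_coeff1 g j = 0"
    unfolding k_def using False LeastI_ex[of "\<lambda>k. taylor_coeff1 g k \<noteq> 0"] not_less_Least by blast+
  have "k > 0" using k(1) g(2) by (cases k) (auto simp: taylor_coeff1_def)
  moreover have "((\<lambda>x. \<delta> x / x powr (real k / real q)) \<longlongrightarrow> taylor_coeff1 g k) (at_right 0)"
    using fractional_leading_term[OF g(1) q k]
      tendsto_at_right_cong[OF r, of "\<lambda>x. \<delta> x / x powr (real k / real q)" "\<lambda>x. g (root q x) / x powr (real k / real q)"]
    by (simp add: \<delta>)
  ultimately show ?thesis using k by blast
qed

lemma fractional_rep_zero:
  assumes rep: "fractional_rep {x. 0 < \<sigma> * x} f q g" and \<sigma>: "\<bar>\<sigma>\<bar> = 1"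
    and lim: "(f \<longlongrightarrow> 0) (at 0 within {x. 0 < \<sigma> * x})"
  shows "g 0 = 0"
proof -
  note R = fractional_repD[OF rep \<sigma>]
  obtain r where r: "r > 0" "\<forall>x. 0 < x \<longrightarrow> x < r \<longrightarrow> f (\<sigma> * x) = g (root q x)"
    using R(3) by blast
  obtain U where U: "open U" "0 \<in> U" "\<forall>n. Ck_on n U g"
    by (rule smooth_near_0E[OF R(2)])
  have "continuous_on U g" using spec[OF U(3), of 0] by simp
  then have "isCont g 0" using U continuous_on_eq_continuous_at by blast
  moreover have "((\<lambda>x. root q x) \<longlongrightarrow> root q 0) (at_right 0)"
    by (intro tendsto_intros)
  ultimately have "((\<lambda>x. g (root q x)) \<longlongrightarrow> g 0) (at_right 0)"
    using isCont_tendsto_compose[of "0::real" g "root q" "at_right 0"] R(1) by simp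
  moreover have "((\<lambda>x. f (\<sigma> * x)) \<longlongrightarrow> 0) (at_right 0)"
    using lim tendsto_half_line[OF \<sigma>] by blast
  then have "((\<lambda>x. g (root q x)) \<longlongrightarrow> 0) (at_right 0)"
    using tendsto_at_right_cong[OF r(1), of "\<lambda>x. f (\<sigma> * x)" "\<lambda>x. g (root q x)"] r(2) by simp
  ultimately show ?thesis using tendsto_unique[OF trivial_limit_at_right_real] by blast
qed

lemma flat_of_limits:
  assumes \<sigma>: "\<bar>\<sigma>\<bar> = 1" and lim: "\<And>a. ((\<lambda>x. f (\<sigma> * x) / x powr a) \<longlongrightarrow> 0) (at_right (0::real))"
  shows "flat {x. 0 < \<sigma> * x} f"
  unfolding flat_def
proof
  fix N :: nat
  have "\<forall>\<^sub>F x in at_right 0. dist (f (\<sigma> * x) / x powr real N) 0 < 1"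
    using lim[of "real N"] by (rule tendstoD) simp
  then obtain r where r: "r > 0" "\<And>x. 0 < x \<Longrightarrow> x < r \<Longrightarrow> \<bar>f (\<sigma> * x) / x powr real N\<bar> < 1"
    unfolding eventually_at_right_field by auto
  have "\<forall>\<^sub>F x in at 0 within {x. 0 < \<sigma> * x}. norm (f x) \<le> 1 * norm (\<bar>x\<bar> ^ N)"
    unfolding eventually_at_half_line[OF \<sigma>]
  proof (intro exI[of _ r] conjI allI impI r(1))
    fix x assume x: "0 < x" "x < r"
    then have "\<bar>f (\<sigma> * x)\<bar> < x ^ N"
      using r(2)[OF x] by (simp add: powr_realpow pos_divide_less_eq)
    then show "norm (f (\<sigma> * x)) \<le> 1 * norm (\<bar>\<sigma> * x\<bar> ^ N)"
      using x \<sigma> by (simp add: abs_mult)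
  qed
  then show "f \<in> O[at 0 within {x. 0 < \<sigma> * x}](\<lambda>x. \<bar>x\<bar> ^ N)"
    by (rule bigoI)
qed

lemma not_flat_of_limit:
  assumes \<sigma>: "\<bar>\<sigma>\<bar> = 1" and lim: "((\<lambda>x. f (\<sigma> * x) / x powr a) \<longlongrightarrow> \<gamma>) (at_right (0::real))" and "\<gamma> \<noteq> 0"
  shows "\<not> flat {x. 0 < \<sigma> * x} f"
proof
  assume fl: "flat {x. 0 < \<sigma> * x} f"
  obtain N where N: "a < real N" using reals_Archimedean2 by blast
  have "f \<in> O[at 0 within {x. 0 < \<sigma> * x}](\<lambda>x. \<bar>x\<bar> ^ N)"
    using fl unfolding flat_def by blast
  then obtain c where "c > 0" "\<forall>\<^sub>F x in at 0 within {x. 0 < \<sigma> * x}. norm (f x) \<le> c * norm (\<bar>x\<bar> ^ N)"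
    by (elim landau_o.bigE)
  then obtain r where r: "r > 0" "\<forall>x. 0 < x \<longrightarrow> x < r \<longrightarrow> norm (f (\<sigma> * x)) \<le> c * norm (\<bar>\<sigma> * x\<bar> ^ N)"
    unfolding eventually_at_half_line[OF \<sigma>] by blast
  have "((\<lambda>x. f (\<sigma> * x) / x powr a) \<longlongrightarrow> 0) (at_right 0)"
  proof (rule Lim_null_comparison)
    show "((\<lambda>x::real. c * x powr (real N - a)) \<longlongrightarrow> 0) (at_right 0)"
      using tendsto_mult[OF tendsto_const tendsto_powr_at_right_0[of "real N - a"], of c] N by simp
    show "\<forall>\<^sub>F x in at_right 0. norm (f (\<sigma> * x) / x powr a) \<le> c * x powr (real N - a)"
      unfolding eventually_at_right_field
    proof (intro exI[of _ r] conjI allI impI r(1))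
      fix x assume x: "0 < x" "x < r"
      then have "\<bar>f (\<sigma> * x)\<bar> \<le> c * x powr real N"
        using r(2) \<sigma> by (simp add: abs_mult powr_realpow)
      then have "\<bar>f (\<sigma> * x)\<bar> / x powr a \<le> c * x powr real N / x powr a"
        by (intro divide_right_mono) auto
      then show "norm (f (\<sigma> * x) / x powr a) \<le> c * x powr (real N - a)"
        by (simp add: powr_diff)
    qed
  qed
  then show False
    using tendsto_unique[OF trivial_limit_at_right_real lim] assms(3) by blast
qed

text \<open>The infimum ranges over all representations, but the limit is intrinsic to
  \<open>f\<close>: in each representation the first nonzero coefficient must sit at the exponent
  \<open>a\<close>.\<close>

lemma leading_exponent_eq:
  assumes \<sigma>: "\<bar>\<sigma>\<bar> = 1" and rep: "fractional_rep {x. 0 < \<sigma> * x} f q g"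
    and f0: "(f \<longlongrightarrow> 0) (at 0 within {x. 0 < \<sigma> * x})"
    and lim: "((\<lambda>x. f (\<sigma> * x) / x powr a) \<longlongrightarrow> \<gamma>) (at_right (0::real))" "\<gamma> \<noteq> 0"
  shows "leading_exponent {x. 0 < \<sigma> * x} f = a"
proof -
  let ?H = "{x. 0 < \<sigma> * x}"
  let ?S = "{real k / real q | k q. \<exists>g. fractional_rep ?H f q g \<and> taylor_coeff1 g k \<noteq> 0}"
  have lead: "\<exists>k. taylor_coeff1 g k \<noteq> 0 \<and> (\<forall>j<k. taylor_coeff1 g j = 0) \<and> real k / real q = a"
    if rep: "fractional_rep ?H f q g" for q g
  proof -
    note R = fractional_repD[OF rep \<sigma>]
    obtain r where r: "r > 0" "\<forall>x. 0 < x \<longrightarrow> x < r \<longrightarrow> f (\<sigma> * x) = g (root q x)"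
      using R(3) by blast
    from fractional_dichotomy[OF R(2) fractional_rep_zero[OF rep \<sigma> f0] R(1) r(1), of "\<lambda>x. f (\<sigma> * x)"] r(2)
    consider "\<forall>a. ((\<lambda>x. f (\<sigma> * x) / x powr a) \<longlongrightarrow> 0) (at_right 0)"
      | k where "taylor_coeff1 g k \<noteq> 0" "\<forall>j<k. taylor_coeff1 g j = 0"
        "((\<lambda>x. f (\<sigma> * x) / x powr (real k / real q)) \<longlongrightarrow> taylor_coeff1 g k) (at_right 0)"
      by blast
    then show ?thesis
    proof cases
      case 1
      then show ?thesis
        using tendsto_unique[OF trivial_limit_at_right_real lim(1)] lim(2) by blast
    next
      case (2 k)
      then have "real k / real q = a"
        using leading_exponent_unique[OF lim(1) 2(3) lim(2)] leading_exponent_unique[OF 2(3) lim(1) 2(1)] by simp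
      then show ?thesis using 2 by blast
    qed
  qed
  have "a \<in> ?S" using lead[OF rep] rep by blast
  moreover have "a \<le> x" if x: "x \<in> ?S" for x
  proof -
    obtain k' q' g' where k': "x = real k' / real q'" "fractional_rep ?H f q' g'" "taylor_coeff1 g' k' \<noteq> 0"
      using x by blast
    obtain k where k: "\<forall>j<k. taylor_coeff1 g' j = 0" "real k / real q' = a"
      using lead[OF k'(2)] by blast
    then have "k \<le> k'" using k'(3) by (metis not_le)
    then show ?thesis using k(2) k'(1) by (metis divide_right_mono of_nat_0_le_iff of_nat_mono)
  qed
  ultimately show ?thesis
    unfolding leading_exponent_def by (rule cInf_eq_minimum)
qed

text \<open>Non-flatness rules out the first alternative of \<open>fractional_dichotomy\<close>, so
  there is a leading term.\<close>

lemma fractional_shear_data: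
  assumes "fractional_shear H f"
  shows "\<exists>\<sigma> q g m0 \<gamma>. \<bar>\<sigma>\<bar> = 1 \<and> H = {x. 0 < \<sigma> * x} \<and> fractional_rep H f q g \<and> g 0 = 0 \<and>
    leading_exponent H f = m0 \<and> m0 > 0 \<and> \<gamma> \<noteq> 0 \<and> ((\<lambda>x. f (\<sigma> * x) / x powr m0) \<longlongrightarrow> \<gamma>) (at_right 0)"
proof -
  obtain \<sigma> :: real where \<sigma>: "\<bar>\<sigma>\<bar> = 1" "H = {x. 0 < \<sigma> * x}"
    using half_line_cases assms unfolding fractional_shear_def by blast
  obtain q g where rep: "fractional_rep {x. 0 < \<sigma> * x} f q g"
    using assms unfolding fractional_shear_def \<sigma>(2) by blast
  have f0: "(f \<longlongrightarrow> 0) (at 0 within {x. 0 < \<sigma> * x})" and nf: "\<not> flat {x. 0 < \<sigma> * x} f"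
    using assms unfolding fractional_shear_def \<sigma>(2) by blast+
  note R = fractional_repD[OF rep \<sigma>(1)]
  note g0 = fractional_rep_zero[OF rep \<sigma>(1) f0]
  obtain r where r: "r > 0" "\<forall>x. 0 < x \<longrightarrow> x < r \<longrightarrow> f (\<sigma> * x) = g (root q x)"
    using R(3) by blast
  from fractional_dichotomy[OF R(2) g0 R(1) r(1), of "\<lambda>x. f (\<sigma> * x)"] r(2)
  consider "\<forall>a. ((\<lambda>x. f (\<sigma> * x) / x powr a) \<longlongrightarrow> 0) (at_right 0)"
    | k where "k > 0" "taylor_coeff1 g k \<noteq> 0"
      "((\<lambda>x. f (\<sigma> * x) / x powr (real k / real q)) \<longlongrightarrow> taylor_coeff1 g k) (at_right 0)"
    by blast
  then show ?thesis
  proof cases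
    case 1
    then show ?thesis using flat_of_limits[OF \<sigma>(1)] nf by blast
  next
    case (2 k)
    have "leading_exponent H f = real k / real q"
      unfolding \<sigma>(2) by (rule leading_exponent_eq[OF \<sigma>(1) rep f0 2(3,2)])
    moreover have "real k / real q > 0" using 2(1) R(1) by simp
    ultimately show ?thesis
      using \<sigma> rep g0 2(2,3) by blast
  qed
qed

text \<open>Any other admissible pair \<open>q'\<close>, \<open>G'\<close> yields an expansion of
  the same function, so uniqueness of expansions identifies the supports.\<close>

lemma puiseux_support_eq:
  assumes \<sigma>: "\<bar>\<sigma>\<bar> = 1" and q: "q > 0" and G: "smooth_near_0 G" and r: "r > 0"
    and F: "\<And>x y. 0 < x \<Longrightarrow> x < r \<Longrightarrow> \<bar>y\<bar> < r \<Longrightarrow> F (\<sigma> * x, y) = G (root q x, y)"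
  shows "puiseux_expansion (\<lambda>x y. F (\<sigma> * x, y)) (puiseux_coeff 1 q G)"
    and "puiseux_support {x. 0 < \<sigma> * x} F = coeff_support (puiseux_coeff 1 q G)"
proof -
  have ex: "puiseux_expansion (\<lambda>x y. F (\<sigma> * x, y)) (puiseux_coeff 1 q G)"
    if "q > 0" "smooth_near_0 G" "r > 0" "\<And>x y. 0 < x \<Longrightarrow> x < r \<Longrightarrow> \<bar>y\<bar> < r \<Longrightarrow> F (\<sigma> * x, y) = G (root q x, y)"
    for q G and r :: real
    by (rule puiseux_expansion_smooth[OF that(2,1) _ that(3)]) (use that(4) in auto)
  show e: "puiseux_expansion (\<lambda>x y. F (\<sigma> * x, y)) (puiseux_coeff 1 q G)"
    by (rule ex[OF q G r F])
  show "puiseux_support {x. 0 < \<sigma> * x} F = coeff_support (puiseux_coeff 1 q G)"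
  proof (intro set_eqI iffI)
    fix p assume "p \<in> puiseux_support {x. 0 < \<sigma> * x} F"
    then obtain k b q' G' where p: "p = (real k / real q', real b)" "q' \<ge> 1" "smooth_near_0 G'"
      "\<forall>\<^sub>F y in at 0 within {x. 0 < \<sigma> * x} \<times> UNIV. F y = G' (root q' \<bar>fst y\<bar>, snd y)"
      "taylor_coeff G' k b \<noteq> 0"
      unfolding puiseux_support_def by blast
    obtain r' where r': "r' > 0" "\<forall>x y. 0 < x \<longrightarrow> x < r' \<longrightarrow> \<bar>y\<bar> < r' \<longrightarrow>
        F (\<sigma> * x, y) = G' (root q' \<bar>fst (\<sigma> * x, y)\<bar>, snd (\<sigma> * x, y))"
      using eventually_at_half_plane[OF \<sigma> p(4)] by blast
    have q': "q' > 0" using p(2) by simp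
    have "puiseux_expansion (\<lambda>x y. F (\<sigma> * x, y)) (puiseux_coeff 1 q' G')"
      by (rule ex[OF q' p(3) r'(1)]) (use r'(2) \<sigma> in \<open>simp add: abs_mult\<close>)
    from puiseux_expansion_unique[OF this e]
    have "coeff_support (puiseux_coeff 1 q' G') = coeff_support (puiseux_coeff 1 q G)" by simp
    moreover have "p \<in> coeff_support (puiseux_coeff 1 q' G')"
      using coeff_support_puiseux_coeff[OF q', of 1 G'] p(1,5) by auto
    ultimately show "p \<in> coeff_support (puiseux_coeff 1 q G)" by simp
  next
    fix p assume "p \<in> coeff_support (puiseux_coeff 1 q G)"
    then obtain k b where p: "p = (real k / real q, real b)" "taylor_coeff G k b \<noteq> 0"
      using coeff_support_puiseux_coeff[OF q, of 1 G] by auto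
    have "\<forall>\<^sub>F y in at 0 within {x. 0 < \<sigma> * x} \<times> UNIV. F y = G (root q \<bar>fst y\<bar>, snd y)"
      by (rule eventually_at_half_planeI[OF \<sigma> r]) (use F \<sigma> in \<open>simp add: abs_mult\<close>)
    then show "p \<in> puiseux_support {x. 0 < \<sigma> * x} F"
      unfolding puiseux_support_def using p q G by force
  qed
qed

lemma smooth_near_0_shear:
  assumes "smooth_near_0 \<rho>" "smooth_near_0 \<psi>" "\<psi> 0 = 0"
  shows "smooth_near_0 (shear \<rho> \<psi>)"
  unfolding shear_def
proof (rule smooth_near_0_compose[OF assms(1)])
  have "smooth_near_0 (\<lambda>y::real\<times>real. \<psi> (fst y))"
    by (rule smooth_near_0_compose[OF assms(2) smooth_near_0_linear[OF bounded_linear_fst]]) simp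
  then show "smooth_near_0 (\<lambda>y. (fst y, snd y + \<psi> (fst y)))"
    by (intro smooth_near_0_Pair smooth_near_0_add[OF smooth_near_0_linear[OF bounded_linear_snd]]
        smooth_near_0_linear[OF bounded_linear_fst])
qed (simp add: assms(3) zero_prod_def)

text \<open>In the variable \<open>s = \<bar>x1\<bar>^(1/q)\<close> one has
  \<open>x1 = \<sigma> s^q\<close>, and the curve is \<open>g s\<close>; the sheared function is
  therefore smooth in \<open>(s, x2)\<close>.\<close>

lemma smooth_near_0_fractional_shear:
  fixes \<phi> :: "real \<times> real \<Rightarrow> real"
  assumes "smooth_near_0 \<phi>" "smooth_near_0 g" "g 0 = 0" "q > 0"
  shows "smooth_near_0 (\<lambda>p. \<phi> (\<sigma> * fst p ^ q, snd p + g (fst p)))"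
proof (rule smooth_near_0_compose[OF assms(1)])
  have "smooth_near_0 (\<lambda>y::real\<times>real. g (fst y))"
    by (rule smooth_near_0_compose[OF assms(2) smooth_near_0_linear[OF bounded_linear_fst]]) simp
  then show "smooth_near_0 (\<lambda>p. (\<sigma> * fst p ^ q, snd p + g (fst p)))"
    by (intro smooth_near_0_Pair smooth_near_0_add[OF smooth_near_0_linear[OF bounded_linear_snd]]
        smooth_near_0_mult[OF smooth_near_0_const] smooth_near_0_power[OF smooth_near_0_linear[OF bounded_linear_fst]])
qed (use assms(3,4) in \<open>simp add: zero_prod_def power_0_left\<close>)

lemma taylor_support_eq_coeff_support:
  "\<sigma> \<noteq> 0 \<Longrightarrow> taylor_support \<rho> = coeff_support (puiseux_coeff \<sigma> 1 \<rho>)"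
  using coeff_support_puiseux_coeff[of 1 \<sigma> \<rho>] by (simp add: taylor_support_def)

lemma puiseux_expansion_half_plane:
  assumes "smooth_near_0 \<rho>" "\<bar>\<sigma>\<bar> = 1"
  shows "puiseux_expansion (\<lambda>x y. \<rho> (\<sigma> * x, y)) (puiseux_coeff \<sigma> 1 \<rho>)"
  by (rule puiseux_expansion_smooth[OF assms(1) _ assms(2), of 1 1]) auto

lemma newton_support_taylor:
  assumes "finite_type \<rho>" "\<rho> (0, 0) = 0"
  shows "newton_support 1 (taylor_support \<rho>)"
proof
  show "lattice_set 1 (taylor_support \<rho>)"
    by (auto simp: lattice_set_def taylor_support_def)
  show "taylor_support \<rho> \<noteq> {}"
    using assms(1) by (auto simp: finite_type_def taylor_support_def)
  show "(0, 0) \<notin> taylor_support \<rho>"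
    using assms(2) by (auto simp: taylor_support_def taylor_coeff_def)
qed

lemma finite_type_iff: "finite_type \<rho> \<longleftrightarrow> taylor_support \<rho> \<noteq> {}"
  by (auto simp: finite_type_def taylor_support_def)

lemma newton_distance_eq:
  assumes "newton_support q (taylor_support \<rho>)"
  shows "newton_distance \<rho> = newton_support.distance (taylor_support \<rho>)"
  by (simp add: newton_distance_def newton_support.distance_def[OF assms] newton_polyhedron_def)

lemma principal_face_eq:
  assumes "newton_support q (taylor_support \<rho>)"
  shows "principal_face \<rho> = newton_support.main_face (taylor_support \<rho>)"
  by (simp add: principal_face_def newton_support.main_face_def[OF assms] newton_distance_eq[OF assms]
      newton_polyhedron_def Let_def)

section \<open>Bounds for multiplicities\<close>

text \<open>An injection of the exponents into the integers from 0 to \<open>D\<close> leaves at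
  most \<open>D + 1\<close> monomials, and a nonzero root has multiplicity less than their
  number.\<close>

lemma order_le_of_injection:
  fixes P :: "real poly"
  assumes "P \<noteq> 0" "\<gamma> \<noteq> 0" and inj: "inj_on h {b. coeff P b \<noteq> 0}"
    and le: "\<And>b. coeff P b \<noteq> 0 \<Longrightarrow> real (h b) \<le> D"
  shows "real (order \<gamma> P) \<le> D"
proof -
  have "real (h (degree P)) \<le> D" using le leading_coeff_neq_0[OF assms(1)] by blast
  then have D: "0 \<le> D" using of_nat_0_le_iff order_trans by blast
  have "h ` {b. coeff P b \<noteq> 0} \<subseteq> {..nat \<lfloor>D\<rfloor>}" using le by (auto simp: le_nat_floor)
  then have "card (h ` {b. coeff P b \<noteq> 0}) \<le> card {..nat \<lfloor>D\<rfloor>}" by (intro card_mono) auto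
  then have "card {b. coeff P b \<noteq> 0} \<le> Suc (nat \<lfloor>D\<rfloor>)" by (simp add: card_image[OF inj])
  then have "order \<gamma> P \<le> nat \<lfloor>D\<rfloor>" using order_less_card_coeffs[OF assms(1,2)] by simp
  then have "real (order \<gamma> P) \<le> real (nat \<lfloor>D\<rfloor>)" by simp
  also have "\<dots> \<le> D" using D by simp
  finally show ?thesis .
qed

text \<open>Denominator 1: the counting arguments use that both exponents of a monomial on a face
  are integers.\<close>

locale integral_newton_support = newton_support 1 "coeff_support c" for c
begin

lemma coeff_face:
  assumes "a > 0" "coeff (weighted_part c a (\<nu> a)) b \<noteq> 0"
  shows "(\<nu> a - a * real b, real b) \<in> face a"
proof -
  have "c (\<nu> a - a * real b) b \<noteq> 0"
    using assms coeff_weighted_part[OF lattice assms(1)] by simp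
  then have "(\<nu> a - a * real b, real b) \<in> coeff_support c" by (rule coeff_supportI)
  then show ?thesis by (simp add: face_def)
qed

lemma face_fst_nat: "p \<in> face a \<Longrightarrow> \<exists>k::nat. fst p = real k"
  using lattice faceD(1) unfolding lattice_set_def by fastforce

lemma weighted_part_nonzero: "a > 0 \<Longrightarrow> weighted_part c a (\<nu> a) \<noteq> 0"
  by (rule weighted_part_order_nonzero[OF lattice nonempty])

text \<open>Below the diagonal the exponents of \<open>x2\<close> themselves are at most
  \<open>\<nu> a / (1 + a)\<close>, the height at which the line meets the diagonal.\<close>

lemma order_le_below_diagonal:
  assumes a: "a > 0" and "\<gamma> \<noteq> 0" and below: "\<And>p. p \<in> face a \<Longrightarrow> snd p \<le> fst p"
  shows "real (order \<gamma> (weighted_part c a (\<nu> a))) \<le> \<nu> a / (1 + a)"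
proof (rule order_le_of_injection[OF weighted_part_nonzero[OF a] assms(2), of id])
  fix b assume "coeff (weighted_part c a (\<nu> a)) b \<noteq> 0"
  from below[OF coeff_face[OF a this]] show "real (id b) \<le> \<nu> a / (1 + a)"
    using a by (simp add: pos_le_divide_eq algebra_simps)
qed simp

text \<open>Mirror image: the exponents of \<open>x1\<close> are natural numbers bounded by the
  diagonal value, and they determine the monomial because \<open>a > 0\<close>.\<close>

lemma order_le_above_diagonal:
  assumes a: "a > 0" and "\<gamma> \<noteq> 0" and above: "\<And>p. p \<in> face a \<Longrightarrow> fst p \<le> snd p"
  shows "real (order \<gamma> (weighted_part c a (\<nu> a))) \<le> \<nu> a / (1 + a)"
proof (rule order_le_of_injection[OF weighted_part_nonzero[OF a] assms(2), of "\<lambda>b. nat \<lfloor>\<nu> a - a * real b\<rfloor>"])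
  have nat: "real (nat \<lfloor>\<nu> a - a * real b\<rfloor>) = \<nu> a - a * real b"
    if "coeff (weighted_part c a (\<nu> a)) b \<noteq> 0" for b
    using face_fst_nat[OF coeff_face[OF a that]] by auto
  show "inj_on (\<lambda>b. nat \<lfloor>\<nu> a - a * real b\<rfloor>) {b. coeff (weighted_part c a (\<nu> a)) b \<noteq> 0}"
  proof (rule inj_onI)
    fix b b' assume b: "b \<in> {b. coeff (weighted_part c a (\<nu> a)) b \<noteq> 0}"
      and b': "b' \<in> {b. coeff (weighted_part c a (\<nu> a)) b \<noteq> 0}"
      and eq: "nat \<lfloor>\<nu> a - a * real b\<rfloor> = nat \<lfloor>\<nu> a - a * real b'\<rfloor>"
    have "\<nu> a - a * real b = real (nat \<lfloor>\<nu> a - a * real b'\<rfloor>)"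
      unfolding eq[symmetric] using nat[of b] b by simp
    then have "\<nu> a - a * real b = \<nu> a - a * real b'" using nat[of b'] b' by simp
    then show "b = b'" using a by simp
  qed
  fix b assume b: "coeff (weighted_part c a (\<nu> a)) b \<noteq> 0"
  have "\<nu> a - a * real b \<le> real b" using above[OF coeff_face[OF a b]] by simp
  then have "a * (\<nu> a - a * real b) \<le> a * real b" using a by simp
  then have "(\<nu> a - a * real b) * (1 + a) \<le> \<nu> a" by (simp add: algebra_simps)
  then show "real (nat \<lfloor>\<nu> a - a * real b\<rfloor>) \<le> \<nu> a / (1 + a)"
    unfolding nat[OF b] using a by (simp add: pos_le_divide_eq)
qed

text \<open>For \<open>a \<ge> 1\<close> the line meets the vertical axis at the height
  \<open>\<nu> a / a\<close>, at most twice its diagonal value.\<close>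

lemma coeff_snd_le:
  assumes a: "1 \<le> a" and b: "coeff (weighted_part c a (\<nu> a)) b \<noteq> 0"
  shows "real b / 2 \<le> \<nu> a / (1 + a)"
proof -
  have "0 \<le> \<nu> a - a * real b"
    using nonneg(1)[OF faceD(1)[OF coeff_face[of a b]]] a b by simp
  moreover have "(1 + a) * real b \<le> (2 * a) * real b" using a by (intro mult_right_mono) auto
  ultimately show ?thesis using a by (simp add: pos_le_divide_eq algebra_simps)
qed

text \<open>For a nonintegral slope no two consecutive powers of \<open>x\<^sub>2\<close> occur on the face.\<close>

lemma order_le_nonintegral:
  assumes a: "1 \<le> a" and "\<gamma> \<noteq> 0" and nonint: "\<And>k::nat. a \<noteq> real k"
  shows "real (order \<gamma> (weighted_part c a (\<nu> a))) \<le> \<nu> a / (1 + a)"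
proof (rule order_le_of_injection[OF _ assms(2), of _ "\<lambda>b. b div 2"])
  have a0: "a > 0" using a by simp
  show "weighted_part c a (\<nu> a) \<noteq> 0" by (rule weighted_part_nonzero[OF a0])
  have not_consecutive: False
    if b: "coeff (weighted_part c a (\<nu> a)) b \<noteq> 0" and b': "coeff (weighted_part c a (\<nu> a)) (Suc b) \<noteq> 0" for b
  proof -
    obtain k k' :: nat where "\<nu> a - a * real b = real k" "\<nu> a - a * real (Suc b) = real k'"
      using face_fst_nat[OF coeff_face[OF a0 b]] face_fst_nat[OF coeff_face[OF a0 b']] by auto
    then have "a = real k - real k'" by (simp add: algebra_simps)
    moreover from this have "k' \<le> k" using a0 by simp
    ultimately have "a = real (k - k')" by (simp add: of_nat_diff)
    then show False using nonint by blast
  qed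
  show "inj_on (\<lambda>b. b div 2) {b. coeff (weighted_part c a (\<nu> a)) b \<noteq> 0}"
  proof (rule inj_onI)
    fix b b' assume "b \<in> {b. coeff (weighted_part c a (\<nu> a)) b \<noteq> 0}"
      "b' \<in> {b. coeff (weighted_part c a (\<nu> a)) b \<noteq> 0}" "b div 2 = b' div 2"
    moreover from this(3) have "b = b' \<or> b' = Suc b \<or> b = Suc b'" by presburger
    ultimately show "b = b'" using not_consecutive by auto
  qed
  fix b assume b: "coeff (weighted_part c a (\<nu> a)) b \<noteq> 0"
  have "real (b div 2) \<le> real b / 2"
    using of_nat_mono[of "2 * (b div 2)" b, where 'a = real] by simp
  also have "\<dots> \<le> \<nu> a / (1 + a)" by (rule coeff_snd_le[OF a b])
  finally show "real (b div 2) \<le> \<nu> a / (1 + a)" .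
qed

text \<open>All exponents of \<open>x2\<close> lie strictly above
  \<open>D = \<nu> a / (1 + a)\<close> and do not exceed \<open>2 * D\<close>; after subtraction of
  the least integer above \<open>D\<close> they are at most \<open>D\<close>. So a root 0 of
  multiplicity above \<open>D\<close> leaves no room for a second heavy root.\<close>

lemma order_le_of_heavy_zero:
  assumes a: "1 \<le> a" and "\<gamma> \<noteq> 0" and heavy: "\<And>p. p \<in> face a \<Longrightarrow> \<nu> a / (1 + a) < snd p"
  shows "real (order \<gamma> (weighted_part c a (\<nu> a))) \<le> \<nu> a / (1 + a)"
proof -
  have a0: "a > 0" using a by simp
  define D where "D = \<nu> a / (1 + a)"
  have D: "0 \<le> D" using order_pos[OF a0] a by (simp add: D_def)
  define n where "n = Suc (nat \<lfloor>D\<rfloor>)"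
  have n: "D < real n" using D by (simp add: n_def) linarith
  have ge: "n \<le> b" if "coeff (weighted_part c a (\<nu> a)) b \<noteq> 0" for b
  proof -
    have "D < real b" using heavy[OF coeff_face[OF a0 that]] by (simp add: D_def)
    then have "\<lfloor>D\<rfloor> < int b" by (simp add: floor_less_iff)
    then show ?thesis using D by (simp add: n_def) linarith
  qed
  have "real (order \<gamma> (weighted_part c a (\<nu> a))) \<le> D"
  proof (rule order_le_of_injection[OF weighted_part_nonzero[OF a0] assms(2), of "\<lambda>b. b - n"])
    show "inj_on (\<lambda>b. b - n) {b. coeff (weighted_part c a (\<nu> a)) b \<noteq> 0}"
      using ge by (auto simp: inj_on_def) (metis diff_add_inverse2 le_add_diff_inverse2)
    fix b assume b: "coeff (weighted_part c a (\<nu> a)) b \<noteq> 0"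
    show "real (b - n) \<le> D"
      using coeff_snd_le[OF a b] ge[OF b] n by (simp add: D_def of_nat_diff)
  qed
  then show ?thesis by (simp add: D_def)
qed

end

text \<open>The multiplicity of \<open>\<gamma>\<close> is the least exponent of \<open>x2\<close>
  after translation: the first part produces a low support point, the second keeps all points of the
  face high.\<close>

lemma translated_coeffs:
  assumes lat: "lattice_set q (coeff_support c')" and a: "a > 0"
    and eq: "weighted_part c' a \<nu> = pcompose P [:\<gamma>, 1:]"
  shows "P \<noteq> 0 \<Longrightarrow> \<exists>b. b \<le> order \<gamma> P \<and> (\<nu> - a * real b, real b) \<in> coeff_support c'"
    and "[:- \<gamma>, 1:] ^ n dvd P \<Longrightarrow> p \<in> coeff_support c' \<Longrightarrow> fst p + a * snd p = \<nu> \<Longrightarrow> real n \<le> snd p"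
proof -
  note co = coeff_weighted_part[OF lat a, of \<nu>]
  {
    assume "P \<noteq> 0"
    then have "\<not> [:- \<gamma>, 1:] ^ Suc (order \<gamma> P) dvd P" by (rule order_2)
    then obtain b where "b \<le> order \<gamma> P" "coeff (pcompose P [:\<gamma>, 1:]) b \<noteq> 0"
      unfolding power_dvd_iff_translated_coeffs by (auto simp: less_Suc_eq_le)
    then show "\<exists>b. b \<le> order \<gamma> P \<and> (\<nu> - a * real b, real b) \<in> coeff_support c'"
      using co[of b] coeff_supportI[of c'] eq by metis
  }
  assume dvd: "[:- \<gamma>, 1:] ^ n dvd P" and p: "p \<in> coeff_support c'" "fst p + a * snd p = \<nu>"
  obtain \<alpha> b where ab: "p = (\<alpha>, real b)" "c' \<alpha> b \<noteq> 0" using p(1) unfolding coeff_support_def by blast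
  then have "\<alpha> = \<nu> - a * real b" using p(2) by simp
  then have "coeff (pcompose P [:\<gamma>, 1:]) b \<noteq> 0" using co[of b] ab(2) eq by simp
  then have "\<not> b < n" using dvd power_dvd_iff_translated_coeffs[of \<gamma> n P] by blast
  then show "real n \<le> snd p" using ab(1) by simp
qed

section \<open>Shears by smooth functions\<close>

abbreviation taylor_order :: "(real \<times> real \<Rightarrow> real) \<Rightarrow> real \<Rightarrow> real" where
  "taylor_order \<rho> \<equiv> weighted_order (taylor_support \<rho>)"

text \<open>The initial polynomial on the half-plane \<open>\<sigma> x\<^sub>1 > 0\<close>, in the coordinate \<open>\<sigma> x\<^sub>1\<close>.\<close>

abbreviation initial_part :: "real \<Rightarrow> (real \<times> real \<Rightarrow> real) \<Rightarrow> real \<Rightarrow> real poly" where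
  "initial_part \<sigma> \<rho> a \<equiv> weighted_part (puiseux_coeff \<sigma> 1 \<rho>) a (taylor_order \<rho> a)"

lemma shear_at_0: "\<psi> 0 = 0 \<Longrightarrow> shear \<phi> \<psi> (0, 0) = \<phi> (0, 0)"
  by (simp add: shear_def)

lemma shear_zero: "shear \<phi> (\<lambda>_. 0) = \<phi>"
  by (simp add: shear_def)

lemma shear_comparison:
  assumes \<phi>: "smooth_near_0 \<phi>" and \<psi>: "smooth_near_0 \<psi>1" "\<psi>1 0 = 0" "smooth_near_0 \<psi>2" "\<psi>2 0 = 0"
    and ft: "finite_type (shear \<phi> \<psi>1)" and \<sigma>: "\<bar>\<sigma>\<bar> = 1" and a: "a > 0"
    and lim: "((\<lambda>x. (\<psi>2 (\<sigma> * x) - \<psi>1 (\<sigma> * x)) / x powr a) \<longlongrightarrow> \<gamma>) (at_right 0)"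
  shows "finite_type (shear \<phi> \<psi>2)"
    and "taylor_order (shear \<phi> \<psi>2) a = taylor_order (shear \<phi> \<psi>1) a"
    and "weighted_part (puiseux_coeff \<sigma> 1 (shear \<phi> \<psi>2)) a (taylor_order (shear \<phi> \<psi>1) a)
      = pcompose (initial_part \<sigma> (shear \<phi> \<psi>1) a) [:\<gamma>, 1:]"
proof -
  have \<sigma>0: "\<sigma> \<noteq> 0" using \<sigma> by auto
  note S = taylor_support_eq_coeff_support[OF \<sigma>0]
  have ne: "coeff_support (puiseux_coeff \<sigma> 1 (shear \<phi> \<psi>1)) \<noteq> {}"
    using ft unfolding finite_type_iff S .
  have eq: "shear \<phi> \<psi>2 (\<sigma> * x, y) = shear \<phi> \<psi>1 (\<sigma> * x, y + (\<psi>2 (\<sigma> * x) - \<psi>1 (\<sigma> * x)))" for x y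
    by (simp add: shear_def)
  note T = puiseux_expansion_shear[OF puiseux_expansion_half_plane[OF smooth_near_0_shear[OF \<phi> \<psi>(1,2)] \<sigma>]
      puiseux_expansion_half_plane[OF smooth_near_0_shear[OF \<phi> \<psi>(3,4)] \<sigma>] ne a zero_less_one eq lim]
  show "finite_type (shear \<phi> \<psi>2)" unfolding finite_type_iff S by (rule T(1))
  show "taylor_order (shear \<phi> \<psi>2) a = taylor_order (shear \<phi> \<psi>1) a"
    unfolding S by (rule T(2))
  show "weighted_part (puiseux_coeff \<sigma> 1 (shear \<phi> \<psi>2)) a (taylor_order (shear \<phi> \<psi>1) a)
      = pcompose (initial_part \<sigma> (shear \<phi> \<psi>1) a) [:\<gamma>, 1:]"
    unfolding S by (rule T(3))
qed

lemma smooth_near_0_scale: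
  fixes \<psi> :: "real \<Rightarrow> real"
  assumes "smooth_near_0 \<psi>" "q > 0"
  shows "smooth_near_0 (\<lambda>s. \<psi> (\<sigma> * s ^ q))"
proof (rule smooth_near_0_compose[OF assms(1)])
  show "smooth_near_0 (\<lambda>s. \<sigma> * s ^ q)"
    by (intro smooth_near_0_mult[OF smooth_near_0_const] smooth_near_0_power smooth_near_0_linear bounded_linear_ident)
qed (use assms(2) in \<open>simp add: power_0_left\<close>)

text \<open>As \<open>\<psi> 0 = 0\<close>, the shear is of size \<open>O(x)\<close> and invisible
  at the slope \<open>1/2\<close>, so comparison with the zero shear at this slope shows that a
  coefficient survives.\<close>

lemma finite_type_shear:
  assumes "smooth_near_0 \<phi>" "finite_type \<phi>" "smooth_near_0 \<psi>" "\<psi> 0 = 0"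
  shows "finite_type (shear \<phi> \<psi>)"
proof (rule shear_comparison(1)[OF assms(1) smooth_near_0_const[of 0] _ assms(3,4), where \<sigma> = 1 and a = "1/2" and \<gamma> = 0])
  have "((\<lambda>x. \<psi> (root 1 x) / x powr (1/2)) \<longlongrightarrow> (\<Sum>j<1. if real j / real 1 = 1/2 then taylor_coeff1 \<psi> j else 0)) (at_right 0)"
  proof (rule fractional_limit[OF assms(3)])
    fix j assume "taylor_coeff1 \<psi> j \<noteq> 0"
    then have "j \<noteq> 0" using assms(4) by (cases j) (auto simp: taylor_coeff1_def)
    then show "1/2 \<le> real j / real 1" by simp
  qed auto
  then show "((\<lambda>x. (\<psi> (1 * x) - 0) / x powr (1/2)) \<longlongrightarrow> 0) (at_right 0)" by simp
qed (use assms in \<open>simp_all add: shear_zero\<close>)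

lemma smooth_near_0_monomial: "smooth_near_0 (\<lambda>x::real. \<beta> * x ^ k)"
  by (intro smooth_near_0_mult[OF smooth_near_0_const] smooth_near_0_power smooth_near_0_linear bounded_linear_ident)

lemma local_coordinates_monomial_shear:
  assumes "k > 0"
  shows "local_coordinates (\<lambda>y. (fst y, snd y + \<beta> * fst y ^ k))"
proof -
  have sm: "smooth_on UNIV (\<lambda>y::real\<times>real. (fst y, snd y + \<beta> * fst y ^ k))" for \<beta>
    unfolding smooth_on_def
    by (intro allI Ck_on_Pair Ck_on_add Ck_on_mult Ck_on_const Ck_on_power Ck_on_linear[OF bounded_linear_fst]
        Ck_on_linear[OF bounded_linear_snd] open_UNIV)
  have "homeomorphism UNIV UNIV (\<lambda>y::real\<times>real. (fst y, snd y + \<beta> * fst y ^ k)) (\<lambda>y. (fst y, snd y + (- \<beta>) * fst y ^ k))"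
    by (intro homeomorphismI continuous_intros) auto
  moreover have "(fst 0, snd 0 + \<beta> * fst 0 ^ k) = (0 :: real \<times> real)"
    using assms by (simp add: zero_prod_def power_0_left)
  ultimately show ?thesis
    unfolding local_coordinates_def using sm[of \<beta>] sm[of "- \<beta>"] open_UNIV UNIV_I by blast
qed

lemma newton_distance_monomial_shear_le:
  assumes "adapted \<rho>" "k > 0"
  shows "newton_distance (shear \<rho> (\<lambda>x. \<beta> * x ^ k)) \<le> newton_distance \<rho>"
proof -
  have "shear \<rho> (\<lambda>x. \<beta> * x ^ k) = \<rho> \<circ> (\<lambda>y. (fst y, snd y + \<beta> * fst y ^ k))"
    by (simp add: shear_def fun_eq_iff)
  then have "ereal (newton_distance (shear \<rho> (\<lambda>x. \<beta> * x ^ k))) \<le> height \<rho>"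
    unfolding height_def using local_coordinates_monomial_shear[OF assms(2)] by (intro SUP_upper2) auto
  then show ?thesis using assms(1) unfolding adapted_def by (metis ereal_less_eq(3))
qed

text \<open>Moving a root of multiplicity greater than the distance to \<open>0\<close> by a shear increases the distance.\<close>

lemma adapted_multiplicity:
  assumes \<rho>: "smooth_near_0 \<rho>" "finite_type \<rho>" "\<rho> (0, 0) = 0" and ad: "adapted \<rho>"
    and \<sigma>: "\<bar>\<sigma>\<bar> = 1" and k: "k > 0"
    and dist: "newton_distance \<rho> = taylor_order \<rho> (real k) / (1 + real k)"
  shows "real (order \<gamma> (initial_part \<sigma> \<rho> (real k)))
    \<le> newton_distance \<rho>"
proof (rule ccontr)
  let ?\<nu> = "taylor_order \<rho> (real k)"
  let ?P = "weighted_part (puiseux_coeff \<sigma> 1 \<rho>) (real k) ?\<nu>"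
  assume "\<not> real (order \<gamma> ?P) \<le> newton_distance \<rho>"
  then have big: "newton_distance \<rho> < real (order \<gamma> ?P)" by simp
  define D where "D = newton_distance \<rho>"
  \<comment> \<open>Normalized so that \<open>\<psi> (\<sigma> x) = \<gamma> x^k\<close> for the
    given sign.\<close>
  define \<beta> where "\<beta> = \<gamma> * \<sigma> ^ k"
  define \<psi> where "\<psi> = (\<lambda>x::real. \<beta> * x ^ k)"
  define \<rho>' where "\<rho>' = shear \<rho> \<psi>"
  have \<psi>: "smooth_near_0 \<psi>" "\<psi> 0 = 0"
    using k by (simp_all add: \<psi>_def smooth_near_0_monomial power_0_left)
  have \<sigma>\<sigma>: "\<sigma> ^ k * \<sigma> ^ k = 1"
  proof -
    have "\<sigma> * \<sigma> = 1" using \<sigma> by (metis abs_mult_self_eq mult_1)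
    then show ?thesis by (simp add: power_mult_distrib[symmetric])
  qed
  have lim: "((\<lambda>x. (\<psi> (\<sigma> * x) - 0) / x powr real k) \<longlongrightarrow> \<gamma>) (at_right 0)"
  proof (rule iffD2[OF tendsto_at_right_cong[OF zero_less_one, of _ "\<lambda>_. \<gamma>"] tendsto_const])
    fix x :: real assume "0 < x" "x < 1"
    then show "(\<psi> (\<sigma> * x) - 0) / x powr real k = \<gamma>"
      using \<sigma>\<sigma> by (simp add: \<psi>_def \<beta>_def powr_realpow power_mult_distrib mult.assoc)
  qed
  have ft: "finite_type (shear \<rho> (\<lambda>_. 0))" using \<rho>(2) by (simp add: shear_zero)
  note C = shear_comparison[OF \<rho>(1) smooth_near_0_const[of 0] refl \<psi> ft \<sigma> _ lim, unfolded shear_zero]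
  have k0: "real k > 0" using k by simp
  interpret X: newton_support 1 "taylor_support \<rho>'"
    using newton_support_taylor[of \<rho>'] C(1)[OF k0] \<rho>(3) \<psi>(2) by (simp add: \<rho>'_def shear_at_0)
  have S: "taylor_support \<rho>' = coeff_support (puiseux_coeff \<sigma> 1 \<rho>')"
    using \<sigma> by (intro taylor_support_eq_coeff_support) auto
  have \<nu>': "X.\<nu> (real k) = ?\<nu>" using C(2)[OF k0] by (simp add: \<rho>'_def)
  have heavy: "real (order \<gamma> ?P) \<le> snd p" if "p \<in> X.face (real k)" for p
  proof (rule translated_coeffs(2)[OF _ k0 C(3)[OF k0], folded \<rho>'_def])
    show "lattice_set 1 (coeff_support (puiseux_coeff \<sigma> 1 \<rho>'))" by (rule lattice_puiseux_coeff) simp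
    show "[:- \<gamma>, 1:] ^ order \<gamma> ?P dvd ?P" by (rule order_1)
    show "p \<in> coeff_support (puiseux_coeff \<sigma> 1 \<rho>')" using X.faceD(1)[OF that] S by simp
    show "fst p + real k * snd p = ?\<nu>" using X.faceD(2)[OF that] \<nu>' by simp
  qed
  have int: "\<exists>i::nat. fst p + real k * snd p = real i" if p: "p \<in> taylor_support \<rho>'" for p
  proof -
    obtain i j where "p = (real i, real j)" using p unfolding taylor_support_def by blast
    then have "fst p + real k * snd p = real (i + k * j)" by simp
    then show ?thesis by blast
  qed
  have D\<nu>: "?\<nu> = (1 + real k) * D" using dist by (simp add: D_def)
  have D0: "0 < D" using X.order_pos[OF k0] D\<nu> \<nu>' by (simp add: zero_less_mult_iff)
  \<comment> \<open>The slope is raised slightly above \<open>k\<close>. Points of the old face lie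
    higher than \<open>D\<close> and profit from this; all others exceed the old line by at least 1,
    as weights of slope \<open>k\<close> are integers, and \<open>e * D < 1\<close>. Hence
    \<open>(D, D)\<close> falls strictly below the new supporting line.\<close>
  define e where "e = 1 / (2 * (D + 1))"
  have e: "e > 0" "e * D < 1" using D0 by (auto simp: e_def field_simps)
  have ke: "real k + e > 0" using e k0 by simp
  obtain p where p: "p \<in> X.face (real k + e)" using X.face_nonempty[OF ke] ..
  note pS = X.faceD(1)[OF p]
  have "(1 + (real k + e)) * D < fst p + (real k + e) * snd p"
  proof (cases "p \<in> X.face (real k)")
    case True
    then have "D < snd p" using heavy[OF True] big by (simp add: D_def)
    then have "e * D < e * snd p" using e(1) by simp
    then show ?thesis using X.faceD(2)[OF True] \<nu>' D\<nu> by (simp add: algebra_simps)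
  next
    case False
    then have less: "?\<nu> < fst p + real k * snd p"
      using X.order_le[OF pS k0] pS \<nu>' by (auto simp: X.face_def)
    obtain p0 where p0: "p0 \<in> X.face (real k)" using X.face_nonempty[OF k0] ..
    obtain i j :: nat where "?\<nu> = real i" "fst p + real k * snd p = real j"
      using int[OF pS] int[OF X.faceD(1)[OF p0]] X.faceD(2)[OF p0] \<nu>' by metis
    then have "?\<nu> + 1 \<le> fst p + real k * snd p" using less by simp
    moreover have "0 \<le> e * snd p" using e(1) X.nonneg(2)[OF pS] by simp
    ultimately show ?thesis using e(2) D\<nu> by (simp add: algebra_simps)
  qed
  then have "(1 + (real k + e)) * D < (1 + (real k + e)) * X.distance"
    using X.faceD(2)[OF p] X.order_le_distance[OF ke] by simp
  then have "D < X.distance" using ke by simp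
  moreover have "newton_distance \<rho>' = X.distance"
    by (rule newton_distance_eq) unfold_locales
  ultimately show False
    using newton_distance_monomial_shear_le[OF ad k, of \<beta>] by (simp add: \<rho>'_def \<psi>_def D_def)
qed

section \<open>Principal root jets\<close>

lemma taylor_supportI: "taylor_coeff \<rho> i j \<noteq> 0 \<Longrightarrow> (real i, real j) \<in> taylor_support \<rho>"
  by (auto simp: taylor_support_def)

lemma poly_map_poly_at_1:
  "poly (map_poly (\<lambda>p. poly p 1) R) t = poly (poly R [:t:]) (1::real)"
proof (induction R)
  case (pCons c R)
  have "map_poly (\<lambda>p. poly p (1::real)) (pCons c R) = pCons (poly c 1) (map_poly (\<lambda>p. poly p 1) R)"
    by (rule map_poly_pCons) simp
  then show ?case using pCons.IH by simp
qed simp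

text \<open>Setting \<open>x1 = 1\<close> merges no terms, since on the face the exponent of
  \<open>x2\<close> determines that of \<open>x1\<close>. The sum in \<open>principal_part\<close>
  is finite because \<open>a > 0\<close>.\<close>

lemma map_poly_principal_part:
  assumes X: "newton_support 1 (taylor_support \<rho>)" and a: "a > 0"
    and F: "principal_face \<rho> = convex hull (newton_support.face (taylor_support \<rho>) a)"
  shows "map_poly (\<lambda>p. poly p 1) (principal_part \<rho>)
    = initial_part 1 \<rho> a"
proof (rule poly_eqI)
  fix j
  interpret X: newton_support 1 "taylor_support \<rho>" by (rule X)
  define T where "T = {(i, j). taylor_coeff \<rho> i j \<noteq> 0 \<and> (real i, real j) \<in> principal_face \<rho>}"
  have T_iff: "(i, j) \<in> T \<longleftrightarrow> taylor_coeff \<rho> i j \<noteq> 0 \<and> real i + a * real j = X.\<nu> a" for i j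
  proof -
    have "(real i, real j) \<in> convex hull (X.face a) \<longleftrightarrow> real i + a * real j = X.\<nu> a"
      if "taylor_coeff \<rho> i j \<noteq> 0"
    proof -
      have "(real i, real j) \<in> taylor_support \<rho>" using that by (rule taylor_supportI)
      then show ?thesis
        using X.hull_face_on[OF a, of "(real i, real j)"] hull_inc[of "(real i, real j)" "X.face a" convex]
        by (auto simp: X.face_def)
    qed
    then show ?thesis unfolding T_def F by blast
  qed
  have "finite ((\<lambda>(i, j). (real i, real j)) ` T)"
  proof (rule finite_subset[OF _ X.finite_face[OF a]])
    show "(\<lambda>(i, j). (real i, real j)) ` T \<subseteq> X.face a"
      using taylor_supportI by (auto simp: T_iff X.face_def)
  qed
  then have finT: "finite T" by (rule finite_imageD) (auto simp: inj_on_def)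
  have "coeff (map_poly (\<lambda>p. poly p 1) (principal_part \<rho>)) j = poly (coeff (principal_part \<rho>) j) 1"
    by (simp add: coeff_map_poly)
  also have "\<dots> = (\<Sum>p\<in>T. if snd p = j then taylor_coeff \<rho> (fst p) j else 0)"
    unfolding principal_part_def T_def[symmetric] coeff_sum poly_sum
    by (intro sum.cong refl) (auto simp: poly_monom)
  also have "\<dots> = puiseux_coeff 1 1 \<rho> (X.\<nu> a - a * real j) j"
  proof (cases "\<exists>i. (i, j) \<in> T")
    case True
    then obtain i where i: "(i, j) \<in> T" by blast
    then have eq: "X.\<nu> a - a * real j = real i / real 1" unfolding T_iff by simp
    have uniq: "p = (i, j)" if p: "p \<in> T" "snd p = j" for p
    proof -
      obtain i' where i': "p = (i', j)" using p(2) by (cases p) simp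
      have "real i' + a * real j = X.\<nu> a" "real i + a * real j = X.\<nu> a"
        using p(1) i unfolding i' T_iff by blast+
      then have "real i' = real i" by linarith
      then show ?thesis using i' by simp
    qed
    have "(\<Sum>p\<in>T. if snd p = j then taylor_coeff \<rho> (fst p) j else 0)
        = (\<Sum>p\<in>T. if p = (i, j) then taylor_coeff \<rho> i j else 0)"
    proof (rule sum.cong[OF refl])
      fix p assume "p \<in> T"
      then have "snd p = j \<longleftrightarrow> p = (i, j)" using uniq[of p] by force
      then show "(if snd p = j then taylor_coeff \<rho> (fst p) j else 0) = (if p = (i, j) then taylor_coeff \<rho> i j else 0)"
        by simp
    qed
    also have "\<dots> = taylor_coeff \<rho> i j" using finT i by simp
    also have "\<dots> = puiseux_coeff 1 1 \<rho> (X.\<nu> a - a * real j) j"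
      unfolding eq by (subst puiseux_coeff_at) simp_all
    finally show ?thesis .
  next
    case False
    have "puiseux_coeff 1 1 \<rho> (X.\<nu> a - a * real j) j = 0"
    proof (rule ccontr)
      assume "puiseux_coeff 1 1 \<rho> (X.\<nu> a - a * real j) j \<noteq> 0"
      from puiseux_coeff_nonzero[OF zero_less_one this]
      obtain i where i: "X.\<nu> a - a * real j = real i / real 1" "taylor_coeff \<rho> i j \<noteq> 0" by blast
      then have "real i + a * real j = X.\<nu> a" by simp
      then show False using i(2) False unfolding T_iff by blast
    qed
    moreover have "(\<Sum>p\<in>T. if snd p = j then taylor_coeff \<rho> (fst p) j else 0) = 0"
    proof (rule sum.neutral, rule ballI)
      fix p assume "p \<in> T"
      then have "snd p \<noteq> j" using False by (metis prod.collapse)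
      then show "(if snd p = j then taylor_coeff \<rho> (fst p) j else 0) = 0" by simp
    qed
    ultimately show ?thesis by simp
  qed
  also have "\<dots> = coeff (weighted_part (puiseux_coeff 1 1 \<rho>) a (X.\<nu> a)) j"
    by (rule coeff_weighted_part[OF lattice_puiseux_coeff[OF zero_less_one] a, symmetric])
  finally show "coeff (map_poly (\<lambda>p. poly p 1) (principal_part \<rho>)) j
    = coeff (weighted_part (puiseux_coeff 1 1 \<rho>) a (X.\<nu> a)) j" .
qed

text \<open>Setting \<open>x1 = 1\<close> turns the factor \<open>(x2 - b x1^m)^n\<close> of the
  principal part into \<open>(t - b)^n\<close>. The point of height at least the distance will place
  the faces of smaller slope above the diagonal.\<close>

lemma varchenko_rootD:
  assumes X: "newton_support 1 (taylor_support \<rho>)" and V: "varchenko_root \<rho> m b"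
  shows "m > 0"
    and "taylor_order \<rho> (real m) = (1 + real m) * newton_distance \<rho>"
    and "\<exists>p\<in>newton_support.face (taylor_support \<rho>) (real m). newton_distance \<rho> \<le> snd p"
    and "\<exists>n. newton_distance \<rho> < real n \<and>
      [:- b, 1:] ^ n dvd initial_part 1 \<rho> (real m)"
proof -
  interpret X: newton_support 1 "taylor_support \<rho>" by (rule X)
  have pf: "principal_face \<rho> = X.main_face" and d: "newton_distance \<rho> = X.distance"
    using principal_face_eq[OF X] newton_distance_eq[OF X] by auto
  have "X.main_face \<in> compact_edges (newton_hull (taylor_support \<rho>))"
    using V pf unfolding varchenko_root_def newton_polyhedron_def by simp
  then obtain a p where a: "a > 0" "X.main_face = convex hull (X.face a)"
      "edge_weight X.main_face = (1 / X.\<nu> a, a / X.\<nu> a)" "X.\<nu> a = (1 + a) * X.distance"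
      "p \<in> X.face a" "X.distance \<le> snd p"
    by (rule X.main_face_compact_edge)
  have "principal_slope \<rho> = a"
    using X.order_pos[OF a(1)] unfolding principal_slope_def pf a(3) by simp
  then have am: "a = real m" using V by (simp add: varchenko_root_def)
  show "m > 0" using a(1) am by simp
  show "taylor_order \<rho> (real m) = (1 + real m) * newton_distance \<rho>"
    using a(4) am d by simp
  show "\<exists>p\<in>newton_support.face (taylor_support \<rho>) (real m). newton_distance \<rho> \<le> snd p"
    using a(5,6) am d by auto
  let ?n = "order (monom b m) (principal_part \<rho>)"
  have n: "newton_distance \<rho> < real ?n" using V by (simp add: varchenko_root_def)
  have "[:- monom b m, 1:] ^ ?n dvd principal_part \<rho>" by (rule order_1)
  then obtain R where R: "principal_part \<rho> = [:- monom b m, 1:] ^ ?n * R" by (auto elim: dvdE)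
  have "map_poly (\<lambda>p. poly p 1) (principal_part \<rho>) = [:- b, 1:] ^ ?n * map_poly (\<lambda>p. poly p 1) R"
  proof (rule iffD1[OF poly_eq_poly_eq_iff], rule ext)
    fix t
    have "poly (map_poly (\<lambda>p. poly p 1) (principal_part \<rho>)) t = poly (poly (principal_part \<rho>) [:t:]) 1"
      by (rule poly_map_poly_at_1)
    also have "\<dots> = (t - b) ^ ?n * poly (poly R [:t:]) 1"
      by (subst R) (simp add: poly_monom)
    also have "\<dots> = poly ([:- b, 1:] ^ ?n * map_poly (\<lambda>p. poly p 1) R) t"
      by (simp add: poly_map_poly_at_1)
    finally show "poly (map_poly (\<lambda>p. poly p 1) (principal_part \<rho>)) t
        = poly ([:- b, 1:] ^ ?n * map_poly (\<lambda>p. poly p 1) R) t" .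
  qed
  then have "[:- b, 1:] ^ ?n dvd weighted_part (puiseux_coeff 1 1 \<rho>) a (X.\<nu> a)"
    using map_poly_principal_part[OF X a(1)] pf a(2) by simp
  then show "\<exists>n. newton_distance \<rho> < real n \<and>
      [:- b, 1:] ^ n dvd initial_part 1 \<rho> (real m)"
    using n am by blast
qed

text \<open>A face with points on both sides of the diagonal spans the principal face, to which the
  convention on the order of the coordinates applies.\<close>

lemma normalized_order_mixed:
  assumes X: "newton_support 1 (taylor_support \<rho>)" and "normalized_order \<rho>" and a: "a > 0"
    and p: "p \<in> newton_support.face (taylor_support \<rho>) a" "fst p < snd p"
    and p': "p' \<in> newton_support.face (taylor_support \<rho>) a" "snd p' < fst p'"
  shows "1 \<le> a"
proof -
  interpret X: newton_support 1 "taylor_support \<rho>" by (rule X)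
  have pf: "principal_face \<rho> = convex hull (X.face a)"
    using principal_face_eq[OF X] X.main_face_of_mixed_face[OF a p p'] by simp
  have "p \<noteq> p'" using p p' by auto
  note E = X.hull_face_compact_edge[OF a p(1) p'(1) this]
  have "fst (edge_weight (principal_face \<rho>)) \<le> snd (edge_weight (principal_face \<rho>))"
    using assms(2) E(1) unfolding normalized_order_def newton_polyhedron_def pf by (simp add: Let_def)
  then show ?thesis
    using X.order_pos[OF a] unfolding pf E(2) by (simp add: divide_le_cancel)
qed

text \<open>Common form of terminating and infinite jets: up to an error of order
  \<open>Suc (m j)\<close>, \<open>\<psi>\<close> is the jet after step \<open>j\<close>.\<close>

definition jet_remainder :: "(nat \<Rightarrow> nat) \<Rightarrow> (nat \<Rightarrow> real) \<Rightarrow> (real \<Rightarrow> real) \<Rightarrow> nat \<Rightarrow> bool" where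
  "jet_remainder m b \<psi> j \<longleftrightarrow> (\<exists>C r. 0 < r \<and> (\<forall>s. \<bar>s\<bar> \<le> r \<longrightarrow>
     \<bar>\<psi> s - jet_sum m b j s - b j * s ^ m j\<bar> \<le> C * \<bar>s\<bar> ^ Suc (m j)))"

text \<open>The exponents of the later steps are at least \<open>Suc (m j)\<close>.\<close>

lemma jet_remainder_finite:
  assumes m: "strict_mono_on {..<K} m" and j: "j < K"
  shows "jet_remainder m b (jet_sum m b K) j"
  unfolding jet_remainder_def
proof (rule exI[of _ "\<Sum>i\<in>{Suc j..<K}. \<bar>b i\<bar>"], rule exI[of _ 1], intro conjI allI impI)
  fix s :: real assume s: "\<bar>s\<bar> \<le> 1"
  have "jet_sum m b K s = jet_sum m b (Suc j) s + (\<Sum>i\<in>{Suc j..<K}. b i * s ^ m i)"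
    unfolding jet_sum_def using sum.atLeastLessThan_concat[of 0 "Suc j" K "\<lambda>i. b i * s ^ m i"] j
    by (simp add: lessThan_atLeast0)
  then have "jet_sum m b K s - jet_sum m b j s - b j * s ^ m j = (\<Sum>i\<in>{Suc j..<K}. b i * s ^ m i)"
    by (simp add: jet_sum_def)
  also have "\<bar>\<dots>\<bar> \<le> (\<Sum>i\<in>{Suc j..<K}. \<bar>b i\<bar> * \<bar>s\<bar> ^ Suc (m j))"
  proof (intro order_trans[OF sum_abs] sum_mono)
    fix i assume i: "i \<in> {Suc j..<K}"
    then have "m j < m i" using strict_mono_onD[OF m, of j i] j by simp
    then have "\<bar>s\<bar> ^ m i \<le> \<bar>s\<bar> ^ Suc (m j)" using s by (intro power_decreasing) auto
    then show "\<bar>b i * s ^ m i\<bar> \<le> \<bar>b i\<bar> * \<bar>s\<bar> ^ Suc (m j)"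
      unfolding abs_mult power_abs by (intro mult_left_mono) auto
  qed
  finally show "\<bar>jet_sum m b K s - jet_sum m b j s - b j * s ^ m j\<bar> \<le> (\<Sum>i\<in>{Suc j..<K}. \<bar>b i\<bar>) * \<bar>s\<bar> ^ Suc (m j)"
    by (simp only: sum_distrib_right)
qed simp

text \<open>Since \<open>m\<close> is increasing, the Taylor polynomial of \<open>\<psi>\<close> up
  to the degree \<open>m j\<close> consists of the terms of the steps up to
  \<open>j\<close>.\<close>

lemma jet_remainder_infinite:
  assumes m: "strict_mono_on UNIV m" and \<psi>: "smooth_near_0 \<psi>"
    and b: "\<forall>k. taylor_coeff1 \<psi> (m k) = b k" "\<forall>j. j \<notin> range m \<longrightarrow> taylor_coeff1 \<psi> j = 0"
  shows "jet_remainder m b \<psi> j"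
proof -
  have inj: "inj_on m A" for A using m by (metis inj_on_subset strict_mono_on_imp_inj_on subset_UNIV)
  have less: "i < j \<longleftrightarrow> m i < m j" for i j
    using m by (metis UNIV_I linorder_neqE_nat order_less_asym strict_mono_onD)
  obtain C r where r: "0 < r" "\<And>s. \<bar>s\<bar> \<le> r \<Longrightarrow>
      \<bar>\<psi> s - (\<Sum>a<Suc (m j). taylor_coeff1 \<psi> a * s ^ a)\<bar> \<le> C * \<bar>s\<bar> ^ Suc (m j)"
    using taylor_estimate1[OF \<psi>, of "Suc (m j)"] by blast
  have "(\<Sum>a<Suc (m j). taylor_coeff1 \<psi> a * s ^ a) = jet_sum m b j s + b j * s ^ m j" for s
  proof -
    have "(\<Sum>a<Suc (m j). taylor_coeff1 \<psi> a * s ^ a) = (\<Sum>a\<in>m ` {..<Suc j}. taylor_coeff1 \<psi> a * s ^ a)"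
    proof (rule sum.mono_neutral_right)
      show "m ` {..<Suc j} \<subseteq> {..<Suc (m j)}"
        using less by (force simp: less_Suc_eq)
      show "\<forall>a\<in>{..<Suc (m j)} - m ` {..<Suc j}. taylor_coeff1 \<psi> a * s ^ a = 0"
      proof
        fix a assume a: "a \<in> {..<Suc (m j)} - m ` {..<Suc j}"
        have "a \<notin> range m"
        proof
          assume "a \<in> range m"
          then obtain i where i: "a = m i" by blast
          then have "\<not> m j < m i" using a by simp
          then have "i < Suc j" using less[of j i] by simp
          then show False using a i by blast
        qed
        then show "taylor_coeff1 \<psi> a * s ^ a = 0" using b(2) by simp
      qed
    qed simp
    also have "\<dots> = (\<Sum>i<Suc j. b i * s ^ m i)"
      by (simp only: sum.reindex[OF inj] o_def b(1)[rule_format])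
    finally show ?thesis by (simp add: jet_sum_def)
  qed
  then show ?thesis
    unfolding jet_remainder_def using r by (intro exI[of _ C] exI[of _ r]) (simp add: diff_diff_eq)
qed

lemma jet_limit:
  assumes J: "jet_remainder m b \<psi> j" and \<sigma>: "\<bar>\<sigma>\<bar> = 1"
  shows "((\<lambda>x. (\<psi> (\<sigma> * x) - jet_sum m b j (\<sigma> * x)) / x powr real (m j)) \<longlongrightarrow> b j * \<sigma> ^ m j) (at_right 0)"
proof -
  obtain C r where r: "0 < r" "\<And>s. \<bar>s\<bar> \<le> r \<Longrightarrow>
      \<bar>\<psi> s - jet_sum m b j s - b j * s ^ m j\<bar> \<le> C * \<bar>s\<bar> ^ Suc (m j)"
    using J unfolding jet_remainder_def by blast
  let ?f = "\<lambda>x. (\<psi> (\<sigma> * x) - jet_sum m b j (\<sigma> * x)) / x powr real (m j)"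
  have "((\<lambda>x. ?f x - b j * \<sigma> ^ m j) \<longlongrightarrow> 0) (at_right 0)"
  proof (rule Lim_null_comparison)
    have "((\<lambda>x. C * x) \<longlongrightarrow> C * 0) (at_right (0::real))" by (intro tendsto_intros)
    then show "((\<lambda>x. C * x) \<longlongrightarrow> 0) (at_right (0::real))" by simp
    show "\<forall>\<^sub>F x in at_right 0. norm (?f x - b j * \<sigma> ^ m j) \<le> C * x"
      unfolding eventually_at_right_field
    proof (intro exI[of _ r] conjI allI impI r(1))
      fix x :: real assume x: "0 < x" "x < r"
      have ax: "\<bar>\<sigma> * x\<bar> = x" using \<sigma> x by (simp add: abs_mult)
      let ?n = "\<psi> (\<sigma> * x) - jet_sum m b j (\<sigma> * x) - b j * (\<sigma> * x) ^ m j"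
      have "?f x - b j * \<sigma> ^ m j = ?n / x ^ m j"
        using x by (simp add: powr_realpow power_mult_distrib diff_divide_distrib)
      moreover have "\<bar>?n\<bar> / x ^ m j \<le> (C * x ^ Suc (m j)) / x ^ m j"
        using r(2)[of "\<sigma> * x"] ax x by (intro divide_right_mono) auto
      moreover have "(C * x ^ Suc (m j)) / x ^ m j = C * x" using x by simp
      ultimately show "norm (?f x - b j * \<sigma> ^ m j) \<le> C * x"
        using x by simp
    qed
  qed
  from tendsto_add[OF this tendsto_const[of "b j * \<sigma> ^ m j"]] show ?thesis by simp
qed

lemma smooth_near_0_jet_sum: "smooth_near_0 (jet_sum m b k)"
  unfolding jet_sum_def by (intro smooth_near_0_sum smooth_near_0_monomial)

text \<open>The multiplicity bound of the overview, for all slopes and both half-planes. The root 0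
  is left out: it belongs to the curves that agree with the jet up to \<open>o(x^a)\<close>.\<close>

definition no_heavy_roots :: "(real \<times> real \<Rightarrow> real) \<Rightarrow> bool" where
  "no_heavy_roots \<rho> \<longleftrightarrow> (\<forall>\<sigma> a \<gamma>. \<bar>\<sigma>\<bar> = 1 \<longrightarrow> a > 0 \<longrightarrow> \<gamma> \<noteq> 0 \<longrightarrow>
     real (order \<gamma> (initial_part \<sigma> \<rho> a))
       \<le> taylor_order \<rho> a / (1 + a))"

text \<open>At \<open>a = m j\<close> the root chosen by the algorithm has been moved to 0 and
  leaves no room for others. For \<open>a < m j\<close> the jet is indistinguishable from its part
  before step \<open>j\<close>, whose face of slope \<open>a\<close> does not reach below the
  diagonal. Beyond all \<open>m j\<close> the algorithm has stopped, and the sheared function is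
  adapted.\<close>

lemma no_heavy_roots_jet:
  assumes \<phi>: "smooth_near_0 \<phi>" "finite_type \<phi>" "\<phi> (0, 0) = 0" "normalized_order \<phi>"
    and V: "varchenko_steps \<phi> m b I"
    and \<psi>: "smooth_near_0 \<psi>" "\<psi> 0 = 0" "\<And>j. j \<in> I \<Longrightarrow> jet_remainder m b \<psi> j"
    and I: "I = UNIV \<or> (\<exists>K. I = {..<K} \<and> adapted (shear \<phi> \<psi>) \<and> \<psi> = jet_sum m b K)"
    and m0: "\<And>j. j \<in> I \<Longrightarrow> 1 \<le> m j"
  shows "no_heavy_roots (shear \<phi> \<psi>)"
  unfolding no_heavy_roots_def
proof (intro allI impI)
  fix \<sigma> a \<gamma> :: real assume \<sigma>: "\<bar>\<sigma>\<bar> = 1" and a: "a > 0" and \<gamma>: "\<gamma> \<noteq> 0"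
  define \<rho> where "\<rho> = shear \<phi> \<psi>"
  have \<sigma>0: "\<sigma> \<noteq> 0" using \<sigma> by auto
  have ft: "finite_type \<rho>" unfolding \<rho>_def by (rule finite_type_shear[OF \<phi>(1,2) \<psi>(1,2)])
  have \<rho>: "smooth_near_0 \<rho>" "\<rho> (0, 0) = 0"
    using smooth_near_0_shear[OF \<phi>(1) \<psi>(1,2)] shear_at_0[of \<psi> \<phi>, OF \<psi>(2)] \<phi>(3) by (simp_all add: \<rho>_def)
  have X: "newton_support 1 (taylor_support \<rho>)" by (rule newton_support_taylor[OF ft \<rho>(2)])
  have S: "taylor_support \<rho> = coeff_support (puiseux_coeff \<sigma> 1 \<rho>)"
    by (rule taylor_support_eq_coeff_support[OF \<sigma>0])
  interpret X: integral_newton_support "puiseux_coeff \<sigma> 1 \<rho>"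
    unfolding integral_newton_support_def using X S by simp
  have goal: "real (order \<gamma> (weighted_part (puiseux_coeff \<sigma> 1 \<rho>) a (X.\<nu> a))) \<le> X.\<nu> a / (1 + a)"
  proof (cases "\<exists>j\<in>I. a \<le> real (m j)")
    case True
    then obtain j where j: "j \<in> I" "a \<le> real (m j)" by blast
    define \<psi>j where "\<psi>j = jet_sum m b j"
    define \<rho>j where "\<rho>j = shear \<phi> \<psi>j"
    have i_in: "i \<in> I" if "i < j" for i using I j(1) that by auto
    have \<psi>j: "smooth_near_0 \<psi>j" "\<psi>j 0 = 0"
    proof -
      show "smooth_near_0 \<psi>j" unfolding \<psi>j_def by (rule smooth_near_0_jet_sum)
      have "b i * 0 ^ m i = 0" if "i < j" for i using m0[OF i_in[OF that]] by simp
      then show "\<psi>j 0 = 0" unfolding \<psi>j_def jet_sum_def by (intro sum.neutral) blast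
    qed
    have ftj: "finite_type \<rho>j" unfolding \<rho>j_def by (rule finite_type_shear[OF \<phi>(1,2) \<psi>j])
    have Y: "newton_support 1 (taylor_support \<rho>j)"
      by (rule newton_support_taylor[OF ftj]) (use shear_at_0[of \<psi>j \<phi>] \<psi>j \<phi>(3) in \<open>simp add: \<rho>j_def\<close>)
    have Vj: "varchenko_root \<rho>j (m j) (b j)"
      using V j(1) unfolding varchenko_steps_def \<rho>j_def \<psi>j_def by blast
    note VD = varchenko_rootD[OF Y Vj]
    have lim: "((\<lambda>x. (\<psi> (\<tau> * x) - \<psi>j (\<tau> * x)) / x powr real (m j)) \<longlongrightarrow> b j * \<tau> ^ m j) (at_right 0)"
      if "\<bar>\<tau>\<bar> = 1" for \<tau>
      unfolding \<psi>j_def by (rule jet_limit[OF \<psi>(3)[OF j(1)] that])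
    show ?thesis
    proof (cases "a = real (m j)")
      case True
      obtain n where n: "newton_distance \<rho>j < real n" "[:- b j, 1:] ^ n dvd
          initial_part 1 \<rho>j (real (m j))"
        using VD(4) by blast
      have mj: "real (m j) > 0" using VD(1) by simp
      have "((\<lambda>x. (\<psi> (1 * x) - \<psi>j (1 * x)) / x powr real (m j)) \<longlongrightarrow> b j) (at_right 0)"
        using lim[of 1] by simp
      note C = shear_comparison[OF \<phi>(1) \<psi>j \<psi>(1,2) ftj[unfolded \<rho>j_def] _ mj this, folded \<rho>_def \<rho>j_def]
      have ord: "X.\<nu> a = taylor_order \<rho>j (real (m j))"
        using C(2) True S by simp
      have D: "X.\<nu> a / (1 + a) = newton_distance \<rho>j"
        unfolding ord VD(2) using a True by simp
      \<comment> \<open>The chosen root has multiplicity at least \<open>n\<close>, so its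
        translation to 0 leaves only exponents of \<open>x2\<close> from \<open>n\<close>
        on.\<close>
      have "X.\<nu> a / (1 + a) < snd p" if "p \<in> X.face a" for p
      proof -
        have "real n \<le> snd p"
        proof (rule translated_coeffs(2)[OF _ mj C(3) n(2)])
          show "lattice_set 1 (coeff_support (puiseux_coeff 1 1 \<rho>))" by (rule lattice_puiseux_coeff) simp
          show "p \<in> coeff_support (puiseux_coeff 1 1 \<rho>)"
            using X.faceD(1)[OF that] S taylor_support_eq_coeff_support[of 1 \<rho>] by simp
          show "fst p + real (m j) * snd p = taylor_order \<rho>j (real (m j))"
            using X.faceD(2)[OF that] ord True by simp
        qed simp
        then show ?thesis using n(1) D by simp
      qed
      moreover have "1 \<le> a" using m0[OF j(1)] True by simp
      ultimately show ?thesis by (intro X.order_le_of_heavy_zero \<gamma>)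
    next
      case False
      then have am: "a < real (m j)" using j(2) by simp
      note C = shear_comparison[OF \<phi>(1) \<psi>j \<psi>(1,2) ftj[unfolded \<rho>j_def] \<sigma> a powr_limit_lower[OF lim[OF \<sigma>] am],
          folded \<rho>_def \<rho>j_def]
      have Sj: "taylor_support \<rho>j = coeff_support (puiseux_coeff \<sigma> 1 \<rho>j)"
        by (rule taylor_support_eq_coeff_support[OF \<sigma>0])
      interpret Y: integral_newton_support "puiseux_coeff \<sigma> 1 \<rho>j"
        unfolding integral_newton_support_def using Y Sj by simp
      obtain p where p: "p \<in> Y.face (real (m j))" "newton_distance \<rho>j \<le> snd p"
        using VD(3) unfolding Sj by blast
      have ordm: "Y.\<nu> (real (m j)) = (1 + real (m j)) * newton_distance \<rho>j"
        using VD(2) unfolding Sj .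
      have mj: "real (m j) > 0" using VD(1) by simp
      have pd: "fst p \<le> newton_distance \<rho>j"
      proof -
        have "0 \<le> real (m j) * (snd p - newton_distance \<rho>j)" using p(2) by simp
        then show ?thesis using Y.faceD(2)[OF p(1)] ordm by (simp add: algebra_simps)
      qed
      \<comment> \<open>The edge of slope \<open>m j\<close> has a point \<open>p\<close> on or
        above the diagonal, and decreasing the slope moves the face up and to the left of
        \<open>p\<close>.\<close>
      have "fst t \<le> snd t" if t: "t \<in> Y.face a" for t
      proof -
        have 1: "fst t + a * snd t \<le> fst p + a * snd p"
          using Y.faceD(2)[OF t] Y.order_le[OF Y.faceD(1)[OF p(1)] a] by simp
        have 2: "fst p + real (m j) * snd p \<le> fst t + real (m j) * snd t"
          using Y.faceD(2)[OF p(1)] Y.order_le[OF Y.faceD(1)[OF t] mj] by simp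
        have "0 \<le> (real (m j) - a) * (snd t - snd p)" using 1 2 by (simp add: algebra_simps)
        then have st: "snd p \<le> snd t" using am by (simp add: zero_le_mult_iff)
        then have "a * snd p \<le> a * snd t" using a by simp
        then have "fst t \<le> fst p" using 1 by linarith
        then show ?thesis using pd p(2) st by linarith
      qed
      then have "real (order \<gamma> (weighted_part (puiseux_coeff \<sigma> 1 \<rho>j) a (Y.\<nu> a))) \<le> Y.\<nu> a / (1 + a)"
        by (intro Y.order_le_above_diagonal[OF a \<gamma>])
      then show ?thesis
        using C(2,3) S Sj by (simp add: pcompose_idR)
    qed
  next
    case False
    then have big: "\<And>j. j \<in> I \<Longrightarrow> real (m j) < a" by force
    \<comment> \<open>Strictly increasing exponents \<open>m j\<close> would eventually exceed
      \<open>a\<close>, so here the algorithm has terminated.\<close>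
    have "I \<noteq> UNIV"
    proof
      assume IU: "I = UNIV"
      then have "strict_mono m" using V unfolding varchenko_steps_def by simp
      then have "j \<le> m j" for j by (rule strict_mono_imp_increasing)
      then have "real j < a" for j using big[of j] IU by (metis UNIV_I le_less_trans of_nat_mono)
      then show False using reals_Archimedean2[of a] less_asym by blast
    qed
    then obtain K where K: "I = {..<K}" "adapted \<rho>" "\<psi> = jet_sum m b K"
      using I unfolding \<rho>_def by blast
    have nd: "newton_distance \<rho> = X.distance"
      using newton_distance_eq[OF X] S by simp
    consider (above) "\<And>p. p \<in> X.face a \<Longrightarrow> fst p \<le> snd p" | (below) "\<And>p. p \<in> X.face a \<Longrightarrow> snd p \<le> fst p"
      | (mixed) p p' where "p \<in> X.face a" "fst p < snd p" "p' \<in> X.face a" "snd p' < fst p'"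
      by (meson not_le)
    then show ?thesis
    proof cases
      case above
      then show ?thesis by (intro X.order_le_above_diagonal[OF a \<gamma>])
    next
      case below
      then show ?thesis by (intro X.order_le_below_diagonal[OF a \<gamma>])
    next
      case (mixed p p')
      have dist: "X.distance = X.\<nu> a / (1 + a)"
        by (rule X.diagonal_point_of_mixed_face(1)[OF a mixed])
      \<comment> \<open>Without any step this is the convention on the order of the coordinates;
        otherwise it follows from \<open>1 \<le> m 0\<close> and \<open>m 0 < a\<close>.\<close>
      have a1: "1 \<le> a"
      proof (cases "K = 0")
        case True
        then have "\<psi> = (\<lambda>_. 0)" using K(3) by (simp add: jet_sum_def)
        then have "\<rho> = \<phi>" by (simp add: \<rho>_def shear_zero)
        then show ?thesis
          using normalized_order_mixed[OF X _ a, of p p'] \<phi>(4) mixed S by simp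
      next
        case False
        then show ?thesis using big[of 0] m0[of 0] K(1) by simp
      qed
      show ?thesis
      proof (cases "\<exists>k::nat. a = real k")
        case True
        then obtain k :: nat where k: "a = real k" by blast
        have "k > 0" using a k by simp
        from adapted_multiplicity[OF \<rho>(1) ft \<rho>(2) K(2) \<sigma> this, of \<gamma>] show ?thesis
          using dist nd k S by simp
      next
        case False
        then show ?thesis by (intro X.order_le_nonintegral[OF a1 \<gamma>]) blast
      qed
    qed
  qed
  then show "real (order \<gamma> (initial_part \<sigma> (shear \<phi> \<psi>) a))
      \<le> taylor_order (shear \<phi> \<psi>) a / (1 + a)"
    using S unfolding \<rho>_def by simp
qed

section \<open>Fractional heights\<close>

text \<open>Evaluates the height through a single expansion \<open>c\<close>. The order at
  \<open>m0\<close> is that of \<open>\<phi>\<close> itself, since a shear of size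
  \<open>x^m0\<close> merely translates the initial polynomial of this slope.\<close>

lemma fractional_shear_expansion:
  assumes \<phi>: "smooth_near_0 \<phi>" "finite_type \<phi>" "\<phi> (0, 0) = 0" and \<sigma>: "\<bar>\<sigma>\<bar> = 1"
    and rep: "fractional_rep {x. 0 < \<sigma> * x} f q g" and g0: "g 0 = 0"
    and m0: "m0 > 0" "leading_exponent {x. 0 < \<sigma> * x} f = m0"
    and lim: "((\<lambda>x. f (\<sigma> * x) / x powr m0) \<longlongrightarrow> \<gamma>) (at_right 0)"
  shows "\<exists>c. newton_support q (coeff_support c) \<and> puiseux_expansion (\<lambda>x y. shear \<phi> f (\<sigma> * x, y)) c \<and>
    fractional_height {x. 0 < \<sigma> * x} \<phi> f
      = max (weighted_order (coeff_support c) m0 / (1 + m0)) (Max (edge_heights m0 (newton_hull (coeff_support c)))) \<and>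
    weighted_order (coeff_support c) m0 = taylor_order \<phi> m0"
proof -
  note R = fractional_repD[OF rep \<sigma>]
  obtain r where r: "r > 0" "\<forall>x. 0 < x \<longrightarrow> x < r \<longrightarrow> f (\<sigma> * x) = g (root q x)" using R(3) by blast
  define G where "G = (\<lambda>p. \<phi> (\<sigma> * fst p ^ q, snd p + g (fst p)))"
  have G: "smooth_near_0 G" unfolding G_def by (rule smooth_near_0_fractional_shear[OF \<phi>(1) R(2) g0 R(1)])
  have eq: "shear \<phi> f (\<sigma> * x, y) = G (root q x, y)" if "0 < x" "x < r" "\<bar>y\<bar> < r" for x y
    using r(2) that R(1) by (simp add: shear_def G_def)
  define c where "c = puiseux_coeff 1 q G"
  have P: "puiseux_expansion (\<lambda>x y. shear \<phi> f (\<sigma> * x, y)) c" "puiseux_support {x. 0 < \<sigma> * x} (shear \<phi> f) = coeff_support c"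
    unfolding c_def by (rule puiseux_support_eq[OF \<sigma> R(1) G r(1)], erule (2) eq)+
  have S: "taylor_support \<phi> = coeff_support (puiseux_coeff \<sigma> 1 \<phi>)"
    using \<sigma> by (intro taylor_support_eq_coeff_support) auto
  have ne: "coeff_support (puiseux_coeff \<sigma> 1 \<phi>) \<noteq> {}"
    using \<phi>(2) unfolding finite_type_iff S .
  have eq': "shear \<phi> f (\<sigma> * x, y) = \<phi> (\<sigma> * x, y + f (\<sigma> * x))" for x y by (simp add: shear_def)
  note T = puiseux_expansion_shear[OF puiseux_expansion_half_plane[OF \<phi>(1) \<sigma>] P(1) ne m0(1) zero_less_one eq' lim]
  have lat: "lattice_set q (coeff_support c)" unfolding c_def by (rule lattice_puiseux_coeff[OF R(1)])
  interpret Y: newton_support 1 "taylor_support \<phi>" by (rule newton_support_taylor[OF \<phi>(2,3)])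
  have wo: "weighted_order (coeff_support c) m0 = Y.\<nu> m0" using T(2) S by simp
  have or: "(0, 0) \<notin> coeff_support c"
  proof
    assume "(0, 0) \<in> coeff_support c"
    from weighted_order_attained(2)[OF lat T(1) m0(1) this] show False
      using wo Y.order_pos[OF m0(1)] by simp
  qed
  interpret X: newton_support q "coeff_support c" by (rule newton_support.intro[OF lat T(1) or])
  have "fractional_height {x. 0 < \<sigma> * x} \<phi> f
      = max (X.\<nu> m0 / (1 + m0)) (Max (edge_heights m0 (newton_hull (coeff_support c))))"
    unfolding fractional_height_def Let_def P(2) m0(2) X.supporting_distance[OF m0(1)] ..
  then show ?thesis using X.newton_support_axioms P(1) wo by blast
qed

lemma fractional_comparison:
  assumes \<phi>: "smooth_near_0 \<phi>" "finite_type \<phi>" and \<psi>: "smooth_near_0 \<psi>" "\<psi> 0 = 0" and \<sigma>: "\<bar>\<sigma>\<bar> = 1"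
    and c: "puiseux_expansion (\<lambda>x y. shear \<phi> f (\<sigma> * x, y)) c" and a: "a > 0"
    and lim: "((\<lambda>x. (f (\<sigma> * x) - \<psi> (\<sigma> * x)) / x powr a) \<longlongrightarrow> \<gamma>) (at_right 0)"
  shows "weighted_order (coeff_support c) a = taylor_order (shear \<phi> \<psi>) a"
    and "weighted_part c a (taylor_order (shear \<phi> \<psi>) a) = pcompose
      (initial_part \<sigma> (shear \<phi> \<psi>) a) [:\<gamma>, 1:]"
proof -
  have S: "taylor_support (shear \<phi> \<psi>) = coeff_support (puiseux_coeff \<sigma> 1 (shear \<phi> \<psi>))"
    using \<sigma> by (intro taylor_support_eq_coeff_support) auto
  have ne: "coeff_support (puiseux_coeff \<sigma> 1 (shear \<phi> \<psi>)) \<noteq> {}"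
    using finite_type_shear[OF \<phi> \<psi>] unfolding finite_type_iff S .
  have eq: "shear \<phi> f (\<sigma> * x, y) = shear \<phi> \<psi> (\<sigma> * x, y + (f (\<sigma> * x) - \<psi> (\<sigma> * x)))" for x y
    by (simp add: shear_def)
  note T = puiseux_expansion_shear[OF puiseux_expansion_half_plane[OF smooth_near_0_shear[OF \<phi>(1) \<psi>] \<sigma>] c ne a
      zero_less_one eq lim]
  show "weighted_order (coeff_support c) a = taylor_order (shear \<phi> \<psi>) a"
    using T(2) S by simp
  show "weighted_part c a (taylor_order (shear \<phi> \<psi>) a) = pcompose
      (initial_part \<sigma> (shear \<phi> \<psi>) a) [:\<gamma>, 1:]"
    using T(3) S by simp
qed

text \<open>The translated initial polynomial contains a power \<open>b\<close> of \<open>x2\<close>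
  not exceeding the multiplicity of \<open>\<gamma>\<close>, hence \<open>b \<le> D\<close>. The
  single support point \<open>(\<nu> - a b, b)\<close> bounds the order at every later slope by
  \<open>\<nu> + (a' - a) D\<close>, which equals \<open>(1 + a') D\<close>.\<close>

lemma order_after_branching:
  assumes \<phi>: "smooth_near_0 \<phi>" "finite_type \<phi>" "\<phi> (0, 0) = 0" and \<psi>: "smooth_near_0 \<psi>" "\<psi> 0 = 0" and \<sigma>: "\<bar>\<sigma>\<bar> = 1"
    and c: "puiseux_expansion (\<lambda>x y. shear \<phi> f (\<sigma> * x, y)) c" "newton_support q (coeff_support c)" and a: "a > 0"
    and lim: "((\<lambda>x. (f (\<sigma> * x) - \<psi> (\<sigma> * x)) / x powr a) \<longlongrightarrow> \<gamma>) (at_right 0)" "\<gamma> \<noteq> 0"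
    and heavy: "no_heavy_roots (shear \<phi> \<psi>)" and aa': "a \<le> a'"
  shows "weighted_order (coeff_support c) a' \<le> (1 + a') * (taylor_order (shear \<phi> \<psi>) a / (1 + a))"
proof -
  interpret X: newton_support q "coeff_support c" by (rule c(2))
  let ?\<nu> = "taylor_order (shear \<phi> \<psi>) a"
  let ?P = "weighted_part (puiseux_coeff \<sigma> 1 (shear \<phi> \<psi>)) a ?\<nu>"
  define D where "D = ?\<nu> / (1 + a)"
  have S: "taylor_support (shear \<phi> \<psi>) = coeff_support (puiseux_coeff \<sigma> 1 (shear \<phi> \<psi>))"
    using \<sigma> by (intro taylor_support_eq_coeff_support) auto
  note C = fractional_comparison[OF \<phi>(1,2) \<psi> \<sigma> c(1) a lim(1)]
  have "?P \<noteq> 0"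
  proof -
    have "coeff_support (puiseux_coeff \<sigma> 1 (shear \<phi> \<psi>)) \<noteq> {}"
      using finite_type_shear[OF \<phi>(1,2) \<psi>] unfolding finite_type_iff S .
    from weighted_part_order_nonzero[OF lattice_puiseux_coeff[OF zero_less_one] this a] show ?thesis
      unfolding S .
  qed
  from translated_coeffs(1)[OF X.lattice a C(2) this]
  obtain b where b: "b \<le> order \<gamma> ?P" "(?\<nu> - a * real b, real b) \<in> coeff_support c" by blast
  have "real (order \<gamma> ?P) \<le> D"
    using heavy \<sigma> a lim(2) unfolding no_heavy_roots_def D_def by blast
  then have bD: "real b \<le> D" using b(1) by simp
  have "X.\<nu> a' \<le> ?\<nu> - a * real b + a' * real b"
    using X.order_le[OF b(2), of a'] a aa' by simp
  moreover have "(a' - a) * real b \<le> (a' - a) * D" using bD aa' by (intro mult_left_mono) auto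
  moreover have "?\<nu> = (1 + a) * D" using a by (simp add: D_def)
  ultimately show ?thesis unfolding D_def[symmetric] by (simp add: algebra_simps)
qed

text \<open>At a slope where \<open>\<psi>\<close> is \<open>O(x^a)\<close> the order of the sheared
  function is still that of \<open>\<phi>\<close>, so \<open>D\<close> is at most the distance of
  \<open>\<phi>\<close>. This covers the curves leaving \<open>\<psi>\<close> at or before its first
  exponent and, with \<open>\<psi> = 0\<close>, the adapted case.\<close>

lemma fractional_height_le_distance:
  assumes \<phi>: "smooth_near_0 \<phi>" "finite_type \<phi>" "\<phi> (0, 0) = 0" and \<psi>: "smooth_near_0 \<psi>" "\<psi> 0 = 0" and \<sigma>: "\<bar>\<sigma>\<bar> = 1"
    and rep: "fractional_rep {x. 0 < \<sigma> * x} f q g" and g0: "g 0 = 0"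
    and m0: "leading_exponent {x. 0 < \<sigma> * x} f = m0"
    and lim_f: "((\<lambda>x. f (\<sigma> * x) / x powr m0) \<longlongrightarrow> \<gamma>0) (at_right 0)"
    and a: "0 < a" "a \<le> m0"
    and lim: "((\<lambda>x. (f (\<sigma> * x) - \<psi> (\<sigma> * x)) / x powr a) \<longlongrightarrow> \<gamma>) (at_right 0)" "\<gamma> \<noteq> 0"
    and lim_\<psi>: "((\<lambda>x. (\<psi> (\<sigma> * x) - 0) / x powr a) \<longlongrightarrow> \<gamma>1) (at_right 0)"
    and heavy: "no_heavy_roots (shear \<phi> \<psi>)"
  shows "fractional_height {x. 0 < \<sigma> * x} \<phi> f \<le> newton_distance \<phi>"
proof -
  have m0': "m0 > 0" using a by simp
  obtain c where c: "newton_support q (coeff_support c)" "puiseux_expansion (\<lambda>x y. shear \<phi> f (\<sigma> * x, y)) c"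
    "fractional_height {x. 0 < \<sigma> * x} \<phi> f
      = max (weighted_order (coeff_support c) m0 / (1 + m0)) (Max (edge_heights m0 (newton_hull (coeff_support c))))"
    using fractional_shear_expansion[OF \<phi> \<sigma> rep g0 m0' m0 lim_f] by blast
  interpret X: newton_support q "coeff_support c" by (rule c(1))
  have Y: "newton_support 1 (taylor_support \<phi>)" by (rule newton_support_taylor[OF \<phi>(2,3)])
  interpret Y: newton_support 1 "taylor_support \<phi>" by (rule Y)
  have ft: "finite_type (shear \<phi> (\<lambda>_. 0))" using \<phi>(2) by (simp add: shear_zero)
  have \<nu>: "taylor_order (shear \<phi> \<psi>) a = Y.\<nu> a"
    using shear_comparison(2)[OF \<phi>(1) smooth_near_0_const[of 0] refl \<psi> ft \<sigma> a(1) lim_\<psi>] by (simp add: shear_zero)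
  define D where "D = newton_distance \<phi>"
  have DY: "D = Y.distance" unfolding D_def by (rule newton_distance_eq[OF Y])
  have D: "Y.\<nu> a / (1 + a) \<le> D"
    using Y.order_le_distance[OF a(1)] a(1) DY by (simp add: pos_divide_le_eq mult.commute)
  \<comment> \<open>The right-hand side is \<open>(1 + a') * D + (a' - m0)\<close>, so the bound
    \<open>(1 + a') * D\<close> suffices.\<close>
  have "X.\<nu> a' \<le> (D - m0) + a' * (D + 1)" if "m0 \<le> a'" for a'
  proof -
    have "X.\<nu> a' \<le> (1 + a') * (Y.\<nu> a / (1 + a))"
      using order_after_branching[OF \<phi> \<psi> \<sigma> c(2,1) a(1) lim heavy, of a'] that a unfolding \<nu> by simp
    also have "\<dots> \<le> (1 + a') * D" using D that m0' by (intro mult_left_mono) auto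
    finally show ?thesis using that by (simp add: algebra_simps)
  qed
  then show ?thesis
    unfolding c(3) D_def[symmetric] using X.max_edge_heights_le_iff[OF m0'] by blast
qed

text \<open>Both disjuncts are unified by an index set \<open>I\<close> of steps. Since
  \<open>\<phi>\<close> is not adapted there is a first step, with positive exponent, and later
  exponents are larger.\<close>

lemma principal_root_jetD:
  assumes \<phi>: "smooth_near_0 \<phi>" "finite_type \<phi>" "\<phi> (0, 0) = 0" and na: "\<not> adapted \<phi>"
    and J: "principal_root_jet \<phi> \<psi>"
  shows "\<exists>m b I. varchenko_steps \<phi> m b I \<and> smooth_near_0 \<psi> \<and> \<psi> 0 = 0 \<and> 0 \<in> I \<and>
    (\<forall>j\<in>I. jet_remainder m b \<psi> j \<and> 1 \<le> m j) \<and>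
    (I = UNIV \<or> (\<exists>K. I = {..<K} \<and> adapted (shear \<phi> \<psi>) \<and> \<psi> = jet_sum m b K)) \<and> varchenko_root \<phi> (m 0) (b 0)"
proof -
  have Y: "newton_support 1 (taylor_support \<phi>)" by (rule newton_support_taylor[OF \<phi>(2,3)])
  have jet0: "jet_sum m b 0 = (\<lambda>_. 0)" for m b by (simp add: jet_sum_def)
  have steps: "varchenko_root \<phi> (m 0) (b 0) \<and> (\<forall>j\<in>I. 1 \<le> m j)"
    if V: "varchenko_steps \<phi> m b I" and 0: "0 \<in> I" for m b I
  proof -
    have root: "varchenko_root \<phi> (m 0) (b 0)"
      using bspec[OF conjunct2[OF V[unfolded varchenko_steps_def]] 0] by (simp add: jet0 shear_zero)
    have "m 0 > 0" by (rule varchenko_rootD(1)[OF Y root])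
    moreover have "m 0 \<le> m j" if "j \<in> I" for j
      using strict_mono_onD[OF conjunct1[OF V[unfolded varchenko_steps_def]] 0 that] by (cases "j = 0") auto
    ultimately show ?thesis using root by fastforce
  qed
  consider (fin) m b K where "varchenko_steps \<phi> m b {..<K}" "adapted (shear \<phi> (jet_sum m b K))" "\<psi> = jet_sum m b K"
    | (inf) m b where "varchenko_steps \<phi> m b UNIV" "smooth_near_0 \<psi>" "\<forall>k. taylor_coeff1 \<psi> (m k) = b k"
      "\<forall>j. j \<notin> range m \<longrightarrow> taylor_coeff1 \<psi> j = 0"
    using J unfolding principal_root_jet_def by blast
  then show ?thesis
  proof cases
    case fin
    have "K \<noteq> 0"
    proof
      assume "K = 0"
      then show False using fin(2) na by (simp add: jet0 shear_zero)
    qed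
    then have 0: "0 \<in> {..<K}" by simp
    note st = steps[OF fin(1) 0]
    have "smooth_near_0 \<psi>" unfolding fin(3) by (rule smooth_near_0_jet_sum)
    moreover have "\<psi> 0 = 0" unfolding fin(3) jet_sum_def
    proof (rule sum.neutral, rule ballI)
      fix j assume "j \<in> {..<K}"
      then show "b j * 0 ^ m j = 0" using conjunct2[OF st, rule_format, of j] by simp
    qed
    moreover have "jet_remainder m b \<psi> j" if "j \<in> {..<K}" for j
      unfolding fin(3) using fin(1) that unfolding varchenko_steps_def by (intro jet_remainder_finite) auto
    ultimately show ?thesis
      using fin st 0 by (intro exI[of _ m] exI[of _ b] exI[of _ "{..<K}"]) auto
  next
    case inf
    have 0: "0 \<in> (UNIV :: nat set)" by simp
    note st = steps[OF inf(1) 0]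
    have "0 \<notin> range m"
    proof
      assume "0 \<in> range m"
      then obtain j where "m j = 0" by force
      then show False using conjunct2[OF st, rule_format, of j] by simp
    qed
    then have "taylor_coeff1 \<psi> 0 = 0" using inf(4) by blast
    then have "\<psi> 0 = 0" by (simp add: taylor_coeff1_def)
    moreover have "jet_remainder m b \<psi> j" for j
      using inf unfolding varchenko_steps_def by (intro jet_remainder_infinite) auto
    ultimately show ?thesis
      using inf st by (intro exI[of _ m] exI[of _ b] exI[of _ UNIV]) auto
  qed
qed

text \<open>Up to the branching slope the orders along \<open>f\<close> and \<open>\<psi>\<close>
  agree, so the bounds encoded in \<open>R\<close> carry over; after it
  \<open>order_after_branching\<close> takes over. The supremum is attained at
  \<open>f = \<psi>\<close>.\<close>

lemma fractional_height_nonadapted: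
  assumes \<phi>: "smooth_near_0 \<phi>" "finite_type \<phi>" "\<phi> (0, 0) = 0" "normalized_order \<phi>" and na: "\<not> adapted \<phi>"
    and J: "principal_root_jet \<phi> \<psi>"
  shows "fractional_shear H f \<Longrightarrow> fractional_height H \<phi> f \<le> r_height \<phi> \<psi>"
    and "fractional_shear {0<..} \<psi>" "fractional_height {0<..} \<phi> \<psi> = r_height \<phi> \<psi>"
proof -
  obtain mm b I where V: "varchenko_steps \<phi> mm b I" and \<psi>: "smooth_near_0 \<psi>" "\<psi> 0 = 0" and I: "0 \<in> I"
    "\<And>j. j \<in> I \<Longrightarrow> jet_remainder mm b \<psi> j" "\<And>j. j \<in> I \<Longrightarrow> 1 \<le> mm j"
    "I = UNIV \<or> (\<exists>K. I = {..<K} \<and> adapted (shear \<phi> \<psi>) \<and> \<psi> = jet_sum mm b K)"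
    and root: "varchenko_root \<phi> (mm 0) (b 0)"
    using principal_root_jetD[OF \<phi>(1-3) na J] by blast
  have heavy: "no_heavy_roots (shear \<phi> \<psi>)"
    by (rule no_heavy_roots_jet[OF \<phi> V \<psi> I(2,4,3)])
  have Y: "newton_support 1 (taylor_support \<phi>)" by (rule newton_support_taylor[OF \<phi>(2,3)])
  define m where "m = real (mm 0)"
  have m: "m > 0" using varchenko_rootD(1)[OF Y root] by (simp add: m_def)
  have slope: "principal_slope \<phi> = m" using root by (simp add: varchenko_root_def m_def)
  have b0: "b 0 \<noteq> 0" using root by (simp add: varchenko_root_def)
  define \<rho> where "\<rho> = shear \<phi> \<psi>"
  have Z: "newton_support 1 (taylor_support \<rho>)"
    using newton_support_taylor[of \<rho>] finite_type_shear[OF \<phi>(1,2) \<psi>] shear_at_0[of \<psi> \<phi>] \<psi>(2) \<phi>(3) by (simp add: \<rho>_def)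
  interpret Z: newton_support 1 "taylor_support \<rho>" by (rule Z)
  have lim_\<psi>: "((\<lambda>x. (\<psi> (\<sigma> * x) - 0) / x powr m) \<longlongrightarrow> b 0 * \<sigma> ^ mm 0) (at_right 0)"
    if "\<bar>\<sigma>\<bar> = 1" for \<sigma>
    using jet_limit[OF I(2)[OF I(1)] that] by (simp add: jet_sum_def m_def)
  have ft: "finite_type (shear \<phi> (\<lambda>_. 0))" using \<phi>(2) by (simp add: shear_zero)
  have "Z.\<nu> m = taylor_order \<phi> m"
    using shear_comparison(2)[OF \<phi>(1) smooth_near_0_const[of 0] refl \<psi> ft _ m lim_\<psi>[of 1]] by (simp add: shear_zero \<rho>_def)
  then have d: "newton_distance \<phi> = Z.\<nu> m / (1 + m)"
    using varchenko_rootD(2)[OF Y root] m by (simp add: m_def)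
  define R where "R = r_height \<phi> \<psi>"
  have R_eq: "R = max (Z.\<nu> m / (1 + m)) (Max (edge_heights m (newton_hull (taylor_support \<rho>))))"
    unfolding R_def r_height_def slope d newton_polyhedron_def \<rho>_def ..
  have R: "Z.\<nu> a \<le> (R - m) + a * (R + 1)" if "m \<le> a" for a
    using Z.max_edge_heights_le_iff[OF m, of R] R_eq that by simp
  have dR: "newton_distance \<phi> \<le> R" using R_eq d by simp
  show "fractional_height H \<phi> f \<le> r_height \<phi> \<psi>" if f: "fractional_shear H f"
  proof -
    obtain \<sigma> q g m0 \<gamma>0 where \<sigma>: "\<bar>\<sigma>\<bar> = 1" and H: "H = {x. 0 < \<sigma> * x}"
      and rep: "fractional_rep {x. 0 < \<sigma> * x} f q g" and g0: "g 0 = 0"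
      and m0: "leading_exponent {x. 0 < \<sigma> * x} f = m0" "m0 > 0" and \<gamma>0: "\<gamma>0 \<noteq> 0"
      and lim_f: "((\<lambda>x. f (\<sigma> * x) / x powr m0) \<longlongrightarrow> \<gamma>0) (at_right 0)"
      using fractional_shear_data[OF f] by blast
    define \<delta> where "\<delta> x = f (\<sigma> * x) - \<psi> (\<sigma> * x)" for x
    define \<gamma>1 where "\<gamma>1 = b 0 * \<sigma> ^ mm 0"
    have \<gamma>1: "\<gamma>1 \<noteq> 0" using b0 \<sigma> by (auto simp: \<gamma>1_def)
    have lim1: "((\<lambda>x. (\<psi> (\<sigma> * x) - 0) / x powr m) \<longlongrightarrow> \<gamma>1) (at_right 0)"
      unfolding \<gamma>1_def by (rule lim_\<psi>[OF \<sigma>])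
    have lim_sum: "((\<lambda>x. f (\<sigma> * x) / x powr a) \<longlongrightarrow> l + l') (at_right 0)"
      if "((\<lambda>x. \<delta> x / x powr a) \<longlongrightarrow> l) (at_right 0)" "((\<lambda>x. (\<psi> (\<sigma> * x) - 0) / x powr a) \<longlongrightarrow> l') (at_right 0)"
      for a l l'
      using tendsto_add[OF that] by (simp add: \<delta>_def add_divide_distrib[symmetric])
    note Rp = fractional_repD[OF rep \<sigma>]
    obtain r where r: "r > 0" "\<forall>x. 0 < x \<longrightarrow> x < r \<longrightarrow> f (\<sigma> * x) = g (root q x)" using Rp(3) by blast
    \<comment> \<open>The difference of the two curves in the variable
      \<open>s = \<bar>x1\<bar>^(1/q)\<close>, where it is smooth; so it is flat or has a leading
      term.\<close>
    define h where "h = (\<lambda>s. g s + (- 1) * \<psi> (\<sigma> * s ^ q))"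
    have h: "smooth_near_0 h" "h 0 = 0"
    proof -
      show "smooth_near_0 h" unfolding h_def
        by (intro smooth_near_0_add[OF Rp(2) smooth_near_0_mult[OF smooth_near_0_const smooth_near_0_scale[OF \<psi>(1) Rp(1)]]])
      show "h 0 = 0" using g0 \<psi>(2) Rp(1) by (simp add: h_def power_0_left)
    qed
    have \<delta>h: "\<delta> x = h (root q x)" if "0 < x" "x < r" for x
      using r(2) that Rp(1) by (simp add: \<delta>_def h_def)
    have late: ?thesis
      if m0m: "m0 = m" and bound: "\<And>c a. puiseux_expansion (\<lambda>x y. shear \<phi> f (\<sigma> * x, y)) c \<Longrightarrow>
        newton_support q (coeff_support c) \<Longrightarrow> m \<le> a \<Longrightarrow> weighted_order (coeff_support c) a \<le> (R - m) + a * (R + 1)"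
    proof -
      obtain c where c: "newton_support q (coeff_support c)" "puiseux_expansion (\<lambda>x y. shear \<phi> f (\<sigma> * x, y)) c"
        "fractional_height {x. 0 < \<sigma> * x} \<phi> f
          = max (weighted_order (coeff_support c) m0 / (1 + m0)) (Max (edge_heights m0 (newton_hull (coeff_support c))))"
        using fractional_shear_expansion[OF \<phi>(1-3) \<sigma> rep g0 m0(2,1) lim_f] by blast
      interpret X: newton_support q "coeff_support c" by (rule c(1))
      show ?thesis
        unfolding H c(3) R_def[symmetric] m0m
        using X.max_edge_heights_le_iff[OF m, of R] bound[OF c(2,1)] by blast
    qed
    from fractional_dichotomy[OF h Rp(1) r(1) \<delta>h]
    consider (flat) "\<forall>a. ((\<lambda>x. \<delta> x / x powr a) \<longlongrightarrow> 0) (at_right 0)"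
      | (lead) k where "k > 0" "taylor_coeff1 h k \<noteq> 0"
        "((\<lambda>x. \<delta> x / x powr (real k / real q)) \<longlongrightarrow> taylor_coeff1 h k) (at_right 0)"
      by blast
    then show ?thesis
    proof cases
      case flat
      have "((\<lambda>x. f (\<sigma> * x) / x powr m) \<longlongrightarrow> 0 + \<gamma>1) (at_right 0)"
        by (rule lim_sum[OF flat[rule_format] lim1])
      then have "m0 = m"
        using leading_exponent_unique[OF _ lim_f] leading_exponent_unique[OF lim_f _ \<gamma>0] \<gamma>1 by force
      then show ?thesis
      proof (rule late)
        fix c a assume c: "puiseux_expansion (\<lambda>x y. shear \<phi> f (\<sigma> * x, y)) c" and ma: "m \<le> a"
        have "a > 0" using m ma by simp
        from fractional_comparison(1)[OF \<phi>(1,2) \<psi> \<sigma> c this flat[rule_format, unfolded \<delta>_def]]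
        show "weighted_order (coeff_support c) a \<le> (R - m) + a * (R + 1)"
          using R[OF ma] by (simp add: \<rho>_def)
      qed
    next
      case (lead k)
      define a where "a = real k / real q"
      define \<gamma> where "\<gamma> = taylor_coeff1 h k"
      have a: "a > 0" using lead(1) Rp(1) by (simp add: a_def)
      have \<gamma>: "\<gamma> \<noteq> 0" using lead(2) by (simp add: \<gamma>_def)
      have lim_\<delta>: "((\<lambda>x. \<delta> x / x powr a) \<longlongrightarrow> \<gamma>) (at_right 0)"
        using lead(3) by (simp add: a_def \<gamma>_def)
      note lim_\<delta>' = lim_\<delta>[unfolded \<delta>_def]
      show ?thesis
      proof (cases "a \<le> m")
        case True
        obtain \<gamma>' where \<gamma>': "((\<lambda>x. (\<psi> (\<sigma> * x) - 0) / x powr a) \<longlongrightarrow> \<gamma>') (at_right 0)"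
          using lim1 powr_limit_lower[OF lim1, of a] True by (cases "a = m") auto
        \<comment> \<open>Both \<open>f - \<psi>\<close> and \<open>\<psi>\<close> are
          \<open>O(x^a)\<close>, hence so is \<open>f\<close>.\<close>
        have "a \<le> m0"
          by (rule leading_exponent_unique[OF lim_f lim_sum[OF lim_\<delta> \<gamma>'] \<gamma>0])
        from fractional_height_le_distance[OF \<phi>(1-3) \<psi> \<sigma> rep g0 m0(1) lim_f a this lim_\<delta>' \<gamma> \<gamma>' heavy]
        show ?thesis using dR unfolding H R_def by simp
      next
        case False
        then have ma: "m < a" by simp
        have "((\<lambda>x. f (\<sigma> * x) / x powr m) \<longlongrightarrow> 0 + \<gamma>1) (at_right 0)"
          by (rule lim_sum[OF powr_limit_lower[OF lim_\<delta> ma] lim1])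
        then have "m0 = m"
          using leading_exponent_unique[OF _ lim_f] leading_exponent_unique[OF lim_f _ \<gamma>0] \<gamma>1 by force
        then show ?thesis
        proof (rule late)
          fix c a' assume c: "puiseux_expansion (\<lambda>x y. shear \<phi> f (\<sigma> * x, y)) c" "newton_support q (coeff_support c)"
            and a': "m \<le> a'"
          have a'0: "a' > 0" using m a' by simp
          show "weighted_order (coeff_support c) a' \<le> (R - m) + a' * (R + 1)"
          proof (cases "a' \<le> a")
            case True
            have "\<exists>l. ((\<lambda>x. (f (\<sigma> * x) - \<psi> (\<sigma> * x)) / x powr a') \<longlongrightarrow> l) (at_right 0)"
              using lim_\<delta>' powr_limit_lower[OF lim_\<delta>', of a'] True by (cases "a' = a") auto
            then obtain l where "((\<lambda>x. (f (\<sigma> * x) - \<psi> (\<sigma> * x)) / x powr a') \<longlongrightarrow> l) (at_right 0)" ..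
            from fractional_comparison(1)[OF \<phi>(1,2) \<psi> \<sigma> c(1) a'0 this] show ?thesis
              using R[OF a'] by (simp add: \<rho>_def)
          next
            case False
            then have "a \<le> a'" by simp
            from order_after_branching[OF \<phi>(1-3) \<psi> \<sigma> c a lim_\<delta>' \<gamma> heavy this]
            have "weighted_order (coeff_support c) a' \<le> (1 + a') * (Z.\<nu> a / (1 + a))" by (simp add: \<rho>_def)
            also have "\<dots> \<le> (R - m) + a' * (R + 1)"
            proof -
              have "(1 + a') * Z.\<nu> a \<le> (1 + a') * ((R - m) + a * (R + 1))"
                using R[of a] ma a'0 by (intro mult_left_mono) auto
              \<comment> \<open>The two sides differ by \<open>(1 + m) * (a' - a)\<close>: the
                quotient of \<open>(R - m) + a * (R + 1)\<close> by \<open>1 + a\<close> increases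
                with \<open>a\<close>.\<close>
              also have "\<dots> \<le> ((R - m) + a' * (R + 1)) * (1 + a)"
              proof -
                have "0 \<le> (1 + m) * (a' - a)" using m \<open>a \<le> a'\<close> by simp
                then show ?thesis by (simp add: algebra_simps)
              qed
              finally have "(1 + a') * Z.\<nu> a / (1 + a) \<le> (R - m) + a' * (R + 1)"
                using a by (simp add: pos_divide_le_eq)
              then show ?thesis by simp
            qed
            finally show ?thesis .
          qed
        qed
      qed
    qed
  qed
  let ?H = "{x. 0 < 1 * (x::real)}"
  have H: "{0<..} = ?H" by auto
  have one: "\<bar>1::real\<bar> = 1" by simp
  have rep: "fractional_rep ?H \<psi> 1 \<psi>"
    unfolding fractional_rep_def eventually_at_half_line[OF one] using \<psi>(1) by (auto intro!: exI[of _ 1])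
  have lim: "((\<lambda>x. \<psi> (1 * x) / x powr m) \<longlongrightarrow> b 0) (at_right 0)" using lim_\<psi>[of 1] by simp
  have \<psi>0: "(\<psi> \<longlongrightarrow> 0) (at 0 within ?H)"
  proof -
    obtain U where U: "open U" "0 \<in> U" "\<forall>n. Ck_on n U \<psi>" by (rule smooth_near_0E[OF \<psi>(1)])
    have "continuous_on U \<psi>" using spec[OF U(3), of 0] by simp
    then have "isCont \<psi> 0" using U continuous_on_eq_continuous_at by blast
    then have "(\<psi> \<longlongrightarrow> 0) (at 0)" using \<psi>(2) by (simp add: isCont_def)
    then show ?thesis by (rule tendsto_within_subset) simp
  qed
  show "fractional_shear {0<..} \<psi>"
    unfolding fractional_shear_def
    using rep not_flat_of_limit[OF one lim b0] \<psi>0 unfolding H by blast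
  have le: "leading_exponent ?H \<psi> = m" by (rule leading_exponent_eq[OF one rep \<psi>0 lim b0])
  obtain c where c: "puiseux_expansion (\<lambda>x y. shear \<phi> \<psi> (1 * x, y)) c"
    "fractional_height ?H \<phi> \<psi>
      = max (weighted_order (coeff_support c) m / (1 + m)) (Max (edge_heights m (newton_hull (coeff_support c))))"
    using fractional_shear_expansion[OF \<phi>(1-3) one rep \<psi>(2) m le lim] by blast
  \<comment> \<open>For the smooth curve \<open>\<psi>\<close> the Puiseux and the Taylor expansion
    coincide, so the polyhedron is the one in \<open>r_height\<close>.\<close>
  have "c = puiseux_coeff 1 1 (shear \<phi> \<psi>)"
    by (rule puiseux_expansion_unique[OF c(1) puiseux_expansion_half_plane[OF smooth_near_0_shear[OF \<phi>(1) \<psi>] one]])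
  then have "coeff_support c = taylor_support \<rho>"
    using taylor_support_eq_coeff_support[of 1 \<rho>] by (simp add: \<rho>_def)
  then show "fractional_height {0<..} \<phi> \<psi> = r_height \<phi> \<psi>"
    unfolding H c(2) R_def[symmetric] R_eq by simp
qed

text \<open>Varchenko's algorithm makes no step, so \<open>\<psi> = 0\<close>, and a non-flat curve
  branches off at its own leading exponent.\<close>

lemma fractional_height_adapted:
  assumes \<phi>: "smooth_near_0 \<phi>" "finite_type \<phi>" "\<phi> (0, 0) = 0" "normalized_order \<phi>" and ad: "adapted \<phi>"
    and f: "fractional_shear H f"
  shows "fractional_height H \<phi> f \<le> newton_distance \<phi>"
proof -
  have z: "shear \<phi> (\<lambda>_. 0) = \<phi>" by (rule shear_zero)
  have V: "varchenko_steps \<phi> (\<lambda>_. 0) (\<lambda>_. 0) {..<0}" by (simp add: varchenko_steps_def)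
  have heavy: "no_heavy_roots (shear \<phi> (\<lambda>_. 0))"
    by (rule no_heavy_roots_jet[OF \<phi> V smooth_near_0_const[of 0] refl]) (use ad z in \<open>auto simp: jet_sum_def\<close>)
  obtain \<sigma> q g m0 \<gamma>0 where \<sigma>: "\<bar>\<sigma>\<bar> = 1" and H: "H = {x. 0 < \<sigma> * x}"
    and rep: "fractional_rep {x. 0 < \<sigma> * x} f q g" and g0: "g 0 = 0"
    and m0: "leading_exponent {x. 0 < \<sigma> * x} f = m0" "m0 > 0" and \<gamma>0: "\<gamma>0 \<noteq> 0"
    and lim_f: "((\<lambda>x. f (\<sigma> * x) / x powr m0) \<longlongrightarrow> \<gamma>0) (at_right 0)"
    using fractional_shear_data[OF f] by blast
  have "((\<lambda>x. (f (\<sigma> * x) - 0) / x powr m0) \<longlongrightarrow> \<gamma>0) (at_right 0)" using lim_f by simp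
  moreover have "((\<lambda>x::real. (0 - 0) / x powr m0) \<longlongrightarrow> 0) (at_right 0)" by simp
  ultimately show ?thesis
    unfolding H
    by (intro fractional_height_le_distance[OF \<phi>(1-3) smooth_near_0_const[of 0] refl \<sigma> rep g0 m0(1) lim_f m0(2) order_refl
          _ \<gamma>0 _ heavy])
qed

text \<open>For the curve \<open>x1^a\<close> the term \<open>d^f\<close> of the height is
  \<open>\<nu> a / (1 + a)\<close>, which rational slopes bring as close to the distance as
  desired.\<close>

lemma fractional_height_near_distance:
  assumes \<phi>: "smooth_near_0 \<phi>" "finite_type \<phi>" "\<phi> (0, 0) = 0" and r: "0 \<le> r" "r < newton_distance \<phi>"
  shows "\<exists>f. fractional_shear {0<..} f \<and> r < fractional_height {0<..} \<phi> f"
proof -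
  have Y: "newton_support 1 (taylor_support \<phi>)" by (rule newton_support_taylor[OF \<phi>(2,3)])
  interpret Y: newton_support 1 "taylor_support \<phi>" by (rule Y)
  have "r < Y.distance" using r(2) newton_distance_eq[OF Y] by simp
  then obtain m n :: nat where mn: "m > 0" "n > 0" "(1 + real m / real n) * r < Y.\<nu> (real m / real n)"
    using Y.order_near_distance[OF r(1)] by blast
  define a where "a = real m / real n"
  have a: "a > 0" using mn by (simp add: a_def)
  define f where "f = (\<lambda>x. root n \<bar>x\<bar> ^ m)"
  let ?H = "{x. 0 < 1 * (x::real)}"
  have H: "{0<..} = ?H" by auto
  have one: "\<bar>1::real\<bar> = 1" by simp
  have rep: "fractional_rep ?H f n (\<lambda>t. t ^ m)"
    unfolding fractional_rep_def f_def using mn(2) smooth_near_0_power[OF smooth_near_0_linear[OF bounded_linear_ident]]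
    by simp
  have lim: "((\<lambda>x. f (1 * x) / x powr a) \<longlongrightarrow> 1) (at_right 0)"
  proof (rule iffD2[OF tendsto_at_right_cong[OF zero_less_one, of _ "\<lambda>_. 1"] tendsto_const])
    fix x :: real assume "0 < x" "x < 1"
    then show "f (1 * x) / x powr a = 1"
      using mn(2) by (simp add: f_def a_def root_powr_inverse powr_powr powr_realpow[symmetric])
  qed
  have f0: "(f \<longlongrightarrow> 0) (at 0 within ?H)"
  proof -
    have "(f \<longlongrightarrow> root n \<bar>0\<bar> ^ m) (at 0 within ?H)"
      unfolding f_def by (intro tendsto_intros)
    then show ?thesis using mn by (simp add: power_0_left)
  qed
  have "fractional_shear {0<..} f"
    unfolding fractional_shear_def using rep not_flat_of_limit[OF one lim] f0 unfolding H by auto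
  moreover have "r < fractional_height ?H \<phi> f"
  proof -
    have le: "leading_exponent ?H f = a" by (rule leading_exponent_eq[OF one rep f0 lim]) simp
    obtain c where c: "fractional_height ?H \<phi> f
        = max (weighted_order (coeff_support c) a / (1 + a)) (Max (edge_heights a (newton_hull (coeff_support c))))"
      "weighted_order (coeff_support c) a = Y.\<nu> a"
      using fractional_shear_expansion[OF \<phi> one rep _ a le lim] mn(1) by (auto simp: power_0_left)
    have "r < Y.\<nu> a / (1 + a)" using mn(3) a unfolding a_def[symmetric] by (simp add: pos_less_divide_eq mult.commute)
    then show ?thesis unfolding c by simp
  qed
  ultimately show ?thesis unfolding H by blast
qed

theorem proposition1p9:
  fixes \<phi> :: "real \<times> real \<Rightarrow> real"
  assumes "smooth_near_0 \<phi>"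
    and "finite_type \<phi>"
    and "\<phi> (0, 0) = 0"
    and "(\<phi> has_derivative (\<lambda>_. 0)) (at (0, 0))"
    and "normalized_order \<phi>"
    and "linearly_adapted \<phi>"
  shows "(\<not> adapted \<phi> \<longrightarrow>
            (\<forall>\<psi>. principal_root_jet \<phi> \<psi> \<longrightarrow>
               (\<forall>H f. fractional_shear H f \<longrightarrow> fractional_height H \<phi> f \<le> r_height \<phi> \<psi>) \<and>
               ereal (r_height \<phi> \<psi>) = r_height_tilde \<phi>)) \<and>
         (adapted \<phi> \<longrightarrow>
            r_height_tilde \<phi> = ereal (newton_distance \<phi>) \<and>
            ereal (newton_distance \<phi>) = height \<phi>) \<and>
         (\<forall>\<psi>. (\<not> adapted \<phi> \<longrightarrow> principal_root_jet \<phi> \<psi>) \<longrightarrow>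
            critical_exponent \<phi> \<psi> = 2 * r_height_tilde \<phi> + 2)"
proof -
  have a1: "fractional_height H \<phi> f \<le> r_height \<phi> \<psi>"
    if "\<not> adapted \<phi>" "principal_root_jet \<phi> \<psi>" "fractional_shear H f" for \<psi> H f
    by (rule fractional_height_nonadapted(1)[OF assms(1-3,5) that])
  have a2: "ereal (r_height \<phi> \<psi>) = r_height_tilde \<phi>" if na: "\<not> adapted \<phi>" and J: "principal_root_jet \<phi> \<psi>" for \<psi>
  proof (rule antisym)
    note A = fractional_height_nonadapted(2,3)[OF assms(1-3,5) na J]
    show "ereal (r_height \<phi> \<psi>) \<le> r_height_tilde \<phi>"
      unfolding r_height_tilde_def using A by (intro SUP_upper2[of "({0<..}, \<psi>)"]) auto
    show "r_height_tilde \<phi> \<le> ereal (r_height \<phi> \<psi>)"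
      unfolding r_height_tilde_def using a1[OF na J] by (intro SUP_least) auto
  qed
  have b1: "r_height_tilde \<phi> = ereal (newton_distance \<phi>)" if ad: "adapted \<phi>"
  proof (rule antisym)
    show "r_height_tilde \<phi> \<le> ereal (newton_distance \<phi>)"
      unfolding r_height_tilde_def using fractional_height_adapted[OF assms(1-3,5) ad] by (intro SUP_least) auto
    have Y: "newton_support 1 (taylor_support \<phi>)" by (rule newton_support_taylor[OF assms(2,3)])
    have pos: "0 < newton_distance \<phi>"
      using newton_support.distance_pos[OF Y] newton_distance_eq[OF Y] by simp
    show "ereal (newton_distance \<phi>) \<le> r_height_tilde \<phi>"
      unfolding r_height_tilde_def le_SUP_iff
    proof (intro allI impI)
      fix y assume y: "y < ereal (newton_distance \<phi>)"
      \<comment> \<open>The approximation is available for nonnegative bounds, whereas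
        \<open>y\<close> may be negative or \<open>-\<infinity>\<close>.\<close>
      define r where "r = max 0 (real_of_ereal y)"
      have "r < newton_distance \<phi>" using y pos by (cases y) (auto simp: r_def)
      moreover have yr: "y \<le> ereal r" using y by (cases y) (auto simp: r_def)
      ultimately obtain f where f: "fractional_shear {0<..} f" "r < fractional_height {0<..} \<phi> f"
        using fractional_height_near_distance[OF assms(1-3), of r] by (auto simp: r_def)
      have "y < ereal (fractional_height {0<..} \<phi> f)" using yr f(2) le_less_trans[of y "ereal r"] by simp
      then show "\<exists>i\<in>{(H, f). fractional_shear H f}. y < (case i of (H, f) \<Rightarrow> ereal (fractional_height H \<phi> f))"
        using f(1) by (intro bexI[of _ "({0<..}, f)"]) auto
    qed
  qed
  have b2: "ereal (newton_distance \<phi>) = height \<phi>" if "adapted \<phi>" using that by (simp add: adapted_def)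
  have c: "critical_exponent \<phi> \<psi> = 2 * r_height_tilde \<phi> + 2" if "\<not> adapted \<phi> \<longrightarrow> principal_root_jet \<phi> \<psi>" for \<psi>
  proof (cases "adapted \<phi>")
    case True
    then show ?thesis using b1 b2 by (simp add: critical_exponent_def)
  next
    case False
    then have "r_height_tilde \<phi> = ereal (r_height \<phi> \<psi>)" using a2 that by simp
    then show ?thesis using False by (simp add: critical_exponent_def)
  qed
  show ?thesis using a1 a2 b1 b2 c by blast
qed

end
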